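(* Let $H$ be a real Hilbert space, $X\subset H$ a dense linear subspace, $V\subset H$ an open neighborhood of the origin $\theta$, and let $\mathcal{L}\in C^1(V,\mathbb{R})$ with $\mathcal{L}'(\theta)=0$ satisfy Hypothesis (A) of the context. Let $\mathcal{G}\in C^1(V,\mathbb{R})$ satisfy: (i) $\mathcal{G}'(\theta)=0$; (ii) the gradient $\nabla\mathcal{G}$ has a Gâteaux derivative $\mathcal{G}''(u)\in\mathscr{L}_s(H)$ at every $u\in V$, and $\mathcal{G}'':V\to\mathscr{L}_s(H)$ is continuous at $\theta$. Suppose that the critical point $\theta$ of $\mathcal{L}$ is nondegenerate, i.e. $\mathrm{Ker}\,B(\theta)=\{\theta\}$, so that $H=H^+\oplus H^-$. Then there exist $\rho>0$, $\epsilon>0$, a family $\{W_\lambda:|\lambda|\le\rho\}$ of open neighborhoods of $\theta$ in $H$ and a family of origin-preserving homeomorphisms $\phi_\lambda:B_{H^+}(\theta,\epsilon)+B_{H^-}(\theta,\epsilon)\to W_\lambda$, $|\lambda|\le\rho$, such that $$(\mathcal{L}+\lambda\mathcal{G})\circ\phi_\lambda(u^++u^-)=\|u^+\|^2-\|u^-\|^2\qquad\forall(u^+,u^-)\in B_{H^+}(\theta,\epsilon)\times B_{H^-}(\theta,\epsilon).$$ Moreover, the map $[-\rho,\rho]\times(B_{H^+}(\theta,\epsilon)+B_{H^-}(\theta,\epsilon))\ni(\lambda,u)\mapsto\phi_\lambda(u)\in H$ is continuous, and $\theta$ is an isolated critical point of each $\mathcal{L}+\lambda\mathcal{G}$, $|\lambda|\le\rho$.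 Finally, if $\hat H$ is a closed subspace of $H$ containing $H^-$ and $\hat H^+=\hat H\cap H^+$ is the orthogonal complement of $H^-$ in $\hat H$, then each $\phi_\lambda$ restricts to a homeomorphism $\hat\phi_\lambda:B_{\hat H^+}(\theta,\epsilon)+B_{H^-}(\theta,\epsilon)\to\hat W_\lambda:=W_\lambda\cap\hat H$, and $(\mathcal{L}+\lambda\mathcal{G})\circ\hat\phi_\lambda(u^++u^-)=\|u^+\|^2-\|u^-\|^2$ for all $(u^+,u^-)\in B_{\hat H^+}(\theta,\epsilon)\times B_{H^-}(\theta,\epsilon)$.
   Context: Notation: $(\cdot,\cdot)_H$, $\|\cdot\|$ are the inner product and norm of $H$; $\mathscr{L}_s(H)$ is the space of bounded self-adjoint operators on $H$, $\mathscr{L}(H)$ that of bounded operators; $B_Y(\theta,r)$ is the open ball of radius $r$ centred at the origin of $Y$. Hypothesis (A): $\nabla\mathcal{L}:V\to H$ has a Gâteaux derivative $B(u)\in\mathscr{L}_s(H)$ at every $u\in V\cap X$, and $B:V\cap X\to\mathscr{L}_s(H)$ has a decomposition $B=P+Q$, where for each $x\in V\cap X$, $P(x)\in\mathscr{L}_s(H)$ is positive definite (spectrum contained in $(0,\infty)$) and $Q(x)\in\mathscr{L}_s(H)$ is compact, and: (D1) all eigenvectors of $B(\theta)$ corresponding to non-positive eigenvalues belong to $X$; (D2) for any sequence $(x_k)\subset V\cap X$ with $\|x_k\|\to0$, $\|P(x_k)u-P(\theta)u\|\to0$ for every $u\in H$; (D3) $Q:V\cap X\to\mathscr{L}(H)$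 is continuous at $\theta$ with respect to the topology of $H$ on $V\cap X$; (D4) for any sequence $(x_k)\subset V\cap X$ with $\|x_k\|\to0$ there exist $C_0>0$, $k_0\in\mathbb{N}$ with $(P(x_k)u,u)_H\ge C_0\|u\|^2$ for all $u\in H$, $k\ge k_0$. $H^+$ and $H^-$ are the positive definite and negative definite spaces of $B(\theta)$ ($H^-$ is finite dimensional under (A)).
   Formalization: The displayed identities are proved with the constant L(θ)+λG(θ) added on the right-hand side; as printed they force L(θ)+λG(θ)=0, which is not assumed, and they agree with the printed form when L(θ)=G(θ)=0. *)

theory Defs
  imports "HOL-Analysis.Analysis"
begin

definition C1_on :: "'a::real_normed_vector set \<Rightarrow> ('a \<Rightarrow> real) \<Rightarrow> bool" where
  "C1_on V f \<longleftrightarrow> (\<exists>f' :: 'a \<Rightarrow> ('a \<Rightarrow>\<^sub>L real).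
      (\<forall>u\<in>V. (f has_derivative blinfun_apply (f' u)) (at u)) \<and> continuous_on V f')"

definition critical_point :: "('a::real_normed_vector \<Rightarrow> real) \<Rightarrow> 'a \<Rightarrow> bool" where
  "critical_point f u \<longleftrightarrow> (f has_derivative (\<lambda>h. 0)) (at u)"

definition isolated_critical_point :: "('a::real_normed_vector \<Rightarrow> real) \<Rightarrow> 'a \<Rightarrow> bool" where
  "isolated_critical_point f u \<longleftrightarrow>
      critical_point f u \<and> (\<forall>\<^sub>F v in at u. \<not> critical_point f v)"

(* On a Hilbert space the gradient exists at every point of Frechet differentiability (Riesz);
   elsewhere the value is unspecified. *)
definition grad :: "('a::real_inner \<Rightarrow> real) \<Rightarrow> 'a \<Rightarrow> 'a" where
  "grad f u = (THE D. GDERIV f u :> D)"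

definition has_gateaux_derivative ::
  "('a::real_normed_vector \<Rightarrow> 'b::real_normed_vector) \<Rightarrow> ('a \<Rightarrow>\<^sub>L 'b) \<Rightarrow> 'a \<Rightarrow> bool" where
  "has_gateaux_derivative F A u \<longleftrightarrow>
      (\<forall>h. ((\<lambda>t::real. (F (u + t *\<^sub>R h) - F u) /\<^sub>R t) \<longlongrightarrow> blinfun_apply A h) (at 0))"

definition self_adjoint :: "('a::real_inner \<Rightarrow>\<^sub>L 'a) \<Rightarrow> bool" where
  "self_adjoint A \<longleftrightarrow> (\<forall>u v. inner (A u) v = inner u (A v))"

(* Real spectrum; for self-adjoint operators this is the whole spectrum of the complexification. *)
definition op_spectrum :: "('a::real_normed_vector \<Rightarrow>\<^sub>L 'a) \<Rightarrow> real set" where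
  "op_spectrum A = {\<mu>. \<not> (\<exists>R. R o\<^sub>L (A - \<mu> *\<^sub>R id_blinfun) = id_blinfun \<and>
                              (A - \<mu> *\<^sub>R id_blinfun) o\<^sub>L R = id_blinfun)}"

definition positive_definite :: "('a::real_inner \<Rightarrow>\<^sub>L 'a) \<Rightarrow> bool" where
  "positive_definite A \<longleftrightarrow> self_adjoint A \<and> op_spectrum A \<subseteq> {0<..}"

definition compact_operator :: "('a::real_normed_vector \<Rightarrow>\<^sub>L 'b::real_normed_vector) \<Rightarrow> bool" where
  "compact_operator A \<longleftrightarrow> (\<forall>S. bounded S \<longrightarrow> compact (closure (blinfun_apply A ` S)))"

(* The largest closed invariant subspace on which the quadratic form of A is positive, resp.
   negative, off the origin.  For self-adjoint A these are the spectral subspaces belonging to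
   the positive and the negative half-line. *)
definition pos_def_space :: "('a::real_inner \<Rightarrow>\<^sub>L 'a) \<Rightarrow> 'a set" where
  "pos_def_space A = closure (span (\<Union> {M. subspace M \<and> closed M \<and> blinfun_apply A ` M \<subseteq> M \<and>
                                          (\<forall>u\<in>M. u \<noteq> 0 \<longrightarrow> inner (A u) u > 0)}))"

definition neg_def_space :: "('a::real_inner \<Rightarrow>\<^sub>L 'a) \<Rightarrow> 'a set" where
  "neg_def_space A = closure (span (\<Union> {M. subspace M \<and> closed M \<and> blinfun_apply A ` M \<subseteq> M \<and>
                                          (\<forall>u\<in>M. u \<noteq> 0 \<longrightarrow> inner (A u) u < 0)}))"

definition hypothesis_A ::
  "'a::{real_inner, complete_space} set \<Rightarrow> 'a set \<Rightarrow> ('a \<Rightarrow> real) \<Rightarrow>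
   ('a \<Rightarrow> 'a \<Rightarrow>\<^sub>L 'a) \<Rightarrow> ('a \<Rightarrow> 'a \<Rightarrow>\<^sub>L 'a) \<Rightarrow> ('a \<Rightarrow> 'a \<Rightarrow>\<^sub>L 'a) \<Rightarrow> bool" where
  "hypothesis_A V X L B P Q \<longleftrightarrow>
     (\<forall>u\<in>V \<inter> X. self_adjoint (B u) \<and> has_gateaux_derivative (grad L) (B u) u) \<and>
     (\<forall>x\<in>V \<inter> X. B x = P x + Q x \<and> positive_definite (P x) \<and>
                  self_adjoint (Q x) \<and> compact_operator (Q x)) \<and>
     (\<forall>\<mu> u. \<mu> \<le> 0 \<and> u \<noteq> 0 \<and> B 0 u = \<mu> *\<^sub>R u \<longrightarrow> u \<in> X) \<and>
     (\<forall>x. (\<forall>k. x k \<in> V \<inter> X) \<and> (\<lambda>k. norm (x k)) \<longlonglongrightarrow> 0 \<longrightarrow>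
          (\<forall>u. (\<lambda>k. norm (P (x k) u - P 0 u)) \<longlonglongrightarrow> 0)) \<and>
     continuous (at 0 within V \<inter> X) Q \<and>
     (\<forall>x. (\<forall>k. x k \<in> V \<inter> X) \<and> (\<lambda>k. norm (x k)) \<longlonglongrightarrow> 0 \<longrightarrow>
          (\<exists>C0>0. \<exists>k0::nat. \<forall>k\<ge>k0. \<forall>u. inner (P (x k) u) u \<ge> C0 * (norm u)\<^sup>2))"

(* In the theorem, (ball 0 e \<inter> S) + (ball 0 e \<inter> T) is the elementwise sum of the open
   e-balls of two subspaces S and T.  The normal form is stated with the constant
   L 0 + lambda * G 0: evaluating at the origin shows that it can only be dropped
   if the functionals are normalized to vanish there. *)

end

theory Submission
  imports Defs
begin

text \<open>
  Let \<open>\<sigma>\<close> be the reflection that is the identity on \<open>H\<^sup>+\<close> and minus the identity on \<open>H\<^sup>-\<close>, and write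
  \<open>A\<^sub>\<lambda>\<close> for the gradient of \<open>J\<^sub>\<lambda> = L + \<lambda> G\<close>.  Near the origin the quadratic form of \<open>B(u) + \<lambda> G''(u)\<close>
  is uniformly positive on \<open>H\<^sup>+\<close> and uniformly negative on \<open>H\<^sup>-\<close>, and since \<open>B(u)\<close> is self-adjoint
  its mixed terms cancel against \<open>\<sigma>\<close>, so \<open>\<sigma> \<circ> A\<^sub>\<lambda>\<close> is strongly monotone on a ball, uniformly in
  \<open>\<lambda>\<close>.  Hence \<open>J\<^sub>\<lambda>\<close> is strongly convex along \<open>H\<^sup>+\<close> and strongly concave along \<open>H\<^sup>-\<close>: over each
  \<open>x \<in> H\<^sup>+\<close> it has a unique fibre maximiser \<open>x + h\<^sub>\<lambda>(x)\<close>, the maximal value grows at least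
  quadratically along rays of \<open>H\<^sup>+\<close>, and the drop from it grows at least quadratically along rays
  of \<open>H\<^sup>-\<close>.  Rescaling both ray parameters by the square roots of these two quantities gives the
  chart.  It moves \<open>x\<close> only along its ray and all else within \<open>H\<^sup>-\<close>, so it respects every subspace
  containing \<open>H\<^sup>-\<close>.
\<close>

section \<open>Strongly convex minimisation, Riesz representation and gradients\<close>

text \<open>The gradient of \<open>L\<close> is merely Gateaux differentiable, and only on the dense
  set \<open>V \<inter> X\<close>, while \<open>P\<close> is only strongly continuous at the origin;
  so the implicit function theorem and the usual Morse lemma are out of reach. Strong monotonicity
  of the reflected gradient takes their place: as an inequality between gradients it passes from
  \<open>X\<close> to a full ball by density, and the existence and continuity of fibre maximisers,
  the growth along rays and the isolation of the critical point all rest on it and on continuity of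
  \<open>J\<close> and its gradient. The delicate point is that the estimates for
  \<open>B(u)\<close> must be uniform near the origin although \<open>P\<close> need not converge in
  norm. On the negative space this is harmless, because that space is finite-dimensional and
  pointwise convergence is uniform there; on the positive space the coercive and the compact part
  have to be balanced by hand. The range \<rho> of the parameter is fixed by the demand that the
  term with \<lambda> consume at most half of the monotonicity constant.\<close>

text \<open>The midpoint inequality bounds the spread of a minimising sequence by its excess over
  the infimum, so the sequence is Cauchy and completeness does the work of weak compactness.\<close>

lemma attains_min_of_midpoint_strongly_convex:
  fixes C :: "'a::{real_normed_vector, complete_space} set" and f :: "'a \<Rightarrow> real"
  assumes "closed C" "convex C" "C \<noteq> {}" "continuous_on C f"
    and bdd: "bdd_below (f ` C)" and "c > 0"
    and mid: "\<And>u v. u \<in> C \<Longrightarrow> v \<in> C \<Longrightarrow>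
      f (midpoint u v) + c * (norm (u - v))\<^sup>2 \<le> (f u + f v) / 2"
  obtains m where "m \<in> C" "\<And>u. u \<in> C \<Longrightarrow> f m \<le> f u"
proof -
  define I where "I = Inf (f ` C)"
  have I_le: "I \<le> f u" if "u \<in> C" for u
    unfolding I_def using that bdd by (intro cInf_lower) auto
  have "\<exists>u\<in>C. f u < I + inverse (real (Suc n))" for n
  proof -
    have "I < I + inverse (real (Suc n))" by simp
    then show ?thesis
      unfolding I_def using assms(3) bdd by (subst (asm) cInf_less_iff) auto
  qed
  then obtain u where u: "\<And>n. u n \<in> C" "\<And>n. f (u n) < I + inverse (real (Suc n))"
    by metis
  have f_lim: "(\<lambda>n. f (u n)) \<longlonglongrightarrow> I"
  proof (rule tendsto_sandwich)
    show "(\<lambda>n. I) \<longlonglongrightarrow> I" by simp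
    have "(\<lambda>n. I + inverse (real (Suc n))) \<longlonglongrightarrow> I + 0"
      by (intro tendsto_intros LIMSEQ_inverse_real_of_nat)
    then show "(\<lambda>n. I + inverse (real (Suc n))) \<longlonglongrightarrow> I" by simp
  qed (use u I_le in \<open>auto intro!: always_eventually less_imp_le\<close>)
  \<comment> \<open>The midpoint lies in \<open>C\<close>, so \<open>f\<close> is at least
    \<open>I\<close> there; what the inequality leaves is the average excess of the two
    values.\<close>
  have est: "c * (norm (u i - u j))\<^sup>2 \<le> ((f (u i) - I) + (f (u j) - I)) / 2" for i j
  proof -
    have "midpoint (u i) (u j) \<in> C"
      unfolding midpoint_def scaleR_right_distrib
      using convexD[OF assms(2) u(1) u(1), of "1/2" "1/2" i j] by (simp add: field_simps)
    from I_le[OF this] mid[OF u(1) u(1), of i j] show ?thesis by (simp add: field_simps)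
  qed
  have "Cauchy u"
  proof (rule CauchyI)
    fix e :: real assume "e > 0"
    then have "I + c * e\<^sup>2 > I" using assms by simp
    then have "eventually (\<lambda>n. f (u n) < I + c * e\<^sup>2) sequentially"
      using f_lim by (simp add: order_tendstoD)
    then obtain N where N: "\<And>n. n \<ge> N \<Longrightarrow> f (u n) < I + c * e\<^sup>2"
      by (auto simp: eventually_sequentially)
    have "norm (u i - u j) < e" if "i \<ge> N" "j \<ge> N" for i j
    proof -
      have "(f (u i) - I) + (f (u j) - I) < c * e\<^sup>2 + c * e\<^sup>2"
        using N[OF that(1)] N[OF that(2)] by (intro add_strict_mono) simp_all
      with est[of i j] have "c * (norm (u i - u j))\<^sup>2 < c * e\<^sup>2" by simp
      then show ?thesis using \<open>e > 0\<close> \<open>c > 0\<close> by (simp add: power2_less_imp_less)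
    qed
    then show "\<exists>M. \<forall>m\<ge>M. \<forall>n\<ge>M. norm (u m - u n) < e" by blast
  qed
  then obtain m where m: "u \<longlonglongrightarrow> m"
    using Cauchy_convergent_iff convergent_def by blast
  have "m \<in> C" using assms(1) u(1) m by (rule closed_sequentially)
  have "(\<lambda>n. f (u n)) \<longlonglongrightarrow> f m"
    using assms(4) m \<open>m \<in> C\<close> u(1) unfolding continuous_on_sequentially by (auto simp: o_def)
  with f_lim have "f m = I" by (rule LIMSEQ_unique[symmetric])
  with \<open>m \<in> C\<close> I_le show ?thesis by (intro that[of m]) auto
qed

text \<open>The solution minimises the energy \<open>T u \<bullet> u / 2 - f u\<close> over
  \<open>M\<close>, and the wanted equation is its first variation. With a general coercive form and
  a general subspace, one result serves Riesz representation, orthogonal projection and, later,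
  projection that is orthogonal for the form of \<open>P\<close>.\<close>

lemma Lax_Milgram_symmetric:
  fixes T :: "'a::{real_inner, complete_space} \<Rightarrow>\<^sub>L 'a" and f :: "'a \<Rightarrow> real"
  assumes M: "closed M" "subspace M" and T: "self_adjoint T"
    and c: "c > 0" "\<And>u. u \<in> M \<Longrightarrow> T u \<bullet> u \<ge> c * (norm u)\<^sup>2"
    and f: "bounded_linear f"
  obtains m where "m \<in> M" "\<And>v. v \<in> M \<Longrightarrow> T m \<bullet> v = f v"
proof -
  interpret f: bounded_linear f by fact
  have sym: "T u \<bullet> v = T v \<bullet> u" for u v
    using T unfolding self_adjoint_def by (simp add: inner_commute)
  define q where "q u = (T u \<bullet> u) / 2 - f u" for u
  obtain K where K: "K > 0" "\<And>u. \<bar>f u\<bar> \<le> norm u * K"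
    using f.pos_bounded by auto
  have cont: "continuous_on M q"
    unfolding q_def by (intro continuous_intros f.continuous_on ballI) simp_all
  \<comment> \<open>Completing the square: with \<open>n = norm u\<close>, the lower bound
    \<open>c * n^2 / 2 - K * n\<close> is smallest at \<open>n = K / c\<close>.\<close>
  have "q u \<ge> - K\<^sup>2 / (2 * c)" if "u \<in> M" for u
  proof -
    have "0 \<le> (c * norm u - K)\<^sup>2" by simp
    then have "- K\<^sup>2 / (2 * c) \<le> c * (norm u)\<^sup>2 / 2 - norm u * K"
      using c(1) by (simp add: field_simps power2_eq_square)
    also have "\<dots> \<le> q u" unfolding q_def using c(2)[OF that] K(2)[of u] by linarith
    finally show ?thesis .
  qed
  then have bdd: "bdd_below (q ` M)" by (auto simp: bdd_below_def)
  \<comment> \<open>For a quadratic plus a linear function the midpoint defect is exactly one eighth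
    of the form at \<open>u - v\<close>.\<close>
  have mid: "q (midpoint u v) + (c/8) * (norm (u - v))\<^sup>2 \<le> (q u + q v) / 2"
    if "u \<in> M" "v \<in> M" for u v
  proof -
    have "u - v \<in> M" using that M(2) by (rule_tac subspace_diff)
    from c(2)[OF this] have "c * (norm (u - v))\<^sup>2 \<le> T u \<bullet> u - 2 * (T u \<bullet> v) + T v \<bullet> v"
      by (simp add: blinfun.diff_right inner_diff_left inner_diff_right sym[of v u])
    then show ?thesis
      unfolding q_def midpoint_def
      by (simp add: blinfun.add_right blinfun.scaleR_right inner_add_left inner_add_right
          f.add f.scaleR sym[of v u] field_simps)
  qed
  have "convex M" "M \<noteq> {}" "c / 8 > 0"
    using M(2) c(1) by (auto simp: subspace_imp_convex dest: subspace_0)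
  then obtain m where m: "m \<in> M" "\<And>u. u \<in> M \<Longrightarrow> q m \<le> q u"
    using attains_min_of_midpoint_strongly_convex[OF M(1) _ _ cont bdd _ mid] by metis
  show thesis
  proof (rule that[OF m(1)])
    fix v assume v: "v \<in> M"
    \<comment> \<open>Along the line \<open>g\<close> is a quadratic polynomial whose linear
      coefficient is the residual of the equation; a minimum at \<open>0\<close> makes it
      vanish.\<close>
    define g where "g t = q (m + t *\<^sub>R v)" for t
    have g: "g t = q m + t * (T m \<bullet> v - f v) + t\<^sup>2 * ((T v \<bullet> v) / 2)" for t
      unfolding g_def q_def
      by (simp add: blinfun.add_right blinfun.scaleR_right inner_add_left inner_add_right
          f.add f.scaleR sym[of v m] field_simps power2_eq_square)
    have "(g has_real_derivative (T m \<bullet> v - f v)) (at 0)"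
      unfolding g by (auto intro!: derivative_eq_intros)
    moreover have "g 0 \<le> g t" for t
      unfolding g_def using m v M(2) by (simp add: subspace_add subspace_scale)
    ultimately have "T m \<bullet> v - f v = 0"
      by (intro DERIV_local_min[of g _ 0 1]) auto
    then show "T m \<bullet> v = f v" by simp
  qed
qed

lemma self_adjoint_id: "self_adjoint id_blinfun"
  by (simp add: self_adjoint_def)

lemma orthogonal_projection_exists:
  fixes M :: "'a::{real_inner, complete_space} set"
  assumes "closed M" "subspace M"
  obtains m where "m \<in> M" "\<And>v. v \<in> M \<Longrightarrow> (u - m) \<bullet> v = 0"
proof -
  obtain m where "m \<in> M" "\<And>v. v \<in> M \<Longrightarrow> id_blinfun m \<bullet> v = u \<bullet> v"
    by (rule Lax_Milgram_symmetric[OF assms self_adjoint_id, of 1 "\<lambda>v. u \<bullet> v"])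
      (auto simp: bounded_linear_inner_right power2_norm_eq_inner)
  then show ?thesis by (intro that[of m]) (auto simp: inner_diff_left)
qed

lemma Riesz_representation:
  fixes f :: "'a::{real_inner, complete_space} \<Rightarrow> real"
  assumes "bounded_linear f"
  obtains D where "\<And>v. f v = D \<bullet> v"
proof -
  obtain D where "\<And>v. v \<in> UNIV \<Longrightarrow> id_blinfun D \<bullet> v = f v"
    by (rule Lax_Milgram_symmetric[OF closed_UNIV subspace_UNIV self_adjoint_id _ _ assms, of 1])
      (auto simp: power2_norm_eq_inner)
  then show ?thesis by (intro that[of D]) auto
qed

section \<open>Gradients of C1 functions on a Hilbert space\<close>

lemma grad_eqI:
  assumes "GDERIV f u :> D"
  shows "grad f u = D"
  unfolding grad_def
proof (rule the_equality)
  show "GDERIV f u :> D" by fact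
  fix D' assume "GDERIV f u :> D'"
  then have "(\<lambda>h. h \<bullet> D') = (\<lambda>h. h \<bullet> D)"
    using assms unfolding gderiv_def by (rule has_derivative_unique)
  then have "(D' - D) \<bullet> D' = (D' - D) \<bullet> D" by meson
  then have "(D' - D) \<bullet> (D' - D) = 0" by (simp add: inner_diff_right)
  then show "D' = D" by simp
qed

text \<open>Riesz representation makes the \<open>THE\<close> in \<open>grad\<close> denote wherever
  a Frechet derivative exists.\<close>

lemma GDERIV_grad:
  fixes f :: "'a::{real_inner, complete_space} \<Rightarrow> real"
  assumes "(f has_derivative f') (at u)"
  shows "GDERIV f u :> grad f u"
proof -
  obtain D where D: "\<And>v. f' v = D \<bullet> v"
    using Riesz_representation has_derivative_bounded_linear[OF assms] by blast
  then have "f' = (\<lambda>h. h \<bullet> D)" by (auto simp: inner_commute)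
  with assms have "GDERIV f u :> D" by (simp add: gderiv_def)
  with grad_eqI[OF this] show ?thesis by simp
qed

lemma C1_on_grad:
  fixes f :: "'a::{real_inner, complete_space} \<Rightarrow> real"
  assumes "C1_on V f"
  shows C1_on_GDERIV: "u \<in> V \<Longrightarrow> GDERIV f u :> grad f u"
    and continuous_on_grad: "continuous_on V (grad f)"
proof -
  obtain f' where f': "\<And>u. u \<in> V \<Longrightarrow> (f has_derivative blinfun_apply (f' u)) (at u)"
    and cont: "continuous_on V f'"
    using assms unfolding C1_on_def by blast
  show GD: "GDERIV f u :> grad f u" if "u \<in> V" for u
    using GDERIV_grad[OF f'[OF that]] .
  have ap: "f' u h = h \<bullet> grad f u" if "u \<in> V" for u h
    using has_derivative_unique[OF f'[OF that] GD[OF that, unfolded gderiv_def]] by meson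
  \<comment> \<open>The Riesz map is an isometry; evaluating the difference of the functionals at
    the difference of the gradients gives the inequality needed.\<close>
  have "dist (grad f u) (grad f v) \<le> dist (f' u) (f' v)" if "u \<in> V" "v \<in> V" for u v
  proof -
    let ?d = "grad f u - grad f v"
    have "(norm ?d)\<^sup>2 = blinfun_apply (f' u - f' v) ?d"
      by (simp add: blinfun.diff_left ap that power2_norm_eq_inner flip: inner_diff_right)
    also have "\<dots> \<le> norm (f' u - f' v) * norm ?d"
      using norm_blinfun[of "f' u - f' v" ?d] by simp
    finally have "norm ?d \<le> norm (f' u - f' v)"
      by (cases "norm ?d = 0") (auto simp: power2_eq_square)
    then show ?thesis by (simp add: dist_norm)
  qed
  then show "continuous_on V (grad f)"
    using cont unfolding continuous_on_iff by (meson le_less_trans)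
qed

section \<open>Nonpositive eigenvectors of compact perturbations of coercive operators\<close>

text \<open>The family need not be normalised and may contain \<open>0\<close>, as the result of
  \<open>basis_orthogonal\<close> may; that summand is a multiple of \<open>0\<close> and
  vanishes.\<close>

definition orth_proj :: "'a::real_inner set \<Rightarrow> 'a \<Rightarrow> 'a" where
  "orth_proj C u = (\<Sum>c\<in>C. ((u \<bullet> c) / (c \<bullet> c)) *\<^sub>R c)"

lemma bounded_linear_orth_proj: "bounded_linear (orth_proj C)"
  unfolding orth_proj_def
proof (rule bounded_linear_sum, rule bounded_linear_scaleR_const)
  fix c show "bounded_linear (\<lambda>u. (u \<bullet> c) / (c \<bullet> c))"
    using bounded_linear_compose[OF bounded_linear_divide bounded_linear_inner_left] .
qed

lemma orth_proj_in_span: "orth_proj C u \<in> span C"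
  unfolding orth_proj_def by (intro span_sum span_scale span_base)

lemma orth_proj_eq:
  assumes "finite C" "pairwise orthogonal C" "u \<in> span C"
  shows "orth_proj C u = u"
proof -
  interpret bounded_linear "orth_proj C" by (rule bounded_linear_orth_proj)
  have base: "orth_proj C c = c" if "c \<in> C" for c
  proof -
    have "orth_proj C c = (\<Sum>b\<in>C. if b = c then c else 0)"
      unfolding orth_proj_def
      using assms(2) that by (intro sum.cong) (auto simp: pairwise_def orthogonal_def)
    then show ?thesis using assms(1) that by simp
  qed
  show ?thesis
    using assms(3)
    by (induction rule: span_induct_alt) (auto simp: zero add scaleR base)
qed

lemma orth_proj_residual:
  assumes "finite C" "pairwise orthogonal C" "v \<in> span C"
  shows "(u - orth_proj C u) \<bullet> v = 0"
  using assms(3)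
proof (induction rule: span_induct_alt)
  case (step r c v)
  have "orth_proj C u \<bullet> c = (\<Sum>b\<in>C. if b = c then u \<bullet> c else 0)"
    unfolding orth_proj_def inner_sum_left
    using assms(2) step(1) by (intro sum.cong) (auto simp: pairwise_def orthogonal_def)
  then have "(u - orth_proj C u) \<bullet> c = 0"
    using assms(1) step(1) by (simp add: inner_diff_left)
  then show ?case using step by (simp add: inner_add_right)
qed simp

text \<open>The span is the fixed-point set of the continuous map \<open>orth_proj C\<close> for an
  orthogonal family \<open>C\<close> with the same span.\<close>

lemma closed_span_finite:
  fixes F :: "'a::real_inner set"
  assumes "finite F"
  shows "closed (span F)"
proof -
  obtain C where C: "finite C" "span C = span F" "pairwise orthogonal C"
    using basis_orthogonal[OF assms] by blast
  interpret bounded_linear "orth_proj C" by (rule bounded_linear_orth_proj)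
  have "span F = {u. orth_proj C u = u}"
    using orth_proj_eq[OF C(1,3)] orth_proj_in_span[of C] C(2) by (metis (mono_tags) Collect_eqI Collect_mem_eq)
  moreover have "closed \<dots>"
    by (intro closed_Collect_eq continuous_on continuous_intros)
  ultimately show ?thesis by simp
qed

text \<open>The point is that \<open>C\<close> is fixed before \<open>D\<close>: operators that
  converge at the finitely many vectors of \<open>C\<close> converge uniformly on bounded parts of
  the span.\<close>

lemma linear_bound_on_span_finite:
  fixes F :: "'a::real_inner set"
  assumes "finite F"
  obtains C where "finite C"
    "\<And>(D :: 'a \<Rightarrow>\<^sub>L 'b::real_normed_vector) u. u \<in> span F \<Longrightarrow> norm (D u) \<le> norm u * (\<Sum>c\<in>C. norm (D c))"
proof -
  obtain C0 where C0: "finite C0" "span C0 = span F" "pairwise orthogonal C0"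
    using basis_orthogonal[OF assms] by blast
  define s where "s c = (1 / norm c) *\<^sub>R c" for c :: 'a
  have bound: "norm (D u) \<le> norm u * (\<Sum>c\<in>s ` C0. norm (D c))" if u: "u \<in> span F"
    for D :: "'a \<Rightarrow>\<^sub>L 'b" and u
  proof -
    \<comment> \<open>The final sum runs over the image of \<open>C0\<close> under \<open>s\<close>,
      so normalisation must not merge two nonzero vectors. The zero vector is sent to
      \<open>0\<close> and contributes nothing.\<close>
    have inj: "inj_on s (C0 - {0})"
    proof (rule inj_onI)
      fix b c assume bc: "b \<in> C0 - {0}" "c \<in> C0 - {0}" "s b = s c"
      show "b = c"
      proof (rule ccontr)
        assume "b \<noteq> c"
        with bc C0(3) have "b \<bullet> c = 0" by (auto simp: pairwise_def orthogonal_def)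
        then have "s b \<bullet> s c = 0" by (simp add: s_def)
        with bc show False by (simp add: s_def)
      qed
    qed
    have "D u = D (orth_proj C0 u)" using orth_proj_eq[OF C0(1,3)] u C0(2) by simp
    also have "\<dots> = (\<Sum>c\<in>C0. ((u \<bullet> c) / (c \<bullet> c)) *\<^sub>R D c)"
      by (simp add: orth_proj_def blinfun.sum_right blinfun.scaleR_right)
    also have "norm \<dots> \<le> (\<Sum>c\<in>C0. norm u * norm (D (s c)))"
    proof (rule sum_norm_le)
      fix c
      have "\<bar>u \<bullet> c\<bar> * (inverse (c \<bullet> c) * norm (D c)) \<le> (norm u * norm c) * (inverse (c \<bullet> c) * norm (D c))"
        by (intro mult_right_mono Cauchy_Schwarz_ineq2) auto
      then show "norm (((u \<bullet> c) / (c \<bullet> c)) *\<^sub>R D c) \<le> norm u * norm (D (s c))"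
        by (cases "c = 0") (auto simp: s_def blinfun.scaleR_right divide_simps power2_norm_eq_inner[symmetric] power2_eq_square)
    qed
    also have "\<dots> = norm u * (\<Sum>c\<in>C0 - {0}. norm (D (s c)))"
      unfolding sum_distrib_left
      using C0(1) by (intro sum.mono_neutral_right) (auto simp: s_def)
    also have "(\<Sum>c\<in>C0 - {0}. norm (D (s c))) = (\<Sum>c\<in>s ` (C0 - {0}). norm (D c))"
      using inj by (simp add: sum.reindex)
    also have "\<dots> \<le> (\<Sum>c\<in>s ` C0. norm (D c))"
      using C0(1) by (intro sum_mono2) auto
    finally show ?thesis by (simp add: mult_left_mono)
  qed
  then show thesis using that[OF finite_imageI[OF C0(1)]] by blast
qed

lemma coercive_lower_bound:
  fixes T :: "'a::real_inner \<Rightarrow>\<^sub>L 'a"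
  assumes "T u \<bullet> u \<ge> c * (norm u)\<^sup>2"
  shows "c * norm u \<le> norm (T u)"
proof (cases "u = 0")
  case False
  have "c * (norm u)\<^sup>2 \<le> norm (T u) * norm u"
    using assms norm_cauchy_schwarz[of "T u" u] by linarith
  then show ?thesis using False by (simp add: power2_eq_square)
qed simp

lemma compact_operator_seq:
  assumes "compact_operator T" "\<And>n::nat. norm (x n) \<le> b"
  obtains r l where "strict_mono r" "(\<lambda>n. blinfun_apply T (x (r n))) \<longlonglongrightarrow> l"
proof -
  have "compact (closure (blinfun_apply T ` cball 0 b))"
    using assms(1) unfolding compact_operator_def by auto
  moreover have "\<forall>n. T (x n) \<in> closure (blinfun_apply T ` cball 0 b)"
    using assms(2) closure_subset[of "blinfun_apply T ` cball 0 b"] by (auto simp: subset_eq)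
  ultimately show ?thesis
    unfolding compact_def using that by (fastforce simp: o_def)
qed

section \<open>Coercive plus compact operators\<close>

text \<open>Up to a compact operator \<open>A\<close> is coercive, so orthonormal eigenvectors with
  nonpositive eigenvalues can only be finite in number and coercivity holds on their
  complement.\<close>

locale Fredholm_form =
  fixes A P Q :: "'a::{real_inner, complete_space} \<Rightarrow>\<^sub>L 'a" and c :: real
  assumes A_adj: "self_adjoint A" and A_eq: "A = P + Q" and c_pos: "c > 0"
    and P_coercive: "\<And>u. P u \<bullet> u \<ge> c * (norm u)\<^sup>2"
    and Q_compact: "compact_operator Q"
begin

lemma A_sym: "A u \<bullet> v = u \<bullet> A v"
  using A_adj by (simp add: self_adjoint_def)

text \<open>The infimum \<open>m\<close> of the form on the unit sphere of \<open>M\<close> is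
  attained at an eigenvector. Failure of coercivity gives \<open>m \<le> 0\<close>, so
  \<open>P - m\<close> is still coercive; as \<open>Q\<close> converges along a subsequence of a
  minimising sequence, that coercivity makes the subsequence itself converge in norm.\<close>

lemma nonpositive_eigenvector:
  assumes M: "closed M" "subspace M" and inv: "blinfun_apply A ` M \<subseteq> M"
    and nc: "\<not> (\<exists>b>0. \<forall>u\<in>M. A u \<bullet> u \<ge> b * (norm u)\<^sup>2)"
  obtains e \<mu> where "e \<in> M" "norm e = 1" "\<mu> \<le> 0" "A e = \<mu> *\<^sub>R e"
proof -
  define U where "U = {u\<in>M. norm u = 1}"
  define f where "f u = A u \<bullet> u" for u
  define m where "m = Inf (f ` U)"
  have f_scale: "f (t *\<^sub>R u) = t\<^sup>2 * f u" for t u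
    by (simp add: f_def blinfun.scaleR_right power2_eq_square)
  have f_ge: "- norm A \<le> f u" if "u \<in> U" for u
  proof -
    have "\<bar>A u \<bullet> u\<bar> \<le> norm A * norm u * norm u"
      by (rule order_trans[OF Cauchy_Schwarz_ineq2]) (intro mult_right_mono norm_blinfun norm_ge_zero)
    then show ?thesis using that by (simp add: U_def f_def)
  qed
  then have bdd: "bdd_below (f ` U)" by (auto simp: bdd_below_def)
  have f_norm: "\<exists>v\<in>U. f u = f v * (norm u)\<^sup>2" if "u \<in> M" "u \<noteq> 0" for u
    using that M(2) by (intro bexI[of _ "(1 / norm u) *\<^sub>R u"])
      (auto simp: U_def subspace_scale f_scale power_divide)
  have m_le: "m * (norm u)\<^sup>2 \<le> f u" if "u \<in> M" for u
  proof (cases "u = 0")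
    case False
    with \<open>u \<in> M\<close> obtain v where "v \<in> U" "f u = f v * (norm u)\<^sup>2" using f_norm by blast
    moreover have "m \<le> f v" unfolding m_def using bdd \<open>v \<in> U\<close> by (intro cInf_lower) auto
    ultimately show ?thesis by (simp add: mult_right_mono)
  qed (simp add: f_def)
  have "U \<noteq> {}"
  proof
    assume "U = {}"
    then have "\<forall>u\<in>M. u = 0" using f_norm by blast
    then have "\<exists>b>0. \<forall>u\<in>M. A u \<bullet> u \<ge> b * (norm u)\<^sup>2" by (intro exI[of _ 1]) auto
    with nc show False by blast
  qed
  have "m \<le> 0"
  proof (rule ccontr)
    assume "\<not> m \<le> 0"
    with m_le have "\<exists>b>0. \<forall>u\<in>M. A u \<bullet> u \<ge> b * (norm u)\<^sup>2"
      unfolding f_def by (intro exI[of _ m]) auto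
    with nc show False by blast
  qed
  have "\<exists>u\<in>U. f u < m + inverse (real (Suc n))" for n
  proof -
    have "m < m + inverse (real (Suc n))" by simp
    then show ?thesis
      unfolding m_def using \<open>U \<noteq> {}\<close> bdd by (subst (asm) cInf_less_iff) auto
  qed
  then obtain h where h: "\<And>n. h n \<in> U" "\<And>n. f (h n) < m + inverse (real (Suc n))"
    by metis
  define T where "T = A - m *\<^sub>R id_blinfun"
  \<comment> \<open>The summand \<open>1\<close> keeps \<open>K\<close> positive even when
    \<open>T\<close> is zero.\<close>
  define K where "K = norm T + 1"
  have T_inner: "T u \<bullet> u = f u - m * (norm u)\<^sup>2" for u
    by (simp add: T_def f_def blinfun.diff_left blinfun.scaleR_left inner_diff_left power2_norm_eq_inner)
  have T_sym: "T u \<bullet> v = T v \<bullet> u" for u v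
    using A_sym[of u v]
    by (simp add: T_def blinfun.diff_left blinfun.scaleR_left inner_diff_left inner_commute[of u])
  \<comment> \<open>Cauchy-Schwarz for the nonnegative form of T: nearly minimal unit vectors are nearly eigenvectors.\<close>
  have T_small: "(norm (T u))\<^sup>2 \<le> K * (T u \<bullet> u)" if "u \<in> M" for u
  proof -
    have K: "K > 0" by (simp add: K_def add_nonneg_pos)
    define v where "v = T u"
    define t where "t = 1 / K"
    have t: "t > 0" "t * K = 1" using K by (simp_all add: t_def)
    have "v \<in> M"
      using that inv M(2) by (auto simp: v_def T_def blinfun.diff_left blinfun.scaleR_left
          intro!: subspace_diff subspace_scale)
    then have "u - t *\<^sub>R v \<in> M" using that M(2) by (intro subspace_diff subspace_scale)
    then have "0 \<le> T (u - t *\<^sub>R v) \<bullet> (u - t *\<^sub>R v)"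
      unfolding T_inner using m_le by simp
    also have "\<dots> = T u \<bullet> u - 2 * t * (v \<bullet> v) + t\<^sup>2 * (T v \<bullet> v)"
      by (simp add: blinfun.diff_right blinfun.scaleR_right inner_diff_left inner_diff_right
          T_sym[of v u] v_def[symmetric] algebra_simps power2_eq_square)
    also have "T v \<bullet> v \<le> K * (v \<bullet> v)"
    proof -
      have "T v \<bullet> v \<le> norm (T v) * norm v" by (rule norm_cauchy_schwarz)
      also have "\<dots> \<le> (norm T * norm v) * norm v" by (intro mult_right_mono norm_blinfun) auto
      also have "\<dots> \<le> K * (v \<bullet> v)"
        unfolding K_def power2_norm_eq_inner[symmetric] power2_eq_square by (simp add: algebra_simps)
      finally show ?thesis .
    qed
    finally have "0 \<le> T u \<bullet> u - 2 * t * (v \<bullet> v) + t\<^sup>2 * (K * (v \<bullet> v))"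
      by (simp add: mult_left_mono)
    also have "t\<^sup>2 * (K * (v \<bullet> v)) = t * (t * K) * (v \<bullet> v)"
      by (simp add: power2_eq_square)
    finally have "t * (v \<bullet> v) \<le> T u \<bullet> u" by (simp add: t)
    then have "K * (t * (v \<bullet> v)) \<le> K * (T u \<bullet> u)" using K by simp
    then have "v \<bullet> v \<le> K * (T u \<bullet> u)" using K by (simp add: t_def)
    then show ?thesis by (simp add: v_def power2_norm_eq_inner)
  qed
  have "(\<lambda>n. K * inverse (real (Suc n))) \<longlonglongrightarrow> K * 0"
    by (intro tendsto_intros LIMSEQ_inverse_real_of_nat)
  then have lim0: "(\<lambda>n. K * inverse (real (Suc n))) \<longlonglongrightarrow> 0" by simp
  have "(\<lambda>n. (norm (T (h n)))\<^sup>2) \<longlonglongrightarrow> 0"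
  proof (rule tendsto_sandwich[OF _ _ tendsto_const lim0])
    show "\<forall>\<^sub>F n in sequentially. 0 \<le> (norm (T (h n)))\<^sup>2" by simp
    show "\<forall>\<^sub>F n in sequentially. (norm (T (h n)))\<^sup>2 \<le> K * inverse (real (Suc n))"
    proof (intro always_eventually allI)
      fix n
      have "T (h n) \<bullet> h n \<le> inverse (real (Suc n))"
        using h[of n] by (simp add: T_inner U_def)
      moreover have "K \<ge> 0" by (simp add: K_def)
      ultimately show "(norm (T (h n)))\<^sup>2 \<le> K * inverse (real (Suc n))"
        using T_small[of "h n"] h(1)[of n] mult_left_mono[of "T (h n) \<bullet> h n" _ K]
        unfolding U_def by fastforce
    qed
  qed
  then have "(\<lambda>n. sqrt ((norm (T (h n)))\<^sup>2)) \<longlonglongrightarrow> sqrt 0" by (rule tendsto_real_sqrt)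
  then have Th: "(\<lambda>n. T (h n)) \<longlonglongrightarrow> 0" by (simp add: tendsto_norm_zero_iff)
  obtain r l where r: "strict_mono r" and l: "(\<lambda>n. Q (h (r n))) \<longlonglongrightarrow> l"
    using compact_operator_seq[OF Q_compact, of h 1] h(1) by (auto simp: U_def)
  have "(\<lambda>n. T (h (r n))) \<longlonglongrightarrow> 0"
    using LIMSEQ_subseq_LIMSEQ[OF Th r] by (simp add: o_def)
  with l have "(\<lambda>n. T (h (r n)) - Q (h (r n))) \<longlonglongrightarrow> 0 - l" by (intro tendsto_diff)
  then have "Cauchy (\<lambda>n. T (h (r n)) - Q (h (r n)))"
    using Cauchy_convergent_iff convergent_def by blast
  \<comment> \<open>\<open>T - Q\<close> equals \<open>P - m id\<close>, and
    \<open>m \<le> 0\<close> lets it inherit the constant of \<open>P\<close>; differences of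
    \<open>h\<close> are thus controlled by those of a convergent sequence.\<close>
  moreover have "c * norm (h (r i) - h (r j)) \<le>
      norm ((T (h (r i)) - Q (h (r i))) - (T (h (r j)) - Q (h (r j))))" for i j
  proof -
    define R where "R = P - m *\<^sub>R id_blinfun"
    have "c * (norm u)\<^sup>2 \<le> R u \<bullet> u" for u
    proof -
      have "R u \<bullet> u = P u \<bullet> u - m * (norm u)\<^sup>2"
        by (simp add: R_def blinfun.diff_left blinfun.scaleR_left inner_diff_left power2_norm_eq_inner)
      moreover have "m * (norm u)\<^sup>2 \<le> 0" using \<open>m \<le> 0\<close> by (simp add: mult_nonpos_nonneg)
      ultimately show ?thesis using P_coercive[of u] by linarith
    qed
    from coercive_lower_bound[OF this, of "h (r i) - h (r j)"] show ?thesis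
      by (simp add: R_def T_def A_eq blinfun.diff_left blinfun.add_left blinfun.diff_right
          blinfun.scaleR_left algebra_simps)
  qed
  ultimately have "Cauchy (\<lambda>n. h (r n))"
  proof -
    assume C: "Cauchy (\<lambda>n. T (h (r n)) - Q (h (r n)))"
      and le: "\<And>i j. c * norm (h (r i) - h (r j)) \<le>
        norm ((T (h (r i)) - Q (h (r i))) - (T (h (r j)) - Q (h (r j))))"
    show ?thesis
    proof (rule CauchyI)
      fix e :: real assume "e > 0"
      then have "c * e > 0" using c_pos by simp
      from CauchyD[OF C this] obtain N where N: "\<And>i j. i \<ge> N \<Longrightarrow> j \<ge> N \<Longrightarrow>
          norm ((T (h (r i)) - Q (h (r i))) - (T (h (r j)) - Q (h (r j)))) < c * e"
        by blast
      have "norm (h (r i) - h (r j)) < e" if "i \<ge> N" "j \<ge> N" for i j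
        using le_less_trans[OF le N[OF that]] c_pos by simp
      then show "\<exists>M. \<forall>i\<ge>M. \<forall>j\<ge>M. norm (h (r i) - h (r j)) < e" by blast
    qed
  qed
  then obtain e where e: "(\<lambda>n. h (r n)) \<longlonglongrightarrow> e"
    using Cauchy_convergent_iff convergent_def by blast
  have "e \<in> M" using M(1) _ e by (rule closed_sequentially) (use h in \<open>auto simp: U_def\<close>)
  have "(\<lambda>n. norm (h (r n))) \<longlonglongrightarrow> norm e" by (intro tendsto_norm e)
  then have "norm e = 1" using h(1) by (simp add: U_def LIMSEQ_const_iff)
  have "(\<lambda>n. T (h (r n))) \<longlonglongrightarrow> T e" by (intro tendsto_intros e)
  with \<open>(\<lambda>n. T (h (r n))) \<longlonglongrightarrow> 0\<close> have "T e = 0" using LIMSEQ_unique by blast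
  then have "A e = m *\<^sub>R e" by (simp add: T_def blinfun.diff_left blinfun.scaleR_left)
  with \<open>e \<in> M\<close> \<open>norm e = 1\<close> \<open>m \<le> 0\<close> show ?thesis by (rule that[of e m])
qed

definition nonpos_system :: "'a set \<Rightarrow> bool" where
  "nonpos_system S \<longleftrightarrow> pairwise orthogonal S \<and>
     (\<forall>e\<in>S. norm e = 1 \<and> (\<exists>\<mu>\<le>0. A e = \<mu> *\<^sub>R e))"

text \<open>On the difference of two members the form of \<open>A\<close> is nonpositive, so
  \<open>- Q\<close> must outweigh the coercivity of \<open>P\<close>. The images under
  \<open>Q\<close> of an infinite system would then be separated by \<open>c\<close>, against
  compactness.\<close>

lemma finite_nonpos_system:
  assumes "nonpos_system S"
  shows "finite S"
proof (rule ccontr)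
  assume "infinite S"
  then obtain e :: "nat \<Rightarrow> 'a" where e: "inj e" "range e \<subseteq> S"
    using infinite_countable_subset by blast
  then have eS: "e n \<in> S" for n by auto
  then have e1: "norm (e n) = 1" for n using assms by (simp add: nonpos_system_def)
  have sep: "c \<le> norm (Q (e i) - Q (e j))" if "i \<noteq> j" for i j
  proof -
    have "e i \<noteq> e j" using e(1) that by (simp add: inj_eq)
    then have orth: "e i \<bullet> e j = 0" "e j \<bullet> e i = 0"
      using assms eS unfolding nonpos_system_def pairwise_def orthogonal_def by metis+
    obtain \<mu> \<nu> where ev: "\<mu> \<le> 0" "A (e i) = \<mu> *\<^sub>R e i" "\<nu> \<le> 0" "A (e j) = \<nu> *\<^sub>R e j"
      using assms eS unfolding nonpos_system_def by meson
    define d where "d = e i - e j"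
    have "A d \<bullet> d = \<mu> * (norm (e i))\<^sup>2 + \<nu> * (norm (e j))\<^sup>2"
      by (simp add: d_def blinfun.diff_right ev inner_diff_left inner_diff_right orth
          power2_norm_eq_inner)
    also have "\<dots> \<le> 0" using ev by (simp add: e1)
    finally have "P d \<bullet> d \<le> (- Q) d \<bullet> d"
      by (simp add: A_eq blinfun.add_left blinfun.minus_left inner_add_left)
    with P_coercive[of d] have "(- Q) d \<bullet> d \<ge> c * (norm d)\<^sup>2" by linarith
    from coercive_lower_bound[OF this] have "c * norm d \<le> norm (Q d)" by (simp add: blinfun.minus_left)
    moreover have "1 \<le> norm d"
    proof -
      have "(norm d)\<^sup>2 = (norm (e i))\<^sup>2 + (norm (e j))\<^sup>2"
        by (simp add: d_def power2_norm_eq_inner inner_diff_left inner_diff_right orth)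
      then have "1 \<le> (norm d)\<^sup>2" by (simp add: e1)
      then show ?thesis using abs_le_square_iff[of 1 "norm d"] by simp
    qed
    moreover have "c * 1 \<le> c * norm d" using c_pos \<open>1 \<le> norm d\<close> by (intro mult_left_mono) auto
    ultimately have "c \<le> norm (Q d)" by linarith
    then show ?thesis by (simp add: d_def blinfun.diff_right)
  qed
  obtain r l where r: "strict_mono r" and l: "(\<lambda>n. Q (e (r n))) \<longlonglongrightarrow> l"
    using compact_operator_seq[OF Q_compact, of e 1] e1 by auto
  have "Cauchy (\<lambda>n. Q (e (r n)))" using l Cauchy_convergent_iff convergent_def by blast
  from CauchyD[OF this c_pos] obtain N where
    "\<And>i j. i \<ge> N \<Longrightarrow> j \<ge> N \<Longrightarrow> norm (Q (e (r i)) - Q (e (r j))) < c" by blast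
  from this[of N "Suc N"] sep[of "r N" "r (Suc N)"] show False
    using r by (simp add: strict_mono_eq)
qed

text \<open>The complement in \<open>M\<close> of a maximal system is invariant, so a failure of
  coercivity there would supply one more eigenvector. The version relative to \<open>M\<close> is
  what later compares an arbitrary invariant subspace with the spectral one.\<close>

lemma maximal_nonpos_system:
  assumes M: "closed M" "subspace M" and inv: "blinfun_apply A ` M \<subseteq> M"
  obtains S b where "nonpos_system S" "S \<subseteq> M" "b > 0"
    "\<And>u. u \<in> M \<Longrightarrow> (\<And>e. e \<in> S \<Longrightarrow> u \<bullet> e = 0) \<Longrightarrow> A u \<bullet> u \<ge> b * (norm u)\<^sup>2"
proof -
  define F where "F = {S. S \<subseteq> M \<and> nonpos_system S}"
  have "\<exists>S\<in>F. \<forall>X\<in>F. S \<subseteq> X \<longrightarrow> X = S"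
  proof (rule subset_Zorn')
    fix C assume C: "subset.chain F C"
    then have sub: "C \<subseteq> F" and lin: "\<And>X Y. X \<in> C \<Longrightarrow> Y \<in> C \<Longrightarrow> X \<subseteq> Y \<or> Y \<subseteq> X"
      unfolding subset_chain_def by blast+
    have "pairwise orthogonal (\<Union>C)"
      unfolding pairwise_def
    proof (intro ballI impI)
      fix u v assume "u \<in> \<Union>C" "v \<in> \<Union>C" "u \<noteq> v"
      then obtain X where "X \<in> C" "u \<in> X" "v \<in> X" using lin by blast
      then show "orthogonal u v"
        using sub \<open>u \<noteq> v\<close> unfolding F_def nonpos_system_def pairwise_def by blast
    qed
    then show "\<Union>C \<in> F" using sub unfolding F_def nonpos_system_def by blast
  qed
  then obtain S where "S \<in> F" "\<forall>X\<in>F. S \<subseteq> X \<longrightarrow> X = S" by (rule bexE)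
  then have S: "S \<subseteq> M" "nonpos_system S"
    and max: "\<And>X. X \<subseteq> M \<Longrightarrow> nonpos_system X \<Longrightarrow> S \<subseteq> X \<Longrightarrow> X = S"
    by (simp_all add: F_def)
  define N where "N = M \<inter> (\<Inter>e\<in>S. {u. u \<bullet> e = 0})"
  have N: "closed N" "subspace N"
    using M unfolding N_def by (auto intro!: closed_Int closed_INT closed_Collect_eq
        continuous_intros simp: subspace_def inner_add_left)
  have "A u \<bullet> e = 0" if "u \<in> N" "e \<in> S" for u e
    using that S(2) unfolding nonpos_system_def N_def by (force simp: A_sym)
  then have invN: "blinfun_apply A ` N \<subseteq> N" using inv by (auto simp: N_def)
  have "\<exists>b>0. \<forall>u\<in>N. A u \<bullet> u \<ge> b * (norm u)\<^sup>2"
  proof (rule ccontr)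
    assume "\<not> ?thesis"
    then obtain e \<mu> where e: "e \<in> N" "norm e = 1" "\<mu> \<le> 0" "A e = \<mu> *\<^sub>R e"
      using nonpositive_eigenvector[OF N invN] by blast
    have "nonpos_system (insert e S)"
      using S(2) e unfolding nonpos_system_def N_def
      by (auto simp: pairwise_insert orthogonal_def inner_commute)
    then have "insert e S = S" using S e by (intro max) (auto simp: N_def)
    then have "e \<in> S" by blast
    then have "e \<bullet> e = 0" using e(1) unfolding N_def by blast
    with e(2) show False by simp
  qed
  then obtain b where "b > 0" "\<forall>u\<in>N. A u \<bullet> u \<ge> b * (norm u)\<^sup>2" by blast
  with S show ?thesis by (intro that[of S b]) (auto simp: N_def)
qed

end

section \<open>Spectral splitting and its stability\<close>

text \<open>\<open>F\<close> is an \<eta>-net of the image of the unit ball. Self-adjointness moves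
  \<open>Q\<close> from \<open>g\<close> onto a unit vector \<open>w\<close>, and subtracting the
  net point near \<open>Q w\<close> costs nothing because \<open>g\<close> is orthogonal to
  it.\<close>

lemma compact_operator_small_on_complement:
  fixes Q :: "'a::real_inner \<Rightarrow>\<^sub>L 'a"
  assumes Q: "self_adjoint Q" "compact_operator Q" and "\<eta> > 0"
  obtains F where "finite F" "\<And>g. (\<And>w. w \<in> F \<Longrightarrow> g \<bullet> w = 0) \<Longrightarrow> norm (Q g) \<le> \<eta> * norm g"
proof -
  have "compact (closure (blinfun_apply Q ` cball 0 1))"
    using Q(2) unfolding compact_operator_def by auto
  then obtain F where F: "finite F" "closure (blinfun_apply Q ` cball 0 1) \<subseteq> (\<Union>x\<in>F. ball x \<eta>)"
    unfolding compact_eq_totally_bounded using \<open>\<eta> > 0\<close> by blast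
  show thesis
  proof (rule that[OF F(1)])
    fix g assume g: "\<And>w. w \<in> F \<Longrightarrow> g \<bullet> w = 0"
    show "norm (Q g) \<le> \<eta> * norm g"
    proof (cases "Q g = 0")
      case False
      define w where "w = (1 / norm (Q g)) *\<^sub>R Q g"
      have "w \<in> cball 0 1" using False by (simp add: w_def)
      then have "Q w \<in> closure (blinfun_apply Q ` cball 0 1)"
        by (intro subsetD[OF closure_subset] imageI)
      then obtain z where z: "z \<in> F" "dist z (Q w) < \<eta>" using F(2) by auto
      have "norm (Q g) = w \<bullet> Q g"
        using False by (simp add: w_def power2_norm_eq_inner[symmetric] power2_eq_square)
      also have "\<dots> = (Q w - z) \<bullet> g"
        using Q(1) g[OF z(1)] by (simp add: self_adjoint_def inner_diff_left inner_commute[of z])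
      also have "\<dots> \<le> norm (Q w - z) * norm g" by (rule norm_cauchy_schwarz)
      also have "\<dots> \<le> \<eta> * norm g"
        using z(2) by (intro mult_right_mono) (auto simp: dist_norm norm_minus_commute)
      finally show ?thesis .
    qed (use \<open>\<eta> > 0\<close> in simp)
  qed
qed

lemma member_subset_closure_span_Union:
  assumes "M \<in> F"
  shows "M \<subseteq> closure (span (\<Union>F))"
  using assms closure_subset[of "span (\<Union>F)"] span_superset[of "\<Union>F"] by blast

context Fredholm_form
begin

lemma nonpos_system_norm: "nonpos_system S \<Longrightarrow> e \<in> S \<Longrightarrow> e \<bullet> e = 1"
  by (simp add: nonpos_system_def power2_norm_eq_inner[symmetric])

lemma nonpos_system_inner_A:
  assumes "nonpos_system S" "\<And>e. e \<in> S \<Longrightarrow> u \<bullet> e = 0" "e \<in> S"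
  shows "A u \<bullet> e = 0"
proof -
  obtain \<mu> where "A e = \<mu> *\<^sub>R e" using assms(1,3) unfolding nonpos_system_def by meson
  then show ?thesis using assms(2,3) by (simp add: A_sym)
qed

lemma span_orth_complement:
  assumes "\<And>e. e \<in> S \<Longrightarrow> u \<bullet> e = (0::real)" "v \<in> span S"
  shows "u \<bullet> v = 0"
  using assms(2) by (induction rule: span_induct_alt) (auto simp: inner_add_right assms(1))

text \<open>On the component of \<open>e\<close> orthogonal to \<open>S\<close> the form equals
  \<mu> times the squared norm, hence is nonpositive, while coercivity makes it positive unless the
  component is zero.\<close>

lemma eigenvector_in_span:
  assumes S: "nonpos_system S" and "b > 0"
    and pos: "\<And>u. (\<And>e. e \<in> S \<Longrightarrow> u \<bullet> e = 0) \<Longrightarrow> A u \<bullet> u \<ge> b * (norm u)\<^sup>2"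
    and e: "A e = \<mu> *\<^sub>R e" "\<mu> \<le> 0"
  shows "e \<in> span S"
proof -
  have fin: "finite S" and orth: "pairwise orthogonal S"
    using finite_nonpos_system[OF S] S by (auto simp: nonpos_system_def)
  define n where "n = orth_proj S e"
  define p where "p = e - n"
  have n: "n \<in> span S" by (simp add: n_def orth_proj_in_span)
  have pS: "p \<bullet> v = 0" if "v \<in> span S" for v
    using orth_proj_residual[OF fin orth that] by (simp add: p_def n_def)
  have pe: "p \<bullet> s = 0" if "s \<in> S" for s using pS that by (simp add: span_base)
  have "A p \<bullet> n = 0"
    using span_orth_complement[OF _ n] nonpos_system_inner_A[OF S pe] by blast
  then have "A p \<bullet> p = A p \<bullet> e" by (simp add: p_def inner_diff_right)
  also have "\<dots> = \<mu> * (p \<bullet> e)" by (simp add: A_sym e)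
  also have "p \<bullet> e = p \<bullet> p" using pS[OF n] by (simp add: p_def inner_diff_right)
  finally have "A p \<bullet> p \<le> 0" using e(2) by (simp add: mult_nonpos_nonneg)
  with pos[OF pe] have "b * (norm p)\<^sup>2 \<le> 0" by linarith
  then have "p = 0" using \<open>b > 0\<close> by (simp add: mult_le_0_iff)
  then show ?thesis using n by (simp add: p_def)
qed

text \<open>Both spaces are generated by all admissible invariant subspaces, so each identification
  has two halves: \<open>span S\<close>, respectively its complement, is itself admissible, and it
  contains every admissible subspace. The trivial kernel turns nonpositive eigenvalues into negative
  ones.\<close>

lemma spectral_splitting:
  assumes ker: "{u. A u = 0} = {0}"
  obtains S b where "nonpos_system S" "b > 0"
    "neg_def_space A = span S" "pos_def_space A = {u. \<forall>e\<in>S. u \<bullet> e = 0}"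
    "\<And>u. u \<in> span S \<Longrightarrow> A u \<bullet> u \<le> - b * (norm u)\<^sup>2"
    "\<And>u. \<forall>e\<in>S. u \<bullet> e = 0 \<Longrightarrow> A u \<bullet> u \<ge> b * (norm u)\<^sup>2"
proof -
  obtain S b1 where S: "nonpos_system S" and b1: "b1 > 0"
    and pos: "\<And>u. (\<And>e. e \<in> S \<Longrightarrow> u \<bullet> e = 0) \<Longrightarrow> A u \<bullet> u \<ge> b1 * (norm u)\<^sup>2"
    using maximal_nonpos_system[OF closed_UNIV subspace_UNIV subset_UNIV]
    by (metis UNIV_I)
  have fin: "finite S" and orth: "pairwise orthogonal S"
    using finite_nonpos_system[OF S] S by (auto simp: nonpos_system_def)
  obtain \<mu> where \<mu>: "\<And>e. e \<in> S \<Longrightarrow> A e = \<mu> e *\<^sub>R e" "\<And>e. e \<in> S \<Longrightarrow> \<mu> e \<le> 0"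
    using S unfolding nonpos_system_def by metis
  have \<mu>_neg: "\<mu> e < 0" if "e \<in> S" for e
  proof -
    have "\<mu> e \<noteq> 0"
    proof
      assume "\<mu> e = 0"
      then have "e \<in> {u. A u = 0}" using \<mu>(1)[OF that] by simp
      then have "e = 0" using ker by simp
      then show False using nonpos_system_norm[OF S that] by simp
    qed
    then show ?thesis using \<mu>(2)[OF that] by simp
  qed
  \<comment> \<open>Inserting \<open>b1\<close> yields one constant for both signs and keeps the set
    nonempty when \<open>S\<close> is empty.\<close>
  define b2 where "b2 = Min (insert b1 ((\<lambda>e. - \<mu> e) ` S))"
  have b2: "b2 > 0" "b2 \<le> b1" "\<And>e. e \<in> S \<Longrightarrow> \<mu> e \<le> - b2"
  proof -
    show "b2 > 0" unfolding b2_def using fin b1 \<mu>_neg by (subst Min_gr_iff) auto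
    show "b2 \<le> b1" unfolding b2_def using fin by (intro Min_le) auto
    fix e assume "e \<in> S"
    then have "b2 \<le> - \<mu> e" unfolding b2_def using fin by (intro Min_le) auto
    then show "\<mu> e \<le> - b2" by simp
  qed
  have neg: "A u \<bullet> u \<le> - b2 * (norm u)\<^sup>2" if "u \<in> span S" for u
  proof -
    have u: "u = (\<Sum>e\<in>S. (u \<bullet> e) *\<^sub>R e)"
      using orth_proj_eq[OF fin orth that] nonpos_system_norm[OF S]
      by (simp add: orth_proj_def)
    have "(norm u)\<^sup>2 = (\<Sum>e\<in>S. (u \<bullet> e) *\<^sub>R e) \<bullet> u"
      by (subst u[symmetric]) (rule power2_norm_eq_inner)
    also have "\<dots> = (\<Sum>e\<in>S. (u \<bullet> e)\<^sup>2)"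
      unfolding inner_sum_left by (intro sum.cong) (auto simp: power2_eq_square inner_commute)
    finally have nu: "(norm u)\<^sup>2 = (\<Sum>e\<in>S. (u \<bullet> e)\<^sup>2)" .
    have "A u = A (\<Sum>e\<in>S. (u \<bullet> e) *\<^sub>R e)" by (rule arg_cong[OF u])
    also have "\<dots> = (\<Sum>e\<in>S. (u \<bullet> e) *\<^sub>R A e)"
      by (simp add: blinfun.sum_right blinfun.scaleR_right)
    finally have "A u = (\<Sum>e\<in>S. (u \<bullet> e) *\<^sub>R A e)" .
    then have "A u \<bullet> u = (\<Sum>e\<in>S. (u \<bullet> e) *\<^sub>R A e) \<bullet> u" by simp
    also have "\<dots> = (\<Sum>e\<in>S. \<mu> e * (u \<bullet> e)\<^sup>2)"
      unfolding inner_sum_left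
      by (intro sum.cong) (auto simp: \<mu>(1) power2_eq_square inner_commute[of u])
    also have "\<dots> \<le> (\<Sum>e\<in>S. - b2 * (u \<bullet> e)\<^sup>2)"
      by (intro sum_mono mult_right_mono b2) auto
    also have "\<dots> = - b2 * (norm u)\<^sup>2" by (simp add: nu sum_distrib_left)
    finally show ?thesis .
  qed
  have pos2: "A u \<bullet> u \<ge> b2 * (norm u)\<^sup>2" if "\<forall>e\<in>S. u \<bullet> e = 0" for u
    using pos[OF bspec[OF that]] b2(2) mult_right_mono[of b2 b1 "(norm u)\<^sup>2"] by force
  define N where "N = {u. \<forall>e\<in>S. u \<bullet> e = 0}"
  have N_eq: "N = (\<Inter>e\<in>S. {u. u \<bullet> e = 0})" by (auto simp: N_def)
  have N: "closed N" "subspace N"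
    unfolding N_eq by (auto intro!: closed_INT closed_Collect_eq
        continuous_intros simp: subspace_def inner_add_left)
  have invN: "blinfun_apply A ` N \<subseteq> N"
    using nonpos_system_inner_A[OF S] by (auto simp: N_def)
  have posN: "A u \<bullet> u > 0" if "u \<in> N" "u \<noteq> 0" for u
    using pos2[of u] that b2(1) by (auto simp: N_def intro: less_le_trans[rotated])
  have invS: "blinfun_apply A ` span S \<subseteq> span S"
  proof
    fix y assume "y \<in> blinfun_apply A ` span S"
    then obtain u where "u \<in> span S" "y = A u" by blast
    have "A u \<in> span S"
      using \<open>u \<in> span S\<close>
      by (induction rule: span_induct_alt)
        (simp_all add: blinfun.add_right blinfun.scaleR_right \<mu>(1) span_zero span_add span_scale span_base)
    then show "y \<in> span S" using \<open>y = A u\<close> by simp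
  qed
  have negS: "A u \<bullet> u < 0" if "u \<in> span S" "u \<noteq> 0" for u
    using neg[OF that(1)] that(2) b2(1) by (auto intro: le_less_trans)
  \<comment> \<open>A maximal system inside \<open>M\<close> spans \<open>M\<close>, since on its
    complement in \<open>M\<close> the form is nonnegative and yet negative off the origin; its
    eigenvectors lie in \<open>span S\<close>.\<close>
  have M_neg: "M \<subseteq> span S"
    if M: "subspace M" "closed M" "blinfun_apply A ` M \<subseteq> M" "\<forall>u\<in>M. u \<noteq> 0 \<longrightarrow> A u \<bullet> u < 0" for M
  proof
    fix u assume u: "u \<in> M"
    obtain S' b' where S': "nonpos_system S'" "S' \<subseteq> M" and b': "b' > 0"
      and pos': "\<And>u. u \<in> M \<Longrightarrow> (\<And>e. e \<in> S' \<Longrightarrow> u \<bullet> e = 0) \<Longrightarrow> A u \<bullet> u \<ge> b' * (norm u)\<^sup>2"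
      using maximal_nonpos_system[OF M(2,1,3)] by metis
    have fin': "finite S'" and orth': "pairwise orthogonal S'"
      using finite_nonpos_system[OF S'(1)] S'(1) by (auto simp: nonpos_system_def)
    have sub: "S' \<subseteq> span S"
    proof
      fix e assume "e \<in> S'"
      then obtain \<nu> where "\<nu> \<le> 0" "A e = \<nu> *\<^sub>R e"
        using S'(1) unfolding nonpos_system_def by meson
      then show "e \<in> span S" using eigenvector_in_span[OF S b1 pos] by blast
    qed
    have "span S' \<subseteq> M" using S'(2) M(1) by (rule span_minimal)
    then have v: "u - orth_proj S' u \<in> M"
      using u orth_proj_in_span[of S' u] M(1) by (auto intro: subspace_diff)
    have "(u - orth_proj S' u) \<bullet> e = 0" if "e \<in> S'" for e
      using orth_proj_residual[OF fin' orth' span_base[OF that]] .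
    from pos'[OF v this] have "u - orth_proj S' u = 0"
      using M(4) v b' by (smt (verit) mult_nonneg_nonneg zero_le_power2)
    then have "u \<in> span S'" using orth_proj_in_span[of S' u] by simp
    then show "u \<in> span S" using span_mono[OF sub] by (simp add: span_span subset_iff)
  qed
  \<comment> \<open>Let \<open>m\<close> be the projection of an eigenvector \<open>e\<close> to
    \<open>M\<close>. Since \<open>A m\<close> stays in \<open>M\<close>, the form at
    \<open>m\<close> is \<open>\<mu> e\<close> times its squared norm, and positivity on
    \<open>M\<close> forces \<open>m = 0\<close>.\<close>
  have M_pos: "M \<subseteq> N"
    if M: "subspace M" "closed M" "blinfun_apply A ` M \<subseteq> M" "\<forall>u\<in>M. u \<noteq> 0 \<longrightarrow> A u \<bullet> u > 0" for M
  proof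
    fix u assume u: "u \<in> M"
    have "u \<bullet> e = 0" if e: "e \<in> S" for e
    proof -
      obtain m where m: "m \<in> M" "\<And>v. v \<in> M \<Longrightarrow> (e - m) \<bullet> v = 0"
        using orthogonal_projection_exists[OF M(2,1)] by metis
      then have em: "e \<bullet> v = m \<bullet> v" if "v \<in> M" for v using that by (simp add: inner_diff_left)
      have "A m \<in> M" using M(3) m(1) by blast
      have "A m \<bullet> m = A m \<bullet> e" using em[OF \<open>A m \<in> M\<close>] by (simp add: inner_commute)
      also have "\<dots> = \<mu> e * (m \<bullet> m)" using em[OF m(1)] A_sym[of m e]
        by (simp add: \<mu>(1)[OF e] inner_commute[of m e])
      also have "\<dots> \<le> 0" using \<mu>(2)[OF e] by (simp add: mult_nonpos_nonneg)
      finally have "m = 0" using M(4) m(1) by force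
      then show ?thesis using em[OF u] by (simp add: inner_commute)
    qed
    then show "u \<in> N" by (simp add: N_def)
  qed
  have "neg_def_space A = span S"
  proof (rule antisym)
    have "span (\<Union> {M. subspace M \<and> closed M \<and> blinfun_apply A ` M \<subseteq> M \<and>
        (\<forall>u\<in>M. u \<noteq> 0 \<longrightarrow> A u \<bullet> u < 0)}) \<subseteq> span S"
      by (intro span_minimal subspace_span Union_least) (use M_neg in blast)
    then show "neg_def_space A \<subseteq> span S"
      unfolding neg_def_space_def by (intro closure_minimal closed_span_finite fin)
    have "span S \<in> {M. subspace M \<and> closed M \<and> blinfun_apply A ` M \<subseteq> M \<and>
        (\<forall>u\<in>M. u \<noteq> 0 \<longrightarrow> A u \<bullet> u < 0)}"
      using negS invS closed_span_finite[OF fin] subspace_span by simp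
    then show "span S \<subseteq> neg_def_space A"
      unfolding neg_def_space_def by (rule member_subset_closure_span_Union)
  qed
  moreover have "pos_def_space A = N"
  proof (rule antisym)
    have "span (\<Union> {M. subspace M \<and> closed M \<and> blinfun_apply A ` M \<subseteq> M \<and>
        (\<forall>u\<in>M. u \<noteq> 0 \<longrightarrow> A u \<bullet> u > 0)}) \<subseteq> N"
      by (intro span_minimal N Union_least) (use M_pos in blast)
    then show "pos_def_space A \<subseteq> N"
      unfolding pos_def_space_def by (intro closure_minimal N)
    have "N \<in> {M. subspace M \<and> closed M \<and> blinfun_apply A ` M \<subseteq> M \<and>
        (\<forall>u\<in>M. u \<noteq> 0 \<longrightarrow> A u \<bullet> u > 0)}"
      using posN invN N by simp
    then show "N \<subseteq> pos_def_space A"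
      unfolding pos_def_space_def by (rule member_subset_closure_span_Union)
  qed
  ultimately show ?thesis using that[OF S b2(1) _ _ neg pos2] unfolding N_def by blast
qed

text \<open>Splitting \<open>h = f + g\<close> with \<open>f\<close> in a finite-dimensional space and \<open>g\<close> orthogonal to it for
  the form of \<open>P\<close> replaces weak compactness: strong convergence of \<open>P\<^sub>x\<close> is uniform on \<open>f\<close>,
  the compact part is small on \<open>g\<close>, and only a uniform lower bound of \<open>P\<^sub>x\<close> is needed there.\<close>
lemma perturbation_coercive:
  fixes Px Qx :: "'b \<Rightarrow> 'a \<Rightarrow>\<^sub>L 'a"
  assumes adj: "self_adjoint P" "self_adjoint Q" "eventually (\<lambda>x. self_adjoint (Px x)) net"
    and strong: "\<And>u. ((\<lambda>x. Px x u) \<longlongrightarrow> P u) net" and Q: "(Qx \<longlongrightarrow> Q) net"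
    and coer: "eventually (\<lambda>x. \<forall>u. Px x u \<bullet> u \<ge> c * (norm u)\<^sup>2) net"
    and S: "finite S" and b: "b > 0"
    and pos: "\<And>u. \<forall>e\<in>S. u \<bullet> e = 0 \<Longrightarrow> A u \<bullet> u \<ge> b * (norm u)\<^sup>2"
  obtains a where "a > 0"
    "eventually (\<lambda>x. \<forall>h. (\<forall>e\<in>S. h \<bullet> e = 0) \<longrightarrow> (Px x + Qx x) h \<bullet> h \<ge> a * (norm h)\<^sup>2) net"
proof -
  define \<kappa> where "\<kappa> = min b c"
  have \<kappa>: "\<kappa> > 0" "\<kappa> \<le> b" "\<kappa> \<le> c" using b c_pos by (auto simp: \<kappa>_def)
  \<comment> \<open>\<omega> limits the changes of \<open>P\<close> and \<open>Q\<close>, \<eta> the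
    size of the compact part on \<open>g\<close>; the fractions are small enough for all error and
    mixed terms to leave at least half of \<kappa>.\<close>
  define \<omega> \<eta> where "\<omega> = \<kappa> / 16" and "\<eta> = \<kappa> / 8"
  have pos_small: "\<omega> > 0" "\<eta> > 0" using \<kappa> by (auto simp: \<omega>_def \<eta>_def)
  have Psym: "P u \<bullet> v = P v \<bullet> u" and Qsym: "Q u \<bullet> v = Q v \<bullet> u" for u v
    using adj(1,2) unfolding self_adjoint_def by (simp_all add: inner_commute)
  obtain F where F: "finite F" "\<And>g. (\<And>w. w \<in> F \<Longrightarrow> g \<bullet> w = 0) \<Longrightarrow> norm (Q g) \<le> \<eta> * norm g"
    using compact_operator_small_on_complement[OF adj(2) Q_compact pos_small(2)] by metis
  have "\<exists>m. P m = w" for w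
  proof -
    obtain m where "\<And>v. v \<in> UNIV \<Longrightarrow> P m \<bullet> v = w \<bullet> v"
      using Lax_Milgram_symmetric[OF closed_UNIV subspace_UNIV adj(1) c_pos P_coercive
          bounded_linear_inner_right, of w] by metis
    then have "(P m - w) \<bullet> (P m - w) = 0" by (simp add: inner_diff_left)
    then show ?thesis by auto
  qed
  then obtain G where G: "\<And>w. P (G w) = w" by metis
  \<comment> \<open>\<open>M\<close> is spanned by preimages under \<open>P\<close>, so being
    orthogonal to \<open>M\<close> for the form of \<open>P\<close> implies ordinary orthogonality
    to \<open>F \<union> S\<close>. Hence \<open>Q\<close> is small on \<open>g\<close>, and
    \<open>f = h - g\<close> remains orthogonal to \<open>S\<close>, where the form of
    \<open>A\<close> is coercive.\<close>
  define M where "M = span (G ` (F \<union> S))"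
  have fin: "finite (G ` (F \<union> S))" using F(1) S by simp
  then have M: "closed M" "subspace M" unfolding M_def by (auto intro: closed_span_finite)
  obtain C where CM: "\<And>(D :: 'a \<Rightarrow>\<^sub>L 'a) u. u \<in> M \<Longrightarrow> norm (D u) \<le> norm u * (\<Sum>c\<in>C. norm (D c))"
    using linear_bound_on_span_finite[OF fin] unfolding M_def by metis
  have "((\<lambda>x. \<Sum>u\<in>C. norm ((Px x - P) u)) \<longlongrightarrow> (\<Sum>u\<in>C. norm (P u - P u))) net"
    unfolding blinfun.diff_left by (intro tendsto_intros strong)
  then have ev1: "eventually (\<lambda>x. (\<Sum>u\<in>C. norm ((Px x - P) u)) < \<omega>) net"
    using pos_small(1) by (intro order_tendstoD) auto
  have ev2: "eventually (\<lambda>x. norm (Qx x - Q) < \<omega>) net"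
    using tendstoD[OF Q pos_small(1)] by (simp add: dist_norm)
  have "eventually (\<lambda>x. \<forall>h. (\<forall>e\<in>S. h \<bullet> e = 0) \<longrightarrow> (Px x + Qx x) h \<bullet> h \<ge> \<kappa> / 4 * (norm h)\<^sup>2) net"
    using ev1 ev2 coer adj(3)
  proof eventually_elim
    case (elim x)
    show ?case
    proof (intro allI impI)
      fix h assume h: "\<forall>e\<in>S. h \<bullet> e = 0"
      have "bounded_linear (\<lambda>v. P h \<bullet> v)" by (rule bounded_linear_inner_right)
      then obtain f where f: "f \<in> M" "\<And>v. v \<in> M \<Longrightarrow> P f \<bullet> v = P h \<bullet> v"
        using Lax_Milgram_symmetric[OF M adj(1) c_pos P_coercive] by metis
      define g where "g = h - f"
      have h_eq: "h = f + g" by (simp add: g_def)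
      have PgM: "P g \<bullet> v = 0" if "v \<in> M" for v
        using f(2)[OF that] by (simp add: g_def blinfun.diff_right inner_diff_left)
      have gFS: "g \<bullet> w = 0" if "w \<in> F \<union> S" for w
      proof -
        have "G w \<in> M" using that by (simp add: M_def span_base)
        from PgM[OF this] show ?thesis using Psym[of g "G w"] by (simp add: G inner_commute)
      qed
      have Qg: "norm (Q g) \<le> \<eta> * norm g" using F(2) gFS by blast
      have "f \<bullet> e = 0" if "e \<in> S" for e
        using bspec[OF h that] gFS[of e] that by (simp add: h_eq inner_add_left)
      then have Af: "A f \<bullet> f \<ge> b * (norm f)\<^sup>2" by (intro pos ballI)
      define p q where "p = norm f" and "q = norm g"
      have pq: "p \<ge> 0" "q \<ge> 0" by (simp_all add: p_def q_def)
      have Df: "norm (Px x f - P f) \<le> \<omega> * p"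
      proof -
        have "norm ((Px x - P) f) \<le> norm f * (\<Sum>u\<in>C. norm ((Px x - P) u))" by (rule CM[OF f(1)])
        also have "\<dots> \<le> norm f * \<omega>" using elim(1) by (intro mult_left_mono) auto
        finally show ?thesis by (simp add: blinfun.diff_left p_def mult.commute)
      qed
      have inner_ge: "u \<bullet> v \<ge> - (r * norm v)" if "norm u \<le> r" for u v :: 'a and r
      proof -
        have "\<bar>u \<bullet> v\<bar> \<le> norm u * norm v" by (rule Cauchy_Schwarz_ineq2)
        also have "\<dots> \<le> r * norm v" using that by (intro mult_right_mono) auto
        finally show ?thesis by linarith
      qed
      have 1: "Px x f \<bullet> f \<ge> P f \<bullet> f - \<omega> * p * p"
        using inner_ge[OF Df, of f] by (simp add: inner_diff_left p_def)
      \<comment> \<open>\<open>P f \<bullet> g\<close> vanishes by the choice of \<open>f\<close>,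
        so the mixed term is only as large as the change of \<open>P\<close> on
        \<open>f\<close>.\<close>
      have 2: "Px x f \<bullet> g \<ge> - (\<omega> * p * q)"
        using inner_ge[OF Df, of g] PgM[OF f(1)] Psym[of f g] by (simp add: inner_diff_left q_def)
      have 3: "Px x g \<bullet> g \<ge> c * q\<^sup>2" using elim(3) by (simp add: q_def)
      have "Px x g \<bullet> f = Px x f \<bullet> g"
        using elim(4) unfolding self_adjoint_def by (simp add: inner_commute)
      then have 4: "Px x h \<bullet> h = Px x f \<bullet> f + 2 * (Px x f \<bullet> g) + Px x g \<bullet> g"
        by (simp add: h_eq blinfun.add_right inner_add_left inner_add_right)
      have nh: "(norm h)\<^sup>2 \<le> 2 * p\<^sup>2 + 2 * q\<^sup>2"
      proof -
        have "norm h \<le> p + q" unfolding h_eq p_def q_def by (rule norm_triangle_ineq)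
        then have "(norm h)\<^sup>2 \<le> (p + q)\<^sup>2" by (intro power_mono) auto
        moreover have "0 \<le> (p - q)\<^sup>2" by simp
        ultimately show ?thesis by (simp add: power2_sum power2_diff)
      qed
      have "norm (Qx x h - Q h) \<le> \<omega> * norm h"
      proof -
        have "norm ((Qx x - Q) h) \<le> norm (Qx x - Q) * norm h" by (rule norm_blinfun)
        also have "\<dots> \<le> \<omega> * norm h" using elim(2) by (intro mult_right_mono) auto
        finally show ?thesis by (simp add: blinfun.diff_left)
      qed
      from inner_ge[OF this, of h] have 5: "Qx x h \<bullet> h \<ge> Q h \<bullet> h - \<omega> * (norm h)\<^sup>2"
        by (simp add: inner_diff_left power2_eq_square)
      have 6: "Q h \<bullet> h = Q f \<bullet> f + 2 * (Q g \<bullet> f) + Q g \<bullet> g"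
        using Qsym[of f g] by (simp add: h_eq blinfun.add_right inner_add_left inner_add_right)
      have 7: "Q g \<bullet> f \<ge> - (\<eta> * q * p)" "Q g \<bullet> g \<ge> - (\<eta> * q * q)"
        using inner_ge[OF Qg] by (simp_all add: p_def q_def)
      have 8: "A f \<bullet> f = P f \<bullet> f + Q f \<bullet> f" by (simp add: A_eq blinfun.add_left inner_add_left)
      have 9: "\<kappa> * p\<^sup>2 \<le> b * p\<^sup>2" "\<kappa> * q\<^sup>2 \<le> c * q\<^sup>2" using \<kappa> by (auto intro: mult_right_mono)
      have 10: "\<omega> * (norm h)\<^sup>2 \<le> \<omega> * (2 * p\<^sup>2 + 2 * q\<^sup>2)"
        using nh pos_small by (intro mult_left_mono) auto
      have 11: "(\<omega> + \<eta>) * (2 * p * q) \<le> (\<omega> + \<eta>) * (p\<^sup>2 + q\<^sup>2)"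
        using pos_small sum_squares_bound[of p q] by (intro mult_left_mono) auto
      have 12: "(Px x + Qx x) h \<bullet> h = Px x h \<bullet> h + Qx x h \<bullet> h"
        by (simp add: blinfun.add_left inner_add_left)
      have "(Px x + Qx x) h \<bullet> h \<ge> \<kappa> * p\<^sup>2 + \<kappa> * q\<^sup>2 - \<omega> * p * p - 2 * (\<omega> * p * q)
          - \<omega> * (2 * p\<^sup>2 + 2 * q\<^sup>2) - 2 * (\<eta> * q * p) - \<eta> * q * q"
        using 1 2 3 4 5 6 7 8 9 10 12 Af unfolding p_def[symmetric] by linarith
      then have 13: "(Px x + Qx x) h \<bullet> h \<ge> \<kappa> * p\<^sup>2 + \<kappa> * q\<^sup>2 - \<omega> * p\<^sup>2
          - (\<omega> + \<eta>) * (p\<^sup>2 + q\<^sup>2) - \<omega> * (2 * p\<^sup>2 + 2 * q\<^sup>2) - \<eta> * q\<^sup>2"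
        using 11 by (simp add: algebra_simps power2_eq_square)
      have "\<kappa> * p\<^sup>2 \<ge> 0" "\<kappa> * q\<^sup>2 \<ge> 0" using \<kappa>(1) by simp_all
      \<comment> \<open>The coefficients left over are \<open>5/8\<close> and \<open>9/16\<close> of
        \<kappa>. One half of \<kappa> is kept, and passing from \<open>p^2 + q^2\<close> to the
        squared norm of \<open>h\<close> costs a further factor two.\<close>
      moreover have "\<kappa> * p\<^sup>2 + \<kappa> * q\<^sup>2 - \<omega> * p\<^sup>2
          - (\<omega> + \<eta>) * (p\<^sup>2 + q\<^sup>2) - \<omega> * (2 * p\<^sup>2 + 2 * q\<^sup>2) - \<eta> * q\<^sup>2
        = \<kappa> / 2 * (p\<^sup>2 + q\<^sup>2) + \<kappa> * p\<^sup>2 / 8 + \<kappa> * q\<^sup>2 / 16"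
        by (simp add: \<omega>_def \<eta>_def field_simps)
      ultimately have "(Px x + Qx x) h \<bullet> h \<ge> \<kappa> / 2 * (p\<^sup>2 + q\<^sup>2)"
        using 13 by linarith
      then show "(Px x + Qx x) h \<bullet> h \<ge> \<kappa> / 4 * (norm h)\<^sup>2"
        using mult_left_mono[OF nh, of "\<kappa> / 4"] \<kappa>(1) by (simp add: algebra_simps)
    qed
  qed
  then show thesis using \<kappa>(1) by (intro that[of "\<kappa> / 4"]) auto
qed

text \<open>On the finite-dimensional \<open>span S\<close> pointwise convergence is uniform, so
  half of the negativity constant survives.\<close>

lemma perturbation_negative:
  fixes Px Qx :: "'b \<Rightarrow> 'a \<Rightarrow>\<^sub>L 'a"
  assumes strong: "\<And>u. ((\<lambda>x. Px x u) \<longlongrightarrow> P u) net" and Q: "(Qx \<longlongrightarrow> Q) net"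
    and S: "finite S" and b: "b > 0"
    and neg: "\<And>u. u \<in> span S \<Longrightarrow> A u \<bullet> u \<le> - b * (norm u)\<^sup>2"
  shows "eventually (\<lambda>x. \<forall>h\<in>span S. (Px x + Qx x) h \<bullet> h \<le> - (b / 2) * (norm h)\<^sup>2) net"
proof -
  obtain C where C: "finite C"
    "\<And>(D :: 'a \<Rightarrow>\<^sub>L 'a) u. u \<in> span S \<Longrightarrow> norm (D u) \<le> norm u * (\<Sum>c\<in>C. norm (D c))"
    using linear_bound_on_span_finite[OF S] by metis
  define D where "D x = (Px x - P) + (Qx x - Q)" for x
  have "((\<lambda>x. \<Sum>u\<in>C. norm (D x u)) \<longlongrightarrow> (\<Sum>u\<in>C. norm ((P u - P u) + (Q u - Q u)))) net"
    unfolding D_def blinfun.diff_left blinfun.add_left by (intro tendsto_intros strong Q)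
  then have "eventually (\<lambda>x. (\<Sum>u\<in>C. norm (D x u)) < b / 2) net"
    using b by (intro order_tendstoD) auto
  then show ?thesis
  proof eventually_elim
    case (elim x)
    show ?case
    proof
      fix h assume h: "h \<in> span S"
      have "D x h \<bullet> h \<le> norm (D x h) * norm h" by (rule norm_cauchy_schwarz)
      also have "\<dots> \<le> (norm h * (\<Sum>u\<in>C. norm (D x u))) * norm h"
        by (intro mult_right_mono C(2) h) auto
      also have "\<dots> \<le> (norm h * (b / 2)) * norm h"
        using elim by (intro mult_right_mono mult_left_mono) auto
      finally have "D x h \<bullet> h \<le> b / 2 * (norm h)\<^sup>2" by (simp add: power2_eq_square algebra_simps)
      moreover have "(Px x + Qx x) h \<bullet> h = A h \<bullet> h + D x h \<bullet> h"
        by (simp add: D_def A_eq blinfun.add_left blinfun.diff_left inner_add_left inner_diff_left)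
      ultimately show "(Px x + Qx x) h \<bullet> h \<le> - (b / 2) * (norm h)\<^sup>2"
        using neg[OF h] by (simp add: algebra_simps)
    qed
  qed
qed

end

section \<open>Radial rescaling\<close>

text \<open>For nonzero \<open>u\<close> with \<open>f u \<ge> 0\<close> this is the point on the
  ray of \<open>u\<close> whose squared norm is \<open>f u\<close>: in the new variable
  \<open>f\<close> becomes the squared norm.\<close>

definition radial_scale :: "('a::real_normed_vector \<Rightarrow> real) \<Rightarrow> 'a \<Rightarrow> 'a" where
  "radial_scale f u = (sqrt (f u) / norm u) *\<^sub>R u"

lemma radial_scale_0 [simp]: "radial_scale f 0 = 0"
  by (simp add: radial_scale_def)

text \<open>\<open>f_mono\<close> is strict growth in the squared radius and makes the equation on
  each ray uniquely solvable; \<open>\<epsilon>\<^sup>2 \<le> c * \<delta>\<^sup>2\<close> ensures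
  that all values below \<open>\<epsilon>\<^sup>2\<close> are reached before radius \<delta>. The
  parameter space \<open>Z\<close> provides joint continuity and is instantiated in two
  ways.\<close>

locale radial_family =
  fixes Z :: "'z::metric_space set" and S :: "'a::real_normed_vector set"
    and f :: "'z \<Rightarrow> 'a \<Rightarrow> real" and c \<delta> \<epsilon> :: real
  assumes S: "subspace S" and c: "c > 0" and \<delta>: "\<delta> > 0" and \<epsilon>: "\<epsilon> > 0" "\<epsilon>\<^sup>2 \<le> c * \<delta>\<^sup>2"
    and f_0: "\<And>z. z \<in> Z \<Longrightarrow> f z 0 = 0"
    and f_cont: "continuous_on (Z \<times> (S \<inter> cball 0 \<delta>)) (\<lambda>(z, u). f z u)"
    and f_mono: "\<And>z e s t. z \<in> Z \<Longrightarrow> e \<in> S \<Longrightarrow> norm e = 1 \<Longrightarrow> 0 \<le> s \<Longrightarrow> s \<le> t \<Longrightarrow> t \<le> \<delta> \<Longrightarrow>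
      c * (t\<^sup>2 - s\<^sup>2) \<le> f z (t *\<^sub>R e) - f z (s *\<^sub>R e)"
begin

lemma f_ge:
  assumes "z \<in> Z" "u \<in> S" "norm u \<le> \<delta>"
  shows "c * (norm u)\<^sup>2 \<le> f z u"
proof (cases "u = 0")
  case False
  then show ?thesis
    using f_mono[of z "u /\<^sub>R norm u" 0 "norm u"] assms S f_0[of z] by (simp add: subspace_scale)
qed (use assms f_0 in simp)

lemma f_nonneg: "z \<in> Z \<Longrightarrow> u \<in> S \<Longrightarrow> norm u \<le> \<delta> \<Longrightarrow> 0 \<le> f z u"
  using f_ge[of z u] c by (smt (verit) mult_nonneg_nonneg zero_le_power2)

lemma norm_radial_scale:
  assumes "z \<in> Z" "u \<in> S" "norm u \<le> \<delta>"
  shows "norm (radial_scale (f z) u) = sqrt (f z u)"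
  using f_nonneg[OF assms] f_0[OF assms(1)] by (cases "u = 0") (auto simp: radial_scale_def)

lemma radial_scale_in: "u \<in> S \<Longrightarrow> radial_scale (f z) u \<in> S"
  using S by (simp add: radial_scale_def subspace_scale)

text \<open>At the origin the direction of \<open>u\<close> has no limit; continuity there comes
  from the norm \<open>sqrt (f z u)\<close>, which tends to zero.\<close>

lemma continuous_on_radial_scale:
  "continuous_on (Z \<times> (S \<inter> cball 0 \<delta>)) (\<lambda>(z, u). radial_scale (f z) u)"
  unfolding continuous_on_eq_continuous_within
proof safe
  fix z u assume z: "z \<in> Z" and u: "u \<in> S" "u \<in> cball 0 \<delta>"
  let ?F = "at (z, u) within Z \<times> (S \<inter> cball 0 \<delta>)"
  have lim_f: "((\<lambda>(z, u). f z u) \<longlongrightarrow> f z u) ?F"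
    using f_cont z u unfolding continuous_on_def by force
  have lim_u: "(snd \<longlongrightarrow> u) ?F"
    using tendsto_snd[OF tendsto_ident_at, of "(z, u)"] by simp
  have lim_sqrt: "((\<lambda>w. sqrt (f (fst w) (snd w))) \<longlongrightarrow> sqrt (f z u)) ?F"
    using tendsto_real_sqrt[OF lim_f] by (simp add: case_prod_unfold)
  show "continuous ?F (\<lambda>(z, u). radial_scale (f z) u)"
  proof (cases "u = 0")
    case True
    have "((\<lambda>w. norm (radial_scale (f (fst w)) (snd w))) \<longlongrightarrow> 0) ?F"
    proof (rule Lim_transform_eventually)
      show "((\<lambda>w. sqrt (f (fst w) (snd w))) \<longlongrightarrow> 0) ?F"
        using lim_sqrt f_0[OF z] True by simp
      show "\<forall>\<^sub>F w in ?F. sqrt (f (fst w) (snd w)) = norm (radial_scale (f (fst w)) (snd w))"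
        unfolding eventually_at_filter
        by (intro always_eventually) (auto simp: norm_radial_scale)
    qed
    then have "((\<lambda>w. radial_scale (f (fst w)) (snd w)) \<longlongrightarrow> 0) ?F"
      by (rule tendsto_norm_zero_cancel)
    then show ?thesis using True by (simp add: continuous_within case_prod_unfold)
  next
    case False
    then show ?thesis
      unfolding continuous_within case_prod_unfold radial_scale_def fst_conv snd_conv
      by (intro tendsto_intros lim_sqrt lim_u) auto
  qed
qed

section \<open>Inverse of the radial rescaling\<close>

lemma radial_solution_ex:
  assumes "z \<in> Z" "p \<in> S" "p \<noteq> 0" "norm p < \<epsilon>"
  shows "\<exists>t>0. t < \<delta> \<and> f z (t *\<^sub>R (p /\<^sub>R norm p)) = (norm p)\<^sup>2"
proof -
  define e where "e = p /\<^sub>R norm p"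
  have e: "e \<in> S" "norm e = 1" using assms S by (auto simp: e_def subspace_scale)
  have p_less: "(norm p)\<^sup>2 < c * \<delta>\<^sup>2"
    using assms(4) \<epsilon> by (intro less_le_trans[OF power_strict_mono[of _ \<epsilon>]]) auto
  also have "\<dots> \<le> f z (\<delta> *\<^sub>R e)" using f_mono[OF assms(1) e, of 0 \<delta>] \<delta> f_0[OF assms(1)] by simp
  finally have 1: "(norm p)\<^sup>2 < f z (\<delta> *\<^sub>R e)" .
  have "continuous_on {0..\<delta>} (\<lambda>t. (\<lambda>(z, u). f z u) (z, t *\<^sub>R e))"
    using assms(1) e S
    by (intro continuous_on_compose2[OF f_cont] continuous_intros) (auto simp: subspace_scale)
  then have "\<exists>t. 0 \<le> t \<and> t \<le> \<delta> \<and> f z (t *\<^sub>R e) = (norm p)\<^sup>2"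
    using 1 \<delta> f_0[OF assms(1)] by (intro IVT') auto
  then obtain t where t: "0 \<le> t" "t \<le> \<delta>" "f z (t *\<^sub>R e) = (norm p)\<^sup>2" by blast
  moreover have "t \<noteq> 0" using t(3) f_0[OF assms(1)] assms(3) by auto
  moreover have "t \<noteq> \<delta>" using t(3) 1 by auto
  ultimately show ?thesis by (intro exI[of _ t]) (auto simp: e_def)
qed

text \<open>For \<open>p \<noteq> 0\<close> growth along the ray makes the choice unique. At
  \<open>p = 0\<close> the direction is the zero vector, so whatever radius is chosen yields
  \<open>radial_inv z 0 = 0\<close>.\<close>

definition radius :: "'z \<Rightarrow> 'a \<Rightarrow> real" where
  "radius z p = (SOME t. t > 0 \<and> t < \<delta> \<and> f z (t *\<^sub>R (p /\<^sub>R norm p)) = (norm p)\<^sup>2)"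

definition radial_inv :: "'z \<Rightarrow> 'a \<Rightarrow> 'a" where
  "radial_inv z p = radius z p *\<^sub>R (p /\<^sub>R norm p)"

lemma radius:
  assumes "z \<in> Z" "p \<in> S" "p \<noteq> 0" "norm p < \<epsilon>"
  shows "radius z p > 0" "radius z p < \<delta>" "f z (radius z p *\<^sub>R (p /\<^sub>R norm p)) = (norm p)\<^sup>2"
  using someI_ex[OF radial_solution_ex[OF assms]] unfolding radius_def by auto

lemma radial_inv_0 [simp]: "radial_inv z 0 = 0"
  by (simp add: radial_inv_def)

lemma radial_inv_in: "p \<in> S \<Longrightarrow> radial_inv z p \<in> S"
  using S by (simp add: radial_inv_def subspace_scale)

lemma radial_inv:
  assumes "z \<in> Z" "p \<in> S" "norm p < \<epsilon>"
  shows norm_radial_inv: "norm (radial_inv z p) < \<delta>"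
    and f_radial_inv: "f z (radial_inv z p) = (norm p)\<^sup>2"
    and radial_scale_radial_inv: "radial_scale (f z) (radial_inv z p) = p"
proof -
  show "norm (radial_inv z p) < \<delta>"
    using radius[OF assms(1,2) _ assms(3)] \<delta>
    by (cases "p = 0") (auto simp: radial_inv_def field_simps)
  show "f z (radial_inv z p) = (norm p)\<^sup>2"
    using radius[OF assms(1,2) _ assms(3)] f_0[OF assms(1)] by (cases "p = 0") (auto simp: radial_inv_def)
  then show "radial_scale (f z) (radial_inv z p) = p"
    using radius[OF assms(1,2) _ assms(3)]
    by (cases "p = 0") (auto simp: radial_scale_def radial_inv_def field_simps)
qed

lemma radial_inv_radial_scale:
  assumes "z \<in> Z" "u \<in> S" "norm u < \<delta>" "f z u < \<epsilon>\<^sup>2"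
  shows "radial_inv z (radial_scale (f z) u) = u"
proof (cases "u = 0")
  case False
  define p where "p = radial_scale (f z) u"
  have p_norm: "norm p = sqrt (f z u)" using norm_radial_scale assms by (simp add: p_def)
  have "0 < c * (norm u)\<^sup>2" using c False by simp
  then have f_pos: "f z u > 0" using f_ge[OF assms(1,2)] assms(3) by simp
  then have "p \<noteq> 0" using p_norm by auto
  have p: "p \<in> S" "norm p < \<epsilon>"
    using radial_scale_in assms(2,4) \<epsilon>(1) p_norm by (auto simp: p_def real_less_lsqrt real_sqrt_less_iff
        intro: real_less_lsqrt)
  have dir: "p /\<^sub>R norm p = u /\<^sub>R norm u"
    using f_pos False p_norm by (simp add: p_def radial_scale_def inverse_eq_divide)
  define t s where "t = radius z p" and "s = norm u"
  define e where "e = u /\<^sub>R norm u"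
  have e: "e \<in> S" "norm e = 1" using assms(2) False S by (auto simp: e_def subspace_scale)
  have t: "0 < t" "t < \<delta>" "f z (t *\<^sub>R e) = f z u"
    using radius[OF assms(1) p(1) \<open>p \<noteq> 0\<close> p(2)] f_pos p_norm unfolding t_def dir e_def by auto
  have s: "s > 0" "s < \<delta>" "s *\<^sub>R e = u" using False assms(3) by (auto simp: s_def e_def)
  \<comment> \<open>Both radii give the same value of \<open>f z\<close> on the ray, and growth then
    allows no gap between their squares.\<close>
  have "t\<^sup>2 = s\<^sup>2"
  proof (cases "t \<le> s")
    case True
    then have "t\<^sup>2 \<le> s\<^sup>2" using t by (intro power_mono) auto
    moreover have "c * (s\<^sup>2 - t\<^sup>2) \<le> 0"
      using f_mono[OF assms(1) e, of t s] True t s by simp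
    ultimately show ?thesis using c by (simp add: mult_le_0_iff)
  next
    case False
    then have "s\<^sup>2 \<le> t\<^sup>2" using s by (intro power_mono) auto
    moreover have "c * (t\<^sup>2 - s\<^sup>2) \<le> 0"
      using f_mono[OF assms(1) e, of s t] False t s by simp
    ultimately show ?thesis using c by (simp add: mult_le_0_iff)
  qed
  then have "t = s" using t(1) s(1) by (simp add: power2_eq_iff_nonneg)
  then show ?thesis
    using s(3) unfolding p_def[symmetric] radial_inv_def dir t_def e_def by simp
qed (simp add: radial_scale_def)

text \<open>With \<open>t\<close> the radius at \<open>(z, p)\<close>, growth bounds the change of
  the squared radius by the error made when the fixed radius \<open>t\<close> is used on nearby
  rays, and this error vanishes by continuity of \<open>f\<close>. At \<open>p = 0\<close>, where
  there is no direction, \<open>norm p / sqrt c\<close> bounds the result.\<close>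

lemma continuous_on_radial_inv:
  "continuous_on (Z \<times> (S \<inter> ball 0 \<epsilon>)) (\<lambda>(z, p). radial_inv z p)"
  unfolding continuous_on_eq_continuous_within
proof safe
  fix z p assume z: "z \<in> Z" and p: "p \<in> S" "p \<in> ball 0 \<epsilon>"
  define D where "D = Z \<times> (S \<inter> ball 0 \<epsilon>)"
  have "((\<lambda>w. radial_inv (fst w) (snd w)) \<longlongrightarrow> radial_inv z p) (at (z, p) within D)"
  proof (cases "p = 0")
    case True
    have "((\<lambda>w. radial_inv (fst w) (snd w)) \<longlongrightarrow> 0) (at (z, p) within D)"
    proof (rule Lim_null_comparison)
      show "\<forall>\<^sub>F w in at (z, p) within D. norm (radial_inv (fst w) (snd w)) \<le> norm (snd w) / sqrt c"
        unfolding eventually_at_filter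
      proof (intro always_eventually allI impI)
        fix w assume "w \<in> D"
        then have w: "fst w \<in> Z" "snd w \<in> S" "norm (snd w) < \<epsilon>" by (auto simp: D_def)
        have "c * (norm (radial_inv (fst w) (snd w)))\<^sup>2 \<le> (norm (snd w))\<^sup>2"
          using f_ge[OF w(1) radial_inv_in[OF w(2)], of "fst w"] norm_radial_inv[OF w] f_radial_inv[OF w] by simp
        then have "(sqrt c * norm (radial_inv (fst w) (snd w)))\<^sup>2 \<le> (norm (snd w))\<^sup>2"
          using c by (simp add: power_mult_distrib)
        then have "sqrt c * norm (radial_inv (fst w) (snd w)) \<le> norm (snd w)"
          by (rule power2_le_imp_le) simp
        then show "norm (radial_inv (fst w) (snd w)) \<le> norm (snd w) / sqrt c"
          using c by (simp add: field_simps)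
      qed
      have "((\<lambda>w. norm (snd w) / sqrt c) \<longlongrightarrow> norm p / sqrt c) (at (z, p) within D)"
        using c tendsto_snd[OF tendsto_ident_at, of "(z, p)" D] by (intro tendsto_intros) auto
      then show "((\<lambda>w. norm (snd w) / sqrt c) \<longlongrightarrow> 0) (at (z, p) within D)" using True by simp
    qed
    then show ?thesis using True by simp
  next
    case False
    define D0 where "D0 = Z \<times> (S \<inter> ball 0 \<epsilon> - {0})"
    define t where "t = radius z p"
    have zp: "(z, p) \<in> D0" using z p False by (auto simp: D0_def)
    have t: "t > 0" "t < \<delta>" "f z (t *\<^sub>R (p /\<^sub>R norm p)) = (norm p)\<^sup>2"
      using radius[OF z p(1) False] p(2) unfolding t_def by auto
    \<comment> \<open>Near \<open>p \<noteq> 0\<close> the origin can be removed from the domain,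
      which makes the direction a continuous function.\<close>
    have within: "at (z, p) within D = at (z, p) within D0"
      using False unfolding D_def D0_def
      by (intro at_within_nhd[of _ "UNIV \<times> - {0}"]) (auto intro!: open_Times)
    have "continuous_on D0 (\<lambda>w. (\<lambda>(z, u). f z u) (fst w, t *\<^sub>R (snd w /\<^sub>R norm (snd w))))"
      using t S unfolding D0_def
      by (intro continuous_on_compose2[OF f_cont] continuous_intros)
        (auto simp: subspace_scale field_simps)
    then have lim1: "((\<lambda>w. f (fst w) (t *\<^sub>R (snd w /\<^sub>R norm (snd w)))) \<longlongrightarrow> (norm p)\<^sup>2) (at (z, p) within D0)"
      using zp t(3) unfolding continuous_on_def by force
    have lim2: "((\<lambda>w. (norm (snd w))\<^sup>2) \<longlongrightarrow> (norm p)\<^sup>2) (at (z, p) within D0)"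
      using tendsto_snd[OF tendsto_ident_at, of "(z, p)" D0] by (intro tendsto_intros) auto
    have "((\<lambda>w. (radius (fst w) (snd w))\<^sup>2 - t\<^sup>2) \<longlongrightarrow> 0) (at (z, p) within D0)"
    proof (rule Lim_null_comparison)
      let ?g = "\<lambda>w. \<bar>(norm (snd w))\<^sup>2 - f (fst w) (t *\<^sub>R (snd w /\<^sub>R norm (snd w)))\<bar> / c"
      have "(?g \<longlongrightarrow> \<bar>(norm p)\<^sup>2 - (norm p)\<^sup>2\<bar> / c) (at (z, p) within D0)"
        using c by (intro tendsto_intros lim1 lim2) auto
      then show "(?g \<longlongrightarrow> 0) (at (z, p) within D0)" by simp
      show "\<forall>\<^sub>F w in at (z, p) within D0. norm ((radius (fst w) (snd w))\<^sup>2 - t\<^sup>2) \<le> ?g w"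
        unfolding eventually_at_filter
      proof (intro always_eventually allI impI)
        fix w assume "w \<in> D0"
        then have w: "fst w \<in> Z" "snd w \<in> S" "snd w \<noteq> 0" "norm (snd w) < \<epsilon>" by (auto simp: D0_def)
        define s e where "s = radius (fst w) (snd w)" and "e = snd w /\<^sub>R norm (snd w)"
        have s: "s > 0" "s < \<delta>" "f (fst w) (s *\<^sub>R e) = (norm (snd w))\<^sup>2"
          using radius[OF w] by (auto simp: s_def e_def)
        have e: "e \<in> S" "norm e = 1" using w S by (auto simp: e_def subspace_scale)
        have "c * \<bar>s\<^sup>2 - t\<^sup>2\<bar> \<le> \<bar>f (fst w) (s *\<^sub>R e) - f (fst w) (t *\<^sub>R e)\<bar>"
        proof (cases "s \<le> t")
          case True
          then have "s\<^sup>2 \<le> t\<^sup>2" using s by (intro power_mono) auto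
          then show ?thesis using f_mono[OF w(1) e, of s t] True s t by simp
        next
          case False
          then have "t\<^sup>2 \<le> s\<^sup>2" using t by (intro power_mono) auto
          then show ?thesis using f_mono[OF w(1) e, of t s] False s t by simp
        qed
        then show "norm ((radius (fst w) (snd w))\<^sup>2 - t\<^sup>2) \<le> ?g w"
          using c unfolding s(3) s_def[symmetric] e_def[symmetric] by (simp add: field_simps)
      qed
    qed
    then have "((\<lambda>w. (radius (fst w) (snd w))\<^sup>2) \<longlongrightarrow> t\<^sup>2) (at (z, p) within D0)"
      by (rule LIM_zero_cancel)
    then have "((\<lambda>w. sqrt ((radius (fst w) (snd w))\<^sup>2)) \<longlongrightarrow> sqrt (t\<^sup>2)) (at (z, p) within D0)"
      by (rule tendsto_real_sqrt)
    then have "((\<lambda>w. \<bar>radius (fst w) (snd w)\<bar>) \<longlongrightarrow> t) (at (z, p) within D0)"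
      using t(1) by simp
    moreover have "\<forall>\<^sub>F w in at (z, p) within D0. \<bar>radius (fst w) (snd w)\<bar> = radius (fst w) (snd w)"
      unfolding eventually_at_filter
      by (intro always_eventually) (auto simp: D0_def dest: radius(1))
    ultimately have "((\<lambda>w. radius (fst w) (snd w)) \<longlongrightarrow> t) (at (z, p) within D0)"
      by (rule Lim_transform_eventually)
    moreover have "(snd \<longlongrightarrow> p) (at (z, p) within D0)"
      using tendsto_snd[OF tendsto_ident_at, of "(z, p)" D0] by simp
    ultimately show ?thesis
      unfolding within radial_inv_def t_def using False by (intro tendsto_intros) auto
  qed
  then show "continuous (at (z, p) within Z \<times> (S \<inter> ball 0 \<epsilon>)) (\<lambda>(z, p). radial_inv z p)"
    by (simp add: continuous_within case_prod_unfold D_def)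
qed

end

section \<open>Saddle functionals\<close>

lemma open_Collect_less_on:
  fixes f :: "'a::topological_space \<Rightarrow> real"
  assumes "open U" "continuous_on U f"
  shows "open {u \<in> U. f u < b}"
proof -
  have "open (f -` {..<b} \<inter> U)"
    using assms(2) open_lessThan unfolding continuous_on_open_vimage[OF assms(1)] by blast
  moreover have "f -` {..<b} \<inter> U = {u \<in> U. f u < b}" by auto
  ultimately show ?thesis by simp
qed

lemma DERIV_along_line:
  assumes "(J has_derivative (\<lambda>h. h \<bullet> D)) (at (u + t *\<^sub>R w))"
  shows "((\<lambda>s. J (u + s *\<^sub>R w)) has_real_derivative (w \<bullet> D)) (at t)"
proof -
  have "((\<lambda>s. u + s *\<^sub>R w) has_derivative (\<lambda>s. s *\<^sub>R w)) (at t)"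
    by (auto intro!: derivative_eq_intros)
  from has_derivative_compose[OF this, of J "\<lambda>h. h \<bullet> D"] assms
  have "((\<lambda>s. J (u + s *\<^sub>R w)) has_derivative (\<lambda>s. (s *\<^sub>R w) \<bullet> D)) (at t)" by simp
  moreover have "(\<lambda>s. (s *\<^sub>R w) \<bullet> D) = (*) (w \<bullet> D)" by (simp add: fun_eq_iff)
  ultimately show ?thesis by (simp add: has_field_derivative_def)
qed

text \<open>Growth of the gradient along a segment integrates to a second-order bound: with the
  affine and quadratic parts subtracted, \<open>g\<close> is nondecreasing.\<close>

lemma second_order_lower_bound:
  fixes J :: "'a::real_inner \<Rightarrow> real"
  assumes deriv: "\<And>t. 0 \<le> t \<Longrightarrow> t \<le> 1 \<Longrightarrow>
      (J has_derivative (\<lambda>h. h \<bullet> A (u + t *\<^sub>R w))) (at (u + t *\<^sub>R w))"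
    and growth: "\<And>t. 0 \<le> t \<Longrightarrow> t \<le> 1 \<Longrightarrow> k * t \<le> (A (u + t *\<^sub>R w) - A u) \<bullet> w"
  shows "J u + A u \<bullet> w + k / 2 \<le> J (u + w)"
proof -
  define g where "g t = J (u + t *\<^sub>R w) - t * (A u \<bullet> w) - k / 2 * t\<^sup>2" for t
  have "g 0 \<le> g 1"
  proof (rule DERIV_nonneg_imp_nondecreasing[of 0 1 g])
    fix t :: real assume t: "0 \<le> t" "t \<le> 1"
    note DERIV_along_line[OF deriv[OF t]]
    then have "(g has_real_derivative (w \<bullet> A (u + t *\<^sub>R w) - A u \<bullet> w - k * t)) (at t)"
      unfolding g_def by (auto intro!: derivative_eq_intros)
    moreover have "w \<bullet> A (u + t *\<^sub>R w) - A u \<bullet> w - k * t \<ge> 0"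
      using growth[OF t] by (simp add: inner_diff_left inner_commute[of w])
    ultimately show "\<exists>y. (g has_real_derivative y) (at t) \<and> 0 \<le> y" by blast
  qed simp
  then show ?thesis by (simp add: g_def)
qed

text \<open>\<open>mono\<close> is strong monotonicity of the reflected gradient; its last factor is
  the reflection \<open>2 \<pi> - id\<close> at \<open>v - u\<close>, written out.
  \<open>A_small\<close> is uniform in \<open>l\<close>, which makes the radii below independent of
  the parameter.\<close>

locale saddle_family =
  fixes \<Lambda> :: "real set" and S T :: "'a::{real_inner, complete_space} set" and \<pi> :: "'a \<Rightarrow> 'a"
    and J :: "real \<Rightarrow> 'a \<Rightarrow> real" and A :: "real \<Rightarrow> 'a \<Rightarrow> 'a" and a r :: real
  assumes S: "subspace S" and T: "subspace T" "closed T"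
    and orth: "\<And>x y. x \<in> S \<Longrightarrow> y \<in> T \<Longrightarrow> x \<bullet> y = 0"
    and \<pi>: "bounded_linear \<pi>" and \<pi>_S: "\<And>u. \<pi> u \<in> S" and \<pi>_T: "\<And>u. u - \<pi> u \<in> T"
    and a: "a > 0" and r: "r > 0"
    and deriv: "\<And>l u. l \<in> \<Lambda> \<Longrightarrow> norm u < r \<Longrightarrow> (J l has_derivative (\<lambda>h. h \<bullet> A l u)) (at u)"
    and A_cont: "continuous_on (\<Lambda> \<times> ball 0 r) (\<lambda>(l, u). A l u)"
    and J_cont: "continuous_on (\<Lambda> \<times> ball 0 r) (\<lambda>(l, u). J l u)"
    and A_0: "\<And>l. l \<in> \<Lambda> \<Longrightarrow> A l 0 = 0" and J_0: "\<And>l. l \<in> \<Lambda> \<Longrightarrow> J l 0 = 0"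
    and A_small: "\<And>e. e > 0 \<Longrightarrow> \<exists>d>0. \<forall>l\<in>\<Lambda>. \<forall>u. norm u \<le> d \<longrightarrow> norm (A l u) < e"
    and mono: "\<And>l u v. l \<in> \<Lambda> \<Longrightarrow> norm u < r \<Longrightarrow> norm v < r \<Longrightarrow>
      a * (norm (v - u))\<^sup>2 \<le> (A l v - A l u) \<bullet> (\<pi> (v - u) - ((v - u) - \<pi> (v - u)))"
begin

lemma \<pi>_id: "x \<in> S \<Longrightarrow> \<pi> x = x"
proof -
  assume "x \<in> S"
  then have "x - \<pi> x \<in> S" using \<pi>_S S by (rule_tac subspace_diff)
  then have "(x - \<pi> x) \<bullet> (x - \<pi> x) = 0" using orth \<pi>_T by blast
  then show ?thesis by simp
qed

lemma \<pi>_zero: "y \<in> T \<Longrightarrow> \<pi> y = 0"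
proof -
  assume y: "y \<in> T"
  then have "y - (y - \<pi> y) \<in> T" using \<pi>_T T(1) by (rule_tac subspace_diff)
  then have "\<pi> y \<bullet> \<pi> y = 0" using orth \<pi>_S by auto
  then show ?thesis by simp
qed

lemma \<pi>_add: "x \<in> S \<Longrightarrow> y \<in> T \<Longrightarrow> \<pi> (x + y) = x"
  using \<pi> \<pi>_id \<pi>_zero by (simp add: linear_add bounded_linear.linear)

lemma norm_add_sq: "x \<in> S \<Longrightarrow> y \<in> T \<Longrightarrow> (norm (x + y))\<^sup>2 = (norm x)\<^sup>2 + (norm y)\<^sup>2"
  using orth by (simp add: power2_norm_eq_inner inner_add_left inner_add_right inner_commute)

lemma mono_S:
  assumes "l \<in> \<Lambda>" "norm u < r" "norm (u + w) < r" "w \<in> S"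
  shows "a * (norm w)\<^sup>2 \<le> (A l (u + w) - A l u) \<bullet> w"
  using mono[OF assms(1-3)] assms(4) by (simp add: \<pi>_id)

lemma mono_T:
  assumes "l \<in> \<Lambda>" "norm u < r" "norm (u + w) < r" "w \<in> T"
  shows "(A l (u + w) - A l u) \<bullet> w \<le> - a * (norm w)\<^sup>2"
  using mono[OF assms(1-3)] assms(4) by (simp add: \<pi>_zero)

lemma norm_segment:
  assumes "norm u < r" "norm (u + w) < r" "0 \<le> t" "t \<le> 1"
  shows "norm (u + t *\<^sub>R w) < (r::real)"
proof -
  have "(1 - t) *\<^sub>R u + t *\<^sub>R (u + w) \<in> ball 0 r"
    using assms by (intro convexD[OF convex_ball]) auto
  then show ?thesis by (simp add: algebra_simps)
qed

lemma J_lower: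
  assumes "l \<in> \<Lambda>" "norm u < r" "norm (u + w) < r" "w \<in> S"
  shows "J l u + A l u \<bullet> w + a / 2 * (norm w)\<^sup>2 \<le> J l (u + w)"
proof -
  have "a * (norm w)\<^sup>2 * t \<le> (A l (u + t *\<^sub>R w) - A l u) \<bullet> w" if t: "0 \<le> t" "t \<le> 1" for t
  proof (cases "t = 0")
    case False
    have "a * (norm (t *\<^sub>R w))\<^sup>2 \<le> (A l (u + t *\<^sub>R w) - A l u) \<bullet> (t *\<^sub>R w)"
      using norm_segment[OF assms(2,3) t] assms S by (intro mono_S) (auto simp: subspace_scale)
    then have "t * (a * (norm w)\<^sup>2 * t) \<le> t * ((A l (u + t *\<^sub>R w) - A l u) \<bullet> w)"
      by (simp add: power_mult_distrib power2_eq_square algebra_simps)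
    then show ?thesis using False t by (simp add: mult_le_cancel_left)
  qed simp
  then have "J l u + A l u \<bullet> w + a * (norm w)\<^sup>2 / 2 \<le> J l (u + w)"
    using norm_segment[OF assms(2,3)] assms(1) deriv by (intro second_order_lower_bound[where A = "A l"]) auto
  then show ?thesis by simp
qed

lemma J_upper:
  assumes "l \<in> \<Lambda>" "norm u < r" "norm (u + w) < r" "w \<in> T"
  shows "J l (u + w) \<le> J l u + A l u \<bullet> w - a / 2 * (norm w)\<^sup>2"
proof -
  have "a * (norm w)\<^sup>2 * t \<le> (- A l (u + t *\<^sub>R w) - - A l u) \<bullet> w" if t: "0 \<le> t" "t \<le> 1" for t
  proof (cases "t = 0")
    case False
    have "(A l (u + t *\<^sub>R w) - A l u) \<bullet> (t *\<^sub>R w) \<le> - a * (norm (t *\<^sub>R w))\<^sup>2"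
      using norm_segment[OF assms(2,3) t] assms T by (intro mono_T) (auto simp: subspace_scale)
    then have "t * (a * (norm w)\<^sup>2 * t) \<le> t * ((- A l (u + t *\<^sub>R w) - - A l u) \<bullet> w)"
      by (simp add: power_mult_distrib power2_eq_square algebra_simps inner_diff_left)
    then show ?thesis using False t by (simp add: mult_le_cancel_left)
  qed simp
  moreover have "((\<lambda>u. - J l u) has_derivative (\<lambda>h. h \<bullet> - A l v)) (at v)" if "norm v < r" for v
    using has_derivative_minus[OF deriv[OF assms(1) that]] by simp
  ultimately have "- J l u + (- A l u) \<bullet> w + a * (norm w)\<^sup>2 / 2 \<le> - J l (u + w)"
    using norm_segment[OF assms(2,3)]
    by (intro second_order_lower_bound[where A = "\<lambda>u. - A l u" and J = "\<lambda>u. - J l u"]) auto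
  then show ?thesis by simp
qed

lemma continuous_on_J: "l \<in> \<Lambda> \<Longrightarrow> continuous_on (ball 0 r) (J l)"
proof -
  assume "l \<in> \<Lambda>"
  then have "continuous_on (ball 0 r) (\<lambda>u. (\<lambda>(l, u). J l u) (l, u))"
    by (intro continuous_on_compose2[OF J_cont] continuous_intros) auto
  then show ?thesis by simp
qed

section \<open>Fibre maximisers\<close>

text \<open>The maximum is taken over a closed ball of \<open>T\<close>; a small gradient at
  \<open>x\<close> keeps the maximiser in its interior, so it is critical along \<open>T\<close>.
  The bound \<open>a * r / 16\<close> confines it to norm below \<open>r / 8\<close>.\<close>

lemma fibre_maximiser_ex:
  assumes l: "l \<in> \<Lambda>" and x: "x \<in> S" "norm x \<le> r / 4" "norm (A l x) < a * r / 16"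
  shows "\<exists>h\<in>T. norm h < r / 4 \<and> norm h \<le> 2 / a * norm (A l x) \<and> (\<forall>v\<in>T. A l (x + h) \<bullet> v = 0)"
proof -
  define C where "C = T \<inter> cball 0 (r / 4)"
  have C: "closed C" "convex C" "0 \<in> C"
    using T r by (auto simp: C_def subspace_imp_convex convex_Int subspace_0)
  have in_r: "norm (x + y) < r" if "y \<in> C" for y
    using norm_triangle_ineq[of x y] that x r by (auto simp: C_def)
  define f where "f y = - J l (x + y)" for y
  have cont: "continuous_on C f"
    unfolding f_def using in_r
    by (intro continuous_intros continuous_on_compose2[OF continuous_on_J[OF l]]) auto
  have first: "f y + (- A l (x + y)) \<bullet> w + a / 2 * (norm w)\<^sup>2 \<le> f (y + w)"
    if "y \<in> C" "y + w \<in> C" for y w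
  proof -
    have "y + w - y \<in> T" using that T by (intro subspace_diff) (auto simp: C_def)
    then have "w \<in> T" by simp
    then show ?thesis
      using J_upper[OF l in_r[OF that(1)], of w] in_r[OF that(2)] by (simp add: f_def add.assoc)
  qed
  have "f 0 - norm (A l x) * (r / 4) \<le> f y" if "y \<in> C" for y
  proof -
    have "(A l x) \<bullet> y \<le> norm (A l x) * norm y" by (rule norm_cauchy_schwarz)
    also have "\<dots> \<le> norm (A l x) * (r / 4)" using that by (intro mult_left_mono) (auto simp: C_def)
    finally have 1: "(A l x) \<bullet> y \<le> norm (A l x) * (r / 4)" .
    have "0 \<le> a / 2 * (norm y)\<^sup>2" using a by simp
    then show ?thesis using 1 first[of 0 y] C(3) that by simp
  qed
  then have bdd: "bdd_below (f ` C)" by (auto simp: bdd_below_def)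
  \<comment> \<open>Expanding at the midpoint in the directions \<open>w\<close> and
    \<open>- w\<close> cancels the gradient terms; \<open>w\<close> is half of \<open>u - v\<close>,
    which turns \<open>a / 2\<close> into \<open>a / 8\<close>.\<close>
  have mid: "f (midpoint u v) + a / 8 * (norm (u - v))\<^sup>2 \<le> (f u + f v) / 2"
    if uv: "u \<in> C" "v \<in> C" for u v
  proof -
    define m w where "m = midpoint u v" and "w = (1/2) *\<^sub>R (u - v)"
    have uv_eq: "u = m + w" "v = m + (- w)"
      by (simp_all add: m_def w_def midpoint_def algebra_simps flip: scaleR_add_left)
    have "m \<in> C"
      unfolding m_def midpoint_def scaleR_right_distrib
      using convexD[OF C(2) uv, of "1/2" "1/2"] by (simp add: field_simps)
    with uv first[of m w] first[of m "- w"]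
    have "f m + a / 2 * (norm w)\<^sup>2 \<le> (f u + f v) / 2" by (simp add: uv_eq)
    moreover have "(norm w)\<^sup>2 = (norm (u - v))\<^sup>2 / 4" by (simp add: w_def power_mult_distrib power2_eq_square)
    ultimately show ?thesis by (simp add: m_def)
  qed
  have "C \<noteq> {}" "a / 8 > 0" using C(3) a by auto
  then obtain h where h: "h \<in> C" "\<And>y. y \<in> C \<Longrightarrow> f h \<le> f y"
    using attains_min_of_midpoint_strongly_convex[OF C(1,2) _ cont bdd _ mid] by metis
  have hT: "h \<in> T" using h(1) by (simp add: C_def)
  \<comment> \<open>The maximiser does at least as well as \<open>0\<close>, so the linear term must
    pay for the quadratic loss.\<close>
  have h_le: "norm h \<le> 2 / a * norm (A l x)"
  proof (cases "h = 0")
    case False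
    have "a / 2 * (norm h)\<^sup>2 \<le> A l x \<bullet> h"
      using first[of 0 h] h(1) h(2)[OF C(3)] C(3) by simp
    also have "\<dots> \<le> norm (A l x) * norm h" by (rule norm_cauchy_schwarz)
    finally have "a / 2 * norm h \<le> norm (A l x)" using False by (simp add: power2_eq_square)
    then show ?thesis using a by (simp add: field_simps)
  qed (use a in simp)
  have h_less: "norm h < r / 4"
  proof -
    have "2 / a * norm (A l x) < 2 / a * (a * r / 16)" using a x(3) by (intro mult_strict_left_mono) auto
    also have "\<dots> < r / 4" using a r by (simp add: field_simps)
    finally show ?thesis using h_le by simp
  qed
  have "A l (x + h) \<bullet> v = 0" if v: "v \<in> T" for v
  proof (cases "v = 0")
    case False
    \<comment> \<open>The distance available along \<open>v\<close> before the ball \<open>C\<close>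
      is left.\<close>
    define d where "d = (r / 4 - norm h) / norm v"
    have "d > 0" using h_less False by (simp add: d_def)
    define g where "g t = J l (x + h + t *\<^sub>R v)" for t
    have "(J l has_derivative (\<lambda>k. k \<bullet> A l (x + h))) (at (x + h + 0 *\<^sub>R v))"
      using deriv[OF l in_r[OF h(1)]] by simp
    then have "(g has_real_derivative (v \<bullet> A l (x + h))) (at 0)"
      unfolding g_def by (rule DERIV_along_line)
    moreover have "\<forall>t. \<bar>0 - t\<bar> < d \<longrightarrow> g t \<le> g 0"
    proof (intro allI impI)
      fix t :: real assume "\<bar>0 - t\<bar> < d"
      then have "\<bar>t\<bar> * norm v < r / 4 - norm h"
        using False by (simp add: d_def field_simps)
      then have "norm (h + t *\<^sub>R v) \<le> r / 4" using norm_triangle_ineq[of h "t *\<^sub>R v"] by simp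
      then have "h + t *\<^sub>R v \<in> C" using hT v T by (auto simp: C_def subspace_add subspace_scale)
      from h(2)[OF this] show "g t \<le> g 0" by (simp add: g_def f_def add.assoc)
    qed
    ultimately have "v \<bullet> A l (x + h) = 0" using \<open>d > 0\<close> by (intro DERIV_local_max)
    then show ?thesis by (simp add: inner_commute)
  qed simp
  then show ?thesis using hT h_le h_less by blast
qed

text \<open>Strong concavity makes the choice unique for small \<open>x\<close>. The bound by
  \<open>norm (A l x)\<close> is recorded because it forces
  \<open>fibre_max l 0 = 0\<close>.\<close>

definition fibre_max :: "real \<Rightarrow> 'a \<Rightarrow> 'a" where
  "fibre_max l x = (SOME h. h \<in> T \<and> norm h < r / 4 \<and> norm h \<le> 2 / a * norm (A l x) \<and>
     (\<forall>v\<in>T. A l (x + h) \<bullet> v = 0))"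

definition fibre_max_value :: "real \<Rightarrow> 'a \<Rightarrow> real" where
  "fibre_max_value l x = J l (x + fibre_max l x)"

definition fibre_drop :: "real \<times> 'a \<Rightarrow> 'a \<Rightarrow> real" where
  "fibre_drop = (\<lambda>(l, x) y. fibre_max_value l x - J l (x + fibre_max l x + y))"

text \<open>Below \<open>r / 4\<close>, so that base point, fibre maximiser and a further
  displacement of length at most \<open>r / 4\<close> add up to less than \<open>r\<close>; the
  gradient bound is the one \<open>fibre_maximiser_ex\<close> asks for.\<close>

definition core_radius :: real where
  "core_radius = (SOME d. d > 0 \<and> d < r / 4 \<and> (\<forall>l\<in>\<Lambda>. \<forall>u. norm u \<le> d \<longrightarrow> norm (A l u) < a * r / 16))"

lemma core_radius: "core_radius > 0" "core_radius < r / 4"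
    "l \<in> \<Lambda> \<Longrightarrow> norm u \<le> core_radius \<Longrightarrow> norm (A l u) < a * r / 16"
proof -
  have "a * r / 16 > 0" using a r by simp
  then obtain d where d: "d > 0" "\<forall>l\<in>\<Lambda>. \<forall>u. norm u \<le> d \<longrightarrow> norm (A l u) < a * r / 16"
    using A_small by blast
  have "\<exists>d. d > 0 \<and> d < r / 4 \<and> (\<forall>l\<in>\<Lambda>. \<forall>u. norm u \<le> d \<longrightarrow> norm (A l u) < a * r / 16)"
    using d r by (intro exI[of _ "min d (r / 8)"]) auto
  from someI_ex[OF this, folded core_radius_def]
  show "core_radius > 0" "core_radius < r / 4"
    "l \<in> \<Lambda> \<Longrightarrow> norm u \<le> core_radius \<Longrightarrow> norm (A l u) < a * r / 16"
    by blast+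
qed

lemma fibre_max:
  assumes "l \<in> \<Lambda>" "x \<in> S" "norm x \<le> core_radius"
  shows fibre_max_T: "fibre_max l x \<in> T" and norm_fibre_max: "norm (fibre_max l x) < r / 4"
    and norm_fibre_max_le: "norm (fibre_max l x) \<le> 2 / a * norm (A l x)"
    and fibre_max_critical: "\<And>v. v \<in> T \<Longrightarrow> A l (x + fibre_max l x) \<bullet> v = 0"
proof -
  have "norm x \<le> r / 4" using assms(3) core_radius(2) by simp
  from fibre_maximiser_ex[OF assms(1,2) this core_radius(3)[OF assms(1,3)]]
  have "\<exists>h. h \<in> T \<and> norm h < r / 4 \<and> norm h \<le> 2 / a * norm (A l x) \<and>
     (\<forall>v\<in>T. A l (x + h) \<bullet> v = 0)" by blast
  from someI_ex[OF this, folded fibre_max_def]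
  show "fibre_max l x \<in> T" "norm (fibre_max l x) < r / 4"
    "norm (fibre_max l x) \<le> 2 / a * norm (A l x)"
    "\<And>v. v \<in> T \<Longrightarrow> A l (x + fibre_max l x) \<bullet> v = 0" by blast+
qed

lemma fibre_max_0: "l \<in> \<Lambda> \<Longrightarrow> fibre_max l 0 = 0"
  using norm_fibre_max_le[of l 0] S core_radius(1) A_0[of l] by (simp add: subspace_0)

lemma in_r:
  assumes "norm x \<le> core_radius" "norm h < r / 4" "norm y \<le> r / 4"
  shows "norm (x + h) < r" "norm (x + y) < r" "norm (x + h + y) < r"
  using assms core_radius norm_triangle_ineq[of x h] norm_triangle_ineq[of x y]
    norm_triangle_ineq[of "x + h" y] r by linarith+

lemma J_le_fibre_max_value:
  assumes "l \<in> \<Lambda>" "x \<in> S" "norm x \<le> core_radius" "y \<in> T" "norm y \<le> r / 4"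
  shows "J l (x + y) \<le> fibre_max_value l x"
proof -
  define h where "h = fibre_max l x"
  note h = fibre_max[OF assms(1-3), folded h_def]
  have w: "y - h \<in> T" using assms(4) h(1) T by (intro subspace_diff)
  have "J l (x + h + (y - h)) \<le> J l (x + h) + A l (x + h) \<bullet> (y - h) - a / 2 * (norm (y - h))\<^sup>2"
    using in_r[OF assms(3) h(2) assms(5)] assms(1) w by (intro J_upper) auto
  moreover have "0 \<le> a / 2 * (norm (y - h))\<^sup>2" using a by simp
  ultimately show ?thesis using h(4)[OF w] by (simp add: fibre_max_value_def h_def)
qed

text \<open>The maximiser at a nearby point and the old \<open>h\<close> are compared through
  monotonicity along \<open>T\<close>. Since each gradient annihilates \<open>T\<close> at its own
  maximiser, their distance is bounded by the change of the gradient at the fixed displacement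
  \<open>h\<close>.\<close>

lemma continuous_on_fibre_max:
  "continuous_on (\<Lambda> \<times> (S \<inter> cball 0 core_radius)) (\<lambda>(l, x). fibre_max l x)"
  unfolding continuous_on_def
proof safe
  fix l x assume l: "l \<in> \<Lambda>" and x: "x \<in> S" "x \<in> cball 0 core_radius"
  define D where "D = \<Lambda> \<times> (S \<inter> cball 0 core_radius)"
  define h where "h = fibre_max l x"
  have x': "norm x \<le> core_radius" using x by simp
  note h = fibre_max[OF l x(1) x', folded h_def]
  have "continuous_on D (\<lambda>w. (\<lambda>(l, u). A l u) (fst w, snd w + h))"
    using in_r(1)[OF _ h(2), of _ 0] r unfolding D_def
    by (intro continuous_on_compose2[OF A_cont] continuous_intros) auto
  then have lim: "((\<lambda>w. A (fst w) (snd w + h)) \<longlongrightarrow> A l (x + h)) (at (l, x) within D)"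
    using l x unfolding continuous_on_def D_def by force
  have "((\<lambda>w. fibre_max (fst w) (snd w) - h) \<longlongrightarrow> 0) (at (l, x) within D)"
  proof (rule Lim_null_comparison)
    let ?g = "\<lambda>w. norm (A (fst w) (snd w + h) - A l (x + h)) / a"
    have "(?g \<longlongrightarrow> norm (A l (x + h) - A l (x + h)) / a) (at (l, x) within D)"
      using a by (intro tendsto_intros lim) auto
    then show "(?g \<longlongrightarrow> 0) (at (l, x) within D)" by simp
    show "\<forall>\<^sub>F w in at (l, x) within D. norm (fibre_max (fst w) (snd w) - h) \<le> ?g w"
      unfolding eventually_at_filter
    proof (intro always_eventually allI impI)
      fix w assume "w \<in> D"
      then have w: "fst w \<in> \<Lambda>" "snd w \<in> S" "norm (snd w) \<le> core_radius" by (auto simp: D_def)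
      define k d where "k = fibre_max (fst w) (snd w)" and "d = k - h"
      note k = fibre_max[OF w, folded k_def]
      have d: "d \<in> T" unfolding d_def using k(1) h(1) T by (intro subspace_diff)
      have "(A (fst w) (snd w + h + d) - A (fst w) (snd w + h)) \<bullet> d \<le> - a * (norm d)\<^sup>2"
        using in_r(1)[OF w(3) h(2), of 0] in_r(1)[OF w(3) k(2), of 0] r d w(1)
        by (intro mono_T) (auto simp: d_def)
      then have "a * (norm d)\<^sup>2 \<le> (A (fst w) (snd w + h) - A l (x + h)) \<bullet> d"
        using k(4)[OF d] h(4)[OF d] by (simp add: d_def inner_diff_left)
      also have "\<dots> \<le> norm (A (fst w) (snd w + h) - A l (x + h)) * norm d"
        by (rule norm_cauchy_schwarz)
      finally have "a * norm d \<le> norm (A (fst w) (snd w + h) - A l (x + h))"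
        by (cases "d = 0") (auto simp: power2_eq_square)
      then show "norm (fibre_max (fst w) (snd w) - h) \<le> ?g w"
        using a by (simp add: d_def k_def field_simps)
    qed
  qed
  then have "((\<lambda>w. fibre_max (fst w) (snd w)) \<longlongrightarrow> h) (at (l, x) within D)"
    by (rule LIM_zero_cancel)
  then show "((\<lambda>(l, x). fibre_max l x) \<longlongrightarrow> fibre_max l x) (at (l, x) within \<Lambda> \<times> (S \<inter> cball 0 core_radius))"
    by (simp add: case_prod_unfold D_def h_def)
qed

lemma continuous_on_fibre_max_value:
  "continuous_on (\<Lambda> \<times> (S \<inter> cball 0 core_radius)) (\<lambda>(l, x). fibre_max_value l x)"
proof -
  have "continuous_on (\<Lambda> \<times> (S \<inter> cball 0 core_radius))
      (\<lambda>w. (\<lambda>(l, u). J l u) (fst w, snd w + (\<lambda>(l, x). fibre_max l x) w))"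
    using in_r(1)[OF _ norm_fibre_max, of _ _ _ 0] r
    by (intro continuous_on_compose2[OF J_cont] continuous_intros continuous_on_fibre_max) auto
  then show ?thesis by (simp add: case_prod_unfold fibre_max_value_def)
qed

lemma continuous_on_fibre_drop:
  "continuous_on ((\<Lambda> \<times> (S \<inter> cball 0 core_radius)) \<times> (T \<inter> cball 0 (r / 4))) (\<lambda>(z, y). fibre_drop z y)"
proof -
  let ?D = "(\<Lambda> \<times> (S \<inter> cball 0 core_radius)) \<times> (T \<inter> cball 0 (r / 4))"
  have fm: "continuous_on ?D (\<lambda>w. (\<lambda>(l, x). fibre_max l x) (fst w))"
    by (intro continuous_on_compose2[OF continuous_on_fibre_max] continuous_intros) auto
  have fv: "continuous_on ?D (\<lambda>w. (\<lambda>(l, x). fibre_max_value l x) (fst w))"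
    by (intro continuous_on_compose2[OF continuous_on_fibre_max_value] continuous_intros) auto
  have "continuous_on ?D (\<lambda>w. (\<lambda>(l, u). J l u)
      (fst (fst w), snd (fst w) + (\<lambda>(l, x). fibre_max l x) (fst w) + snd w))"
    using in_r(3)[OF _ norm_fibre_max]
    by (intro continuous_on_compose2[OF J_cont] continuous_intros fm) auto
  with fv have "continuous_on ?D (\<lambda>w. (\<lambda>(l, x). fibre_max_value l x) (fst w) - (\<lambda>(l, u). J l u)
      (fst (fst w), snd (fst w) + (\<lambda>(l, x). fibre_max l x) (fst w) + snd w))"
    by (rule continuous_on_diff)
  then show ?thesis by (simp add: case_prod_unfold fibre_drop_def)
qed

section \<open>Quadratic growth along rays\<close>

text \<open>Moving from \<open>s\<close> to \<open>t\<close> with the fibre component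
  \<open>h\<close> frozen bounds the new maximum from below. The slope at \<open>s\<close>
  contributes \<open>a * s * (t - s)\<close> and convexity \<open>a / 2 * (t - s)^2\<close>, which
  add up to the difference of squares.\<close>

lemma fibre_max_value_mono:
  assumes l: "l \<in> \<Lambda>" and e: "e \<in> S" "norm e = 1" and st: "0 \<le> s" "s \<le> t" "t \<le> core_radius"
  shows "a / 2 * (t\<^sup>2 - s\<^sup>2) \<le> fibre_max_value l (t *\<^sub>R e) - fibre_max_value l (s *\<^sub>R e)"
proof -
  define x h where "x = s *\<^sub>R e" and "h = fibre_max l x"
  have x: "x \<in> S" "norm x \<le> core_radius" using e st S by (auto simp: x_def subspace_scale)
  note h = fibre_max[OF l x, folded h_def]
  have te: "t *\<^sub>R e \<in> S" "norm (t *\<^sub>R e) \<le> core_radius" using e st S by (auto simp: subspace_scale)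
  have w: "(t - s) *\<^sub>R e \<in> S" using e S by (simp add: subspace_scale)
  have eq: "x + h + (t - s) *\<^sub>R e = t *\<^sub>R e + h" by (simp add: x_def algebra_simps)
  \<comment> \<open>Monotonicity between the origin and \<open>x + h\<close>: the fibre part drops
    out because the gradient annihilates \<open>T\<close> at the maximiser, and only the radial
    slope remains.\<close>
  have A_e: "a * s \<le> A l (x + h) \<bullet> e"
  proof (cases "s = 0")
    case True
    then show ?thesis using fibre_max_0[OF l] A_0[OF l] by (simp add: x_def h_def)
  next
    case False
    have "a * (norm (x + h - 0))\<^sup>2 \<le> (A l (x + h) - A l 0) \<bullet>
        (\<pi> (x + h - 0) - ((x + h - 0) - \<pi> (x + h - 0)))"
      using in_r(1)[OF x(2) h(2), of 0] r l by (intro mono) auto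
    then have "a * ((norm x)\<^sup>2 + (norm h)\<^sup>2) \<le> A l (x + h) \<bullet> (x - h)"
      using norm_add_sq[OF x(1) h(1)] \<pi>_add[OF x(1) h(1)] A_0[OF l] by simp
    also have "\<dots> = s * (A l (x + h) \<bullet> e)"
      using h(4)[OF h(1)] by (simp add: inner_diff_right x_def)
    finally have "a * (norm x)\<^sup>2 + a * (norm h)\<^sup>2 \<le> s * (A l (x + h) \<bullet> e)" by (simp add: algebra_simps)
    moreover have "0 \<le> a * (norm h)\<^sup>2" using a by simp
    moreover have "(norm x)\<^sup>2 = s * s" using e(2) by (simp add: x_def power2_eq_square)
    ultimately have "s * (a * s) \<le> s * (A l (x + h) \<bullet> e)" by (simp add: algebra_simps)
    then show ?thesis using False st(1) by (simp add: mult_le_cancel_left)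
  qed
  have "J l (x + h) + A l (x + h) \<bullet> ((t - s) *\<^sub>R e) + a / 2 * (norm ((t - s) *\<^sub>R e))\<^sup>2
      \<le> J l (x + h + (t - s) *\<^sub>R e)"
    using in_r(1)[OF x(2) h(2), of 0] in_r(1)[OF te(2) h(2), of 0] r l w
    by (intro J_lower) (auto simp: eq)
  also have "\<dots> \<le> fibre_max_value l (t *\<^sub>R e)"
    unfolding eq using h(1,2) l te by (intro J_le_fibre_max_value) auto
  finally have "J l (x + h) + (t - s) * (A l (x + h) \<bullet> e) + a / 2 * (t - s)\<^sup>2 \<le> fibre_max_value l (t *\<^sub>R e)"
    using e(2) by simp
  moreover have "(t - s) * (a * s) \<le> (t - s) * (A l (x + h) \<bullet> e)"
    using A_e st by (intro mult_left_mono) auto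
  ultimately show ?thesis
    by (simp add: fibre_max_value_def x_def h_def power2_eq_square algebra_simps)
qed

text \<open>The slope of \<open>J\<close> along \<open>e\<close> is zero at the fibre maximiser,
  hence at most \<open>- a * s\<close> at distance \<open>s\<close>; concavity from there on
  completes the difference of squares.\<close>

lemma fibre_drop_mono:
  assumes z: "z \<in> \<Lambda> \<times> (S \<inter> cball 0 core_radius)"
    and e: "e \<in> T" "norm e = 1" and st: "0 \<le> s" "s \<le> t" "t \<le> r / 4"
  shows "a / 2 * (t\<^sup>2 - s\<^sup>2) \<le> fibre_drop z (t *\<^sub>R e) - fibre_drop z (s *\<^sub>R e)"
proof -
  obtain l x where lx: "z = (l, x)" "l \<in> \<Lambda>" "x \<in> S" "norm x \<le> core_radius" using z by auto
  define u where "u = x + fibre_max l x"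
  note h = fibre_max[OF lx(2-4), folded u_def]
  have u_r: "norm u < r" "\<And>q. 0 \<le> q \<Longrightarrow> q \<le> r / 4 \<Longrightarrow> norm (u + q *\<^sub>R e) < r"
    using in_r(1)[OF lx(4) h(2), of 0] in_r(3)[OF lx(4) h(2)] e(2) r unfolding u_def by auto
  have eT: "q *\<^sub>R e \<in> T" for q using e T by (simp add: subspace_scale)
  have A_e: "A l (u + s *\<^sub>R e) \<bullet> e \<le> - a * s"
  proof (cases "s = 0")
    case True
    then show ?thesis using h(4)[OF e(1)] by simp
  next
    case False
    have "(A l (u + s *\<^sub>R e) - A l u) \<bullet> (s *\<^sub>R e) \<le> - a * (norm (s *\<^sub>R e))\<^sup>2"
      using u_r st eT lx(2) by (intro mono_T) auto
    then have "s * (A l (u + s *\<^sub>R e) \<bullet> e) \<le> s * (- a * s)"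
      using h(4)[OF e(1)] e(2) by (simp add: inner_diff_left power2_eq_square algebra_simps)
    then show ?thesis by (rule mult_left_le_imp_le) (use False st(1) in simp)
  qed
  have eq: "u + s *\<^sub>R e + (t - s) *\<^sub>R e = u + t *\<^sub>R e" by (simp add: algebra_simps)
  have "J l (u + s *\<^sub>R e + (t - s) *\<^sub>R e) \<le> J l (u + s *\<^sub>R e) + A l (u + s *\<^sub>R e) \<bullet> ((t - s) *\<^sub>R e)
      - a / 2 * (norm ((t - s) *\<^sub>R e))\<^sup>2"
    using u_r st eT lx(2) by (intro J_upper) (auto simp: eq)
  then have "J l (u + t *\<^sub>R e) \<le> J l (u + s *\<^sub>R e) + (t - s) * (A l (u + s *\<^sub>R e) \<bullet> e)
      - a / 2 * (t - s)\<^sup>2"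
    using e(2) by (simp add: eq)
  moreover have "(t - s) * (A l (u + s *\<^sub>R e) \<bullet> e) \<le> (t - s) * (- a * s)"
    using A_e st by (intro mult_left_mono) auto
  ultimately have "a / 2 * (t\<^sup>2 - s\<^sup>2) \<le> J l (u + s *\<^sub>R e) - J l (u + t *\<^sub>R e)"
    by (simp add: power2_eq_square algebra_simps)
  then show ?thesis by (simp add: fibre_drop_def lx(1) u_def)
qed

text \<open>The largest value allowed by the locale condition for the growth constant
  \<open>a / 2\<close> and radius \<open>core_radius\<close>; as \<open>core_radius < r / 4\<close>
  it also suits the fibres, so one radius serves both factors.\<close>

definition normal_radius :: real where
  "normal_radius = sqrt (a / 2) * core_radius"

lemma normal_radius: "normal_radius > 0" "normal_radius\<^sup>2 \<le> a / 2 * core_radius\<^sup>2"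
    "normal_radius\<^sup>2 \<le> a / 2 * (r / 4)\<^sup>2"
proof -
  show "normal_radius > 0" using a core_radius(1) by (simp add: normal_radius_def)
  show 1: "normal_radius\<^sup>2 \<le> a / 2 * core_radius\<^sup>2"
    using a by (simp add: normal_radius_def power_mult_distrib)
  have "core_radius\<^sup>2 \<le> (r / 4)\<^sup>2" using core_radius by (intro power_mono) auto
  then have "a / 2 * core_radius\<^sup>2 \<le> a / 2 * (r / 4)\<^sup>2" using a by (intro mult_left_mono) auto
  with 1 show "normal_radius\<^sup>2 \<le> a / 2 * (r / 4)\<^sup>2" by linarith
qed

sublocale pos: radial_family \<Lambda> S fibre_max_value "a / 2" core_radius normal_radius
proof
  show "fibre_max_value l 0 = 0" if "l \<in> \<Lambda>" for l
    using fibre_max_0[OF that] J_0[OF that] by (simp add: fibre_max_value_def)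
  show "a / 2 * (t\<^sup>2 - s\<^sup>2) \<le> fibre_max_value l (t *\<^sub>R e) - fibre_max_value l (s *\<^sub>R e)"
    if "l \<in> \<Lambda>" "e \<in> S" "norm e = 1" "0 \<le> s" "s \<le> t" "t \<le> core_radius" for l e s t
    using fibre_max_value_mono[OF that] .
qed (use S a core_radius normal_radius continuous_on_fibre_max_value in auto)

text \<open>The base point \<open>x\<close> joins \<open>l\<close> as a parameter, so the fibrewise
  inverse is continuous in \<open>x\<close> as well.\<close>

sublocale neg: radial_family "\<Lambda> \<times> (S \<inter> cball 0 core_radius)" T fibre_drop "a / 2" "r / 4" normal_radius
proof
  show "fibre_drop z 0 = 0" for z
    by (simp add: fibre_drop_def fibre_max_value_def case_prod_unfold)
  show "a / 2 * (t\<^sup>2 - s\<^sup>2) \<le> fibre_drop z (t *\<^sub>R e) - fibre_drop z (s *\<^sub>R e)"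
    if "z \<in> \<Lambda> \<times> (S \<inter> cball 0 core_radius)" "e \<in> T" "norm e = 1" "0 \<le> s" "s \<le> t" "t \<le> r / 4" for z e s t
    using fibre_drop_mono[OF that] .
qed (use T a r normal_radius continuous_on_fibre_drop in auto)

end

section \<open>The Morse chart\<close>

context saddle_family
begin

definition chart_domain :: "'a set" where
  "chart_domain = {u. norm (\<pi> u) < normal_radius \<and> norm (u - \<pi> u) < normal_radius}"

definition chart :: "real \<Rightarrow> 'a \<Rightarrow> 'a" where
  "chart l u = (let x = pos.radial_inv l (\<pi> u)
     in x + fibre_max l x + neg.radial_inv (l, x) (u - \<pi> u))"

definition chart_inv :: "real \<Rightarrow> 'a \<Rightarrow> 'a" where
  "chart_inv l v = radial_scale (fibre_max_value l) (\<pi> v) +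
     radial_scale (fibre_drop (l, \<pi> v)) (v - \<pi> v - fibre_max l (\<pi> v))"

text \<open>The first two bounds keep both components where the rescalings are invertible, the last
  two keep the rescaled components inside \<open>chart_domain\<close>; together they describe
  exactly the image of the chart.\<close>

definition chart_range :: "real \<Rightarrow> 'a set" where
  "chart_range l = {v. norm (\<pi> v) < core_radius \<and> norm (v - \<pi> v - fibre_max l (\<pi> v)) < r / 4 \<and>
     fibre_max_value l (\<pi> v) < normal_radius\<^sup>2 \<and>
     fibre_drop (l, \<pi> v) (v - \<pi> v - fibre_max l (\<pi> v)) < normal_radius\<^sup>2}"

lemma chart_domain_eq: "chart_domain = (ball 0 normal_radius \<inter> S) + (ball 0 normal_radius \<inter> T)"
proof (intro antisym subsetI)
  fix u assume "u \<in> chart_domain"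
  then have "\<pi> u + (u - \<pi> u) \<in> (ball 0 normal_radius \<inter> S) + (ball 0 normal_radius \<inter> T)"
    using \<pi>_S \<pi>_T by (intro set_plus_intro) (auto simp: chart_domain_def)
  then show "u \<in> (ball 0 normal_radius \<inter> S) + (ball 0 normal_radius \<inter> T)" by simp
next
  fix u assume "u \<in> (ball 0 normal_radius \<inter> S) + (ball 0 normal_radius \<inter> T)"
  then obtain x y where "u = x + y" "x \<in> ball 0 normal_radius \<inter> S" "y \<in> ball 0 normal_radius \<inter> T"
    by (rule set_plus_elim)
  then show "u \<in> chart_domain" using \<pi>_add[of x y] by (simp add: chart_domain_def)
qed

lemma chart_components:
  assumes l: "l \<in> \<Lambda>" and u: "u \<in> chart_domain"
  defines "x \<equiv> pos.radial_inv l (\<pi> u)"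
  defines "y \<equiv> neg.radial_inv (l, x) (u - \<pi> u)"
  shows "x \<in> S" "norm x < core_radius" "y \<in> T" "norm y < r / 4"
    "chart l u = x + fibre_max l x + y" "\<pi> (chart l u) = x"
    "fibre_max_value l x = (norm (\<pi> u))\<^sup>2" "fibre_drop (l, x) y = (norm (u - \<pi> u))\<^sup>2"
    "radial_scale (fibre_max_value l) x = \<pi> u" "radial_scale (fibre_drop (l, x)) y = u - \<pi> u"
proof -
  have un: "norm (\<pi> u) < normal_radius" "norm (u - \<pi> u) < normal_radius"
    using u by (auto simp: chart_domain_def)
  show x: "x \<in> S" "norm x < core_radius" "fibre_max_value l x = (norm (\<pi> u))\<^sup>2"
      "radial_scale (fibre_max_value l) x = \<pi> u"
    unfolding x_def by (intro pos.radial_inv_in pos.radial_inv l \<pi>_S un)+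
  have z: "(l, x) \<in> \<Lambda> \<times> (S \<inter> cball 0 core_radius)" using l x by auto
  show y: "y \<in> T" "norm y < r / 4" "fibre_drop (l, x) y = (norm (u - \<pi> u))\<^sup>2"
      "radial_scale (fibre_drop (l, x)) y = u - \<pi> u"
    unfolding y_def by (intro neg.radial_inv_in neg.radial_inv z \<pi>_T un)+
  show eq: "chart l u = x + fibre_max l x + y"
    by (simp add: chart_def Let_def x_def y_def)
  have "fibre_max l x + y \<in> T" using fibre_max_T[OF l x(1)] x(2) y(1) T by (simp add: subspace_add)
  then show "\<pi> (chart l u) = x" unfolding eq add.assoc using x(1) by (rule_tac \<pi>_add)
qed

lemma chart_in_range:
  assumes "l \<in> \<Lambda>" "u \<in> chart_domain"
  shows "chart l u \<in> chart_range l"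
proof -
  note c = chart_components[OF assms]
  have "norm (\<pi> u) < normal_radius" "norm (u - \<pi> u) < normal_radius"
    using assms(2) by (auto simp: chart_domain_def)
  then have "(norm (\<pi> u))\<^sup>2 < normal_radius\<^sup>2" "(norm (u - \<pi> u))\<^sup>2 < normal_radius\<^sup>2"
    by (auto intro: power_strict_mono)
  then show ?thesis
    unfolding chart_range_def using c by simp
qed

lemma chart_inv_chart:
  assumes "l \<in> \<Lambda>" "u \<in> chart_domain"
  shows "chart_inv l (chart l u) = u"
  unfolding chart_inv_def using chart_components[OF assms] by simp

text \<open>\<open>J\<close> is the fibre maximum minus the drop from it, and the rescalings make
  these the two squared norms.\<close>

lemma J_chart:
  assumes "l \<in> \<Lambda>" "u \<in> chart_domain"
  shows "J l (chart l u) = (norm (\<pi> u))\<^sup>2 - (norm (u - \<pi> u))\<^sup>2"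
  using chart_components(5,7,8)[OF assms] by (simp add: fibre_drop_def)

lemma chart_range_components:
  assumes l: "l \<in> \<Lambda>" and v: "v \<in> chart_range l"
  shows "(l, \<pi> v) \<in> \<Lambda> \<times> (S \<inter> cball 0 core_radius)" "v - \<pi> v - fibre_max l (\<pi> v) \<in> T"
    "norm (v - \<pi> v - fibre_max l (\<pi> v)) < r / 4"
    "fibre_max_value l (\<pi> v) < normal_radius\<^sup>2" "norm (\<pi> v) < core_radius"
    "fibre_drop (l, \<pi> v) (v - \<pi> v - fibre_max l (\<pi> v)) < normal_radius\<^sup>2"
  using v l \<pi>_S \<pi>_T T fibre_max_T[OF l \<pi>_S, of v]
  unfolding chart_range_def by (auto intro: subspace_diff)

lemma chart_range_subset: "l \<in> \<Lambda> \<Longrightarrow> chart_range l \<subseteq> ball 0 r"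
proof
  fix v assume l: "l \<in> \<Lambda>" and v: "v \<in> chart_range l"
  note c = chart_range_components[OF this]
  have "norm (\<pi> v + fibre_max l (\<pi> v) + (v - \<pi> v - fibre_max l (\<pi> v))) < r"
    using c norm_fibre_max[OF l \<pi>_S, of v] by (intro in_r) auto
  then show "v \<in> ball 0 r" by simp
qed

lemma chart_chart_inv:
  assumes l: "l \<in> \<Lambda>" and v: "v \<in> chart_range l"
  shows "chart_inv l v \<in> chart_domain" "chart l (chart_inv l v) = v"
proof -
  note c = chart_range_components[OF assms]
  define y p m where "y = v - \<pi> v - fibre_max l (\<pi> v)"
    and "p = radial_scale (fibre_max_value l) (\<pi> v)" and "m = radial_scale (fibre_drop (l, \<pi> v)) y"
  have p: "p \<in> S" and m: "m \<in> T"
    unfolding p_def m_def y_def by (intro pos.radial_scale_in neg.radial_scale_in \<pi>_S c)+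
  have pm: "chart_inv l v = p + m" by (simp add: chart_inv_def p_def m_def y_def)
  have \<pi>_pm: "\<pi> (p + m) = p" using p m by (rule \<pi>_add)
  have np: "norm p = sqrt (fibre_max_value l (\<pi> v))"
    unfolding p_def using l \<pi>_S c(5) by (intro pos.norm_radial_scale) auto
  have nm: "norm m = sqrt (fibre_drop (l, \<pi> v) y)"
    unfolding m_def using c(1,2,3) by (intro neg.norm_radial_scale) (auto simp: y_def)
  have "norm p < normal_radius" "norm m < normal_radius"
    unfolding np nm using c(4,6) normal_radius(1)
    by (auto simp: y_def intro!: real_less_lsqrt real_sqrt_less_iff[THEN iffD2, THEN less_le_trans])
  then show "chart_inv l v \<in> chart_domain" by (simp add: pm chart_domain_def \<pi>_pm)
  have "pos.radial_inv l p = \<pi> v"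
    unfolding p_def using l \<pi>_S c(4,5) by (intro pos.radial_inv_radial_scale) auto
  moreover have "neg.radial_inv (l, \<pi> v) m = y"
    unfolding m_def y_def using c by (intro neg.radial_inv_radial_scale) auto
  ultimately show "chart l (chart_inv l v) = v"
    by (simp add: pm chart_def \<pi>_pm y_def)
qed

lemma continuous_on_chart: "continuous_on (\<Lambda> \<times> chart_domain) (\<lambda>(l, u). chart l u)"
proof -
  let ?D = "\<Lambda> \<times> chart_domain"
  define x where "x = (\<lambda>w. (\<lambda>(l, p). pos.radial_inv l p) (fst w, \<pi> (snd w)))"
  have \<pi>_cont: "continuous_on ?D (\<lambda>w. \<pi> (snd w))"
    by (intro bounded_linear.continuous_on[OF \<pi>] continuous_intros)
  have x_cont: "continuous_on ?D x"
    unfolding x_def using \<pi>_S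
    by (intro continuous_on_compose2[OF pos.continuous_on_radial_inv] continuous_intros \<pi>_cont)
      (auto simp: chart_domain_def)
  have x_in: "x w \<in> S" "norm (x w) \<le> core_radius" if "w \<in> ?D" for w
    using chart_components(1,2)[of "fst w" "snd w"] that by (auto simp: x_def intro: less_imp_le)
  have h: "continuous_on ?D (\<lambda>w. (\<lambda>(l, x). fibre_max l x) (fst w, x w))"
    using x_in by (intro continuous_on_compose2[OF continuous_on_fibre_max] continuous_intros x_cont) auto
  have y: "continuous_on ?D (\<lambda>w. (\<lambda>(z, p). neg.radial_inv z p) ((fst w, x w), snd w - \<pi> (snd w)))"
    using x_in \<pi>_T
    by (intro continuous_on_compose2[OF neg.continuous_on_radial_inv] continuous_intros x_cont \<pi>_cont)
      (auto simp: chart_domain_def)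
  have "continuous_on ?D (\<lambda>w. x w + (\<lambda>(l, x). fibre_max l x) (fst w, x w) +
      (\<lambda>(z, p). neg.radial_inv z p) ((fst w, x w), snd w - \<pi> (snd w)))"
    by (intro continuous_on_add x_cont h y)
  then show ?thesis by (simp add: case_prod_unfold chart_def x_def Let_def)
qed

lemma continuous_on_residual:
  assumes "l \<in> \<Lambda>"
  shows "continuous_on {v. norm (\<pi> v) < core_radius} (\<lambda>v. v - \<pi> v - fibre_max l (\<pi> v))"
proof -
  have "continuous_on {v. norm (\<pi> v) < core_radius} (\<lambda>v. (\<lambda>(l, x). fibre_max l x) (l, \<pi> v))"
    using assms \<pi>_S
    by (intro continuous_on_compose2[OF continuous_on_fibre_max] continuous_intros
        bounded_linear.continuous_on[OF \<pi>]) auto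
  then show ?thesis by (intro continuous_intros bounded_linear.continuous_on[OF \<pi>]) auto
qed

text \<open>Each function in the definition is known to be continuous only where the earlier bounds
  hold, so the set is cut out in stages, each open in the previous one.\<close>

lemma open_chart_range:
  assumes l: "l \<in> \<Lambda>"
  shows "open (chart_range l)"
proof -
  define U1 where "U1 = {v \<in> UNIV. norm (\<pi> v) < core_radius}"
  define res where "res v = v - \<pi> v - fibre_max l (\<pi> v)" for v
  have \<pi>_cont: "continuous_on U \<pi>" for U by (intro bounded_linear.continuous_on[OF \<pi>] continuous_intros)
  have U1: "open U1" unfolding U1_def
    by (intro open_Collect_less_on continuous_intros \<pi>_cont) auto
  have res_cont: "continuous_on U1 res"
    using continuous_on_residual[OF l] by (simp add: U1_def res_def[abs_def])
  define U2 where "U2 = {v \<in> U1. norm (res v) < r / 4}"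
  have U2: "open U2" unfolding U2_def by (intro open_Collect_less_on continuous_intros U1 res_cont)
  have res_T: "res v \<in> T" if "v \<in> U1" for v
    unfolding res_def using fibre_max_T[OF l \<pi>_S, of v] \<pi>_T T that by (auto simp: U1_def intro: subspace_diff)
  have "continuous_on U2 (\<lambda>v. (\<lambda>(l, x). fibre_max_value l x) (l, \<pi> v))"
    using l \<pi>_S
    by (intro continuous_on_compose2[OF continuous_on_fibre_max_value] continuous_intros \<pi>_cont)
      (auto simp: U2_def U1_def)
  then have U3: "open {v \<in> U2. fibre_max_value l (\<pi> v) < normal_radius\<^sup>2}" (is "open ?U3")
    by (intro open_Collect_less_on U2) simp
  have "continuous_on ?U3 (\<lambda>v. (\<lambda>(z, y). fibre_drop z y) ((l, \<pi> v), res v))"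
    using l \<pi>_S res_T
    by (intro continuous_on_compose2[OF continuous_on_fibre_drop] continuous_intros \<pi>_cont
        continuous_on_subset[OF res_cont]) (auto simp: U2_def U1_def)
  then have "open {v \<in> ?U3. fibre_drop (l, \<pi> v) (res v) < normal_radius\<^sup>2}"
    by (intro open_Collect_less_on U3) simp
  moreover have "{v \<in> ?U3. fibre_drop (l, \<pi> v) (res v) < normal_radius\<^sup>2} = chart_range l"
    by (auto simp: chart_range_def U2_def U1_def res_def)
  ultimately show ?thesis by simp
qed

lemma continuous_on_chart_inv:
  assumes l: "l \<in> \<Lambda>"
  shows "continuous_on (chart_range l) (chart_inv l)"
proof -
  have \<pi>_cont: "continuous_on (chart_range l) \<pi>" by (intro bounded_linear.continuous_on[OF \<pi>] continuous_intros)
  have res: "continuous_on (chart_range l) (\<lambda>v. v - \<pi> v - fibre_max l (\<pi> v))"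
    by (rule continuous_on_subset[OF continuous_on_residual[OF l]]) (auto simp: chart_range_def)
  have "continuous_on (chart_range l) (\<lambda>v. (\<lambda>(l, x). radial_scale (fibre_max_value l) x) (l, \<pi> v))"
    using chart_range_components[OF l] l \<pi>_S
    by (intro continuous_on_compose2[OF pos.continuous_on_radial_scale] continuous_intros \<pi>_cont)
      (auto intro: less_imp_le)
  moreover have "continuous_on (chart_range l) (\<lambda>v. (\<lambda>(z, y). radial_scale (fibre_drop z) y)
      ((l, \<pi> v), v - \<pi> v - fibre_max l (\<pi> v)))"
    using chart_range_components(1,2)[OF l] less_imp_le[OF chart_range_components(3)[OF l]]
    by (intro continuous_on_compose2[OF neg.continuous_on_radial_scale] continuous_on_Pair
        continuous_on_const \<pi>_cont res) auto
  ultimately show ?thesis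
    unfolding chart_inv_def[abs_def] by (intro continuous_on_add) simp_all
qed

lemma homeomorphism_chart:
  assumes l: "l \<in> \<Lambda>"
  shows "homeomorphism chart_domain (chart_range l) (chart l) (chart_inv l)"
proof (rule homeomorphismI)
  have "continuous_on chart_domain (\<lambda>u. (\<lambda>(l, u). chart l u) (l, u))"
    using l by (intro continuous_on_compose2[OF continuous_on_chart] continuous_intros) auto
  then show "continuous_on chart_domain (chart l)" by simp
qed (use l continuous_on_chart_inv chart_in_range chart_chart_inv chart_inv_chart in auto)

lemma chart_0:
  assumes "l \<in> \<Lambda>"
  shows "chart l 0 = 0"
  using \<pi>_zero[of 0] T fibre_max_0[OF assms] by (simp add: chart_def subspace_0)

lemma zero_in_chart_domain: "0 \<in> chart_domain"
  using \<pi>_zero[of 0] T normal_radius(1) by (simp add: chart_domain_def subspace_0)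

text \<open>An equivalence is needed, since surjectivity onto the part of the range in
  \<open>K\<close> requires the preimage to lie in \<open>K\<close>; \<open>x\<close> and
  \<open>\<pi> u\<close> are multiples of each other, which gives both directions.\<close>

lemma chart_subspace_iff:
  assumes l: "l \<in> \<Lambda>" and u: "u \<in> chart_domain" and K: "subspace K" "T \<subseteq> K"
  shows "chart l u \<in> K \<longleftrightarrow> u \<in> K"
proof -
  note c = chart_components[OF l u]
  define x where "x = pos.radial_inv l (\<pi> u)"
  have sum_iff: "v + w \<in> K \<longleftrightarrow> v \<in> K" if "w \<in> K" for v w
    using K(1) that subspace_diff[of K "v + w" w] by (auto intro: subspace_add)
  have "fibre_max l x + neg.radial_inv (l, x) (u - \<pi> u) \<in> K"
    using fibre_max_T[OF l c(1)] c(2,3) K unfolding x_def by (intro subspace_add) auto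
  then have "chart l u \<in> K \<longleftrightarrow> x \<in> K"
    using sum_iff[of _ x] by (simp add: c(5) x_def add.assoc)
  also have "\<dots> \<longleftrightarrow> \<pi> u \<in> K"
  proof
    show "\<pi> u \<in> K" if "x \<in> K"
      using subspace_scale[OF K(1) that, of "sqrt (fibre_max_value l x) / norm x"] c(9)
      by (simp add: x_def radial_scale_def)
    show "x \<in> K" if "\<pi> u \<in> K"
      unfolding x_def pos.radial_inv_def by (intro subspace_scale K(1) that)
  qed
  also have "\<dots> \<longleftrightarrow> u \<in> K"
    using sum_iff[of "u - \<pi> u" "\<pi> u"] \<pi>_T K(2) by auto
  finally show ?thesis .
qed

lemma homeomorphism_chart_subspace:
  assumes l: "l \<in> \<Lambda>" and K: "subspace K" "T \<subseteq> K"
  shows "homeomorphism ((ball 0 normal_radius \<inter> (K \<inter> S)) + (ball 0 normal_radius \<inter> T))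
    (chart_range l \<inter> K) (chart l) (chart_inv l)"
proof -
  have eq: "(ball 0 normal_radius \<inter> (K \<inter> S)) + (ball 0 normal_radius \<inter> T) = chart_domain \<inter> K"
  proof (intro antisym subsetI)
    fix u assume "u \<in> (ball 0 normal_radius \<inter> (K \<inter> S)) + (ball 0 normal_radius \<inter> T)"
    then obtain x y where xy: "u = x + y" "x \<in> ball 0 normal_radius \<inter> (K \<inter> S)" "y \<in> ball 0 normal_radius \<inter> T"
      by (rule set_plus_elim)
    then have "u \<in> chart_domain" unfolding chart_domain_eq by auto
    moreover have "u \<in> K" using xy K by (auto intro: subspace_add)
    ultimately show "u \<in> chart_domain \<inter> K" by simp
  next
    fix u assume u: "u \<in> chart_domain \<inter> K"
    have "u - \<pi> u \<in> K" "u \<in> K" using \<pi>_T K(2) u by auto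
    then have "\<pi> u \<in> K" using subspace_diff[OF K(1), of u "u - \<pi> u"] by simp
    then have "\<pi> u + (u - \<pi> u) \<in> (ball 0 normal_radius \<inter> (K \<inter> S)) + (ball 0 normal_radius \<inter> T)"
      using u \<pi>_S \<pi>_T by (intro set_plus_intro) (auto simp: chart_domain_def)
    then show "u \<in> (ball 0 normal_radius \<inter> (K \<inter> S)) + (ball 0 normal_radius \<inter> T)" by simp
  qed
  have "chart l ` (chart_domain \<inter> K) = chart_range l \<inter> K"
  proof (intro antisym subsetI)
    fix v assume "v \<in> chart_range l \<inter> K"
    then have v: "v \<in> chart_range l" "v \<in> K" by auto
    note c = chart_chart_inv[OF l v(1)]
    have "chart_inv l v \<in> K" using chart_subspace_iff[OF l c(1) K] c(2) v(2) by simp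
    then have "chart_inv l v \<in> chart_domain \<inter> K" using c(1) by simp
    then show "v \<in> chart l ` (chart_domain \<inter> K)" using c(2) by (metis imageI)
  qed (use chart_in_range[OF l] chart_subspace_iff[OF l _ K] in auto)
  then show ?thesis
    unfolding eq by (rule_tac homeomorphism_of_subsets[OF homeomorphism_chart[OF l]]) auto
qed

text \<open>Monotonicity against the origin, where the gradient also vanishes.\<close>

lemma critical_imp_zero:
  assumes "l \<in> \<Lambda>" "norm u < r" "A l u = 0"
  shows "u = 0"
proof -
  have "a * (norm u)\<^sup>2 \<le> 0" using mono[OF assms(1) _ assms(2), of 0] assms(1,3) r A_0 by simp
  then show ?thesis using a by (simp add: mult_le_0_iff)
qed

end

section \<open>Monotonicity from Gateaux derivatives\<close>

text \<open>Were no constant and radius to work, taking both equal to \<open>1 / (n + 1)\<close>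
  would select a null sequence in \<open>D\<close> along which coercivity degenerates.\<close>

lemma uniform_coercivity:
  fixes P :: "'a::real_inner \<Rightarrow> 'a \<Rightarrow>\<^sub>L 'a"
  assumes "\<And>x. (\<And>k. x k \<in> D) \<Longrightarrow> (\<lambda>k. norm (x k)) \<longlonglongrightarrow> 0 \<Longrightarrow>
      \<exists>C0>0. \<exists>k0::nat. \<forall>k\<ge>k0. \<forall>u. P (x k) u \<bullet> u \<ge> C0 * (norm u)\<^sup>2"
  obtains c d where "c > 0" "d > 0"
    "\<And>x u. x \<in> D \<Longrightarrow> norm x < d \<Longrightarrow> P x u \<bullet> u \<ge> c * (norm u)\<^sup>2"
proof (rule ccontr)
  assume no: "\<not> thesis"
  have "\<exists>x\<in>D. norm x < inverse (real (Suc n)) \<and>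
      (\<exists>u. P x u \<bullet> u < inverse (real (Suc n)) * (norm u)\<^sup>2)" for n
  proof (rule ccontr)
    assume "\<not> ?thesis"
    then have "\<And>x u. x \<in> D \<Longrightarrow> norm x < inverse (real (Suc n)) \<Longrightarrow>
        P x u \<bullet> u \<ge> inverse (real (Suc n)) * (norm u)\<^sup>2" by (meson not_le)
    with no that[of "inverse (real (Suc n))" "inverse (real (Suc n))"] show False by simp
  qed
  then obtain x u where x: "\<And>n. x n \<in> D" "\<And>n. norm (x n) < inverse (real (Suc n))"
    and u: "\<And>n. P (x n) (u n) \<bullet> u n < inverse (real (Suc n)) * (norm (u n))\<^sup>2" by metis
  have "(\<lambda>n. norm (x n)) \<longlonglongrightarrow> 0"
    by (rule tendsto_sandwich[OF _ _ tendsto_const LIMSEQ_inverse_real_of_nat])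
      (use x(2) in \<open>auto intro!: always_eventually less_imp_le\<close>)
  from assms[OF x(1) this] obtain C0 k0 where C0: "C0 > 0"
    "\<And>k u. k \<ge> k0 \<Longrightarrow> P (x k) u \<bullet> u \<ge> C0 * (norm u)\<^sup>2" by blast
  obtain m where m: "inverse (real (Suc m)) < C0" using reals_Archimedean[OF C0(1)] by blast
  define n where "n = max m k0"
  have "inverse (real (Suc n)) \<le> inverse (real (Suc m))" by (simp add: n_def)
  then have "inverse (real (Suc n)) \<le> C0" using m by linarith
  then have "inverse (real (Suc n)) * (norm (u n))\<^sup>2 \<le> C0 * (norm (u n))\<^sup>2"
    by (rule mult_right_mono) simp
  with u[of n] C0(2)[of n "u n"] show False by (simp add: n_def)
qed

lemma has_gateaux_derivative_add_scaleR:
  assumes "has_gateaux_derivative F A u" "has_gateaux_derivative G B u"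
  shows "has_gateaux_derivative (\<lambda>u. F u + l *\<^sub>R G u) (A + l *\<^sub>R B) u"
  unfolding has_gateaux_derivative_def
proof
  fix h
  have "((\<lambda>t. (F (u + t *\<^sub>R h) - F u) /\<^sub>R t + l *\<^sub>R ((G (u + t *\<^sub>R h) - G u) /\<^sub>R t))
      \<longlongrightarrow> A h + l *\<^sub>R B h) (at 0)"
    using assms unfolding has_gateaux_derivative_def by (intro tendsto_intros) auto
  then show "((\<lambda>t. ((F (u + t *\<^sub>R h) + l *\<^sub>R G (u + t *\<^sub>R h)) - (F u + l *\<^sub>R G u)) /\<^sub>R t)
      \<longlongrightarrow> (A + l *\<^sub>R B) h) (at 0)"
    by (simp add: blinfun.add_left blinfun.scaleR_left algebra_simps)
qed

text \<open>The Gateaux derivative exists only on the dense subspace \<open>X\<close>, so the mean value theorem is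
  applied there and the inequality is extended by continuity of \<open>F\<close>.\<close>
lemma monotone_of_gateaux_derivative:
  fixes F :: "'a::real_inner \<Rightarrow> 'a" and B :: "'a \<Rightarrow> 'a \<Rightarrow>\<^sub>L 'a"
  assumes X: "subspace X" "closure X = UNIV" and \<sigma>: "bounded_linear \<sigma>"
    and cont: "continuous_on (ball 0 r) F"
    and gat: "\<And>u. u \<in> X \<Longrightarrow> norm u < r \<Longrightarrow> has_gateaux_derivative F (B u) u"
    and lower: "\<And>u d. u \<in> X \<Longrightarrow> norm u < r \<Longrightarrow> a * (norm d)\<^sup>2 \<le> B u d \<bullet> \<sigma> d"
    and u: "norm u < r" and v: "norm v < r"
  shows "a * (norm (v - u))\<^sup>2 \<le> (F v - F u) \<bullet> \<sigma> (v - u)"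
proof -
  have on_X: "a * (norm (v - u))\<^sup>2 \<le> (F v - F u) \<bullet> \<sigma> (v - u)"
    if uv: "u \<in> X" "v \<in> X" "norm u < r" "norm v < r" for u v
  proof -
    define d where "d = v - u"
    define g where "g t = F (u + t *\<^sub>R d) \<bullet> \<sigma> d" for t
    have seg: "u + t *\<^sub>R d \<in> X" "norm (u + t *\<^sub>R d) < r" if "0 \<le> t" "t \<le> 1" for t
    proof -
      show "u + t *\<^sub>R d \<in> X"
        unfolding d_def using X(1) uv by (intro subspace_add subspace_scale subspace_diff)
      have "(1 - t) *\<^sub>R u + t *\<^sub>R v \<in> ball 0 r"
        using uv that by (intro convexD[OF convex_ball]) auto
      then show "norm (u + t *\<^sub>R d) < r" by (simp add: d_def algebra_simps)
    qed
    \<comment> \<open>A Gateaux derivative in the fixed direction \<open>d\<close> is an ordinary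
      two-sided derivative of the scalar function \<open>g\<close>, also at both endpoints.\<close>
    have deriv: "(g has_real_derivative (B (u + t *\<^sub>R d) d \<bullet> \<sigma> d)) (at t)" if t: "0 \<le> t" "t \<le> 1" for t
    proof -
      have "((\<lambda>s. ((F (u + t *\<^sub>R d + s *\<^sub>R d) - F (u + t *\<^sub>R d)) /\<^sub>R s) \<bullet> \<sigma> d)
          \<longlongrightarrow> B (u + t *\<^sub>R d) d \<bullet> \<sigma> d) (at 0)"
        using gat[OF seg[OF t]] unfolding has_gateaux_derivative_def by (intro tendsto_intros) auto
      moreover have "(\<lambda>s. ((F (u + t *\<^sub>R d + s *\<^sub>R d) - F (u + t *\<^sub>R d)) /\<^sub>R s) \<bullet> \<sigma> d) =
          (\<lambda>s. (g (t + s) - g t) / s)"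
        by (simp add: fun_eq_iff g_def inner_diff_left divide_inverse scaleR_add_left add.assoc mult.commute)
      ultimately show ?thesis unfolding DERIV_def by simp
    qed
    have "\<exists>t. 0 < t \<and> t < 1 \<and> g 1 - g 0 = (1 - 0) * (B (u + t *\<^sub>R d) d \<bullet> \<sigma> d)"
      by (rule MVT2) (use deriv in auto)
    then obtain t where t: "0 < t" "t < 1" "g 1 - g 0 = B (u + t *\<^sub>R d) d \<bullet> \<sigma> d" by auto
    have "a * (norm d)\<^sup>2 \<le> g 1 - g 0" unfolding t(3) using seg[of t] t by (intro lower) auto
    then show ?thesis by (simp add: g_def d_def inner_diff_left)
  qed
  \<comment> \<open>A sequence from the dense subspace lies in the open ball from some index on;
    shifting it drops the other terms.\<close>
  have approx: "\<exists>x. (\<forall>n. x n \<in> X \<and> norm (x n) < r) \<and> x \<longlonglongrightarrow> w" if "norm w < r" for w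
  proof -
    have "w \<in> closure X" using X(2) by simp
    then obtain x where x: "\<And>n. x n \<in> X" "x \<longlonglongrightarrow> w" unfolding closure_sequential by blast
    have "eventually (\<lambda>n. norm (x n) < r) sequentially"
      using order_tendstoD(2)[OF tendsto_norm[OF x(2)] that] .
    then obtain N where "\<And>n. n \<ge> N \<Longrightarrow> norm (x n) < r" by (auto simp: eventually_sequentially)
    then show ?thesis
      using x LIMSEQ_ignore_initial_segment[OF x(2), of N] by (intro exI[of _ "\<lambda>n. x (n + N)"]) auto
  qed
  obtain x where x: "\<And>n. x n \<in> X" "\<And>n. norm (x n) < r" "x \<longlonglongrightarrow> u" using approx[OF u] by blast
  obtain y where y: "\<And>n. y n \<in> X" "\<And>n. norm (y n) < r" "y \<longlonglongrightarrow> v" using approx[OF v] by blast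
  have F_lim: "(\<lambda>n. F (z n)) \<longlonglongrightarrow> F w" if "\<And>n. norm (z n) < r" "z \<longlonglongrightarrow> w" "norm w < r" for z w
    using cont that unfolding continuous_on_sequentially by (auto simp: o_def)
  show ?thesis
  proof (rule tendsto_le[OF sequentially_bot])
    show "(\<lambda>n. (F (y n) - F (x n)) \<bullet> \<sigma> (y n - x n)) \<longlonglongrightarrow> (F v - F u) \<bullet> \<sigma> (v - u)"
      by (intro tendsto_intros F_lim bounded_linear.tendsto[OF \<sigma>] x y u v)
    show "(\<lambda>n. a * (norm (y n - x n))\<^sup>2) \<longlonglongrightarrow> a * (norm (v - u))\<^sup>2"
      by (intro tendsto_intros x y)
  qed (use on_X x y in auto)
qed

section \<open>Verification of the saddle conditions and the theorem\<close>

theorem theorem2p9: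
  fixes V X Hp Hm :: "'a::{real_inner, complete_space} set"
    and L G :: "'a \<Rightarrow> real"
    and B P Q G2 :: "'a \<Rightarrow> 'a \<Rightarrow>\<^sub>L 'a"
  assumes "subspace X" and "closure X = UNIV"
    and "open V" and "0 \<in> V"
    and "C1_on V L" and "critical_point L 0"
    and "hypothesis_A V X L B P Q"
    and "C1_on V G" and "critical_point G 0"
    and "\<forall>u\<in>V. self_adjoint (G2 u) \<and> has_gateaux_derivative (grad G) (G2 u) u"
    and "continuous (at 0 within V) G2"
    and "{u. B 0 u = 0} = {0}"
    and "Hp = pos_def_space (B 0)" and "Hm = neg_def_space (B 0)"
  shows "Hp = orthogonal_comp Hm \<and> Hp + Hm = UNIV \<and>
    (\<exists>\<rho>>0. \<exists>\<epsilon>>0. \<exists>(W :: real \<Rightarrow> 'a set) (\<phi> :: real \<Rightarrow> 'a \<Rightarrow> 'a).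
      (\<forall>lam\<in>{-\<rho>..\<rho>}.
         open (W lam) \<and> 0 \<in> W lam \<and> W lam \<subseteq> V \<and>
         (\<exists>\<psi>. homeomorphism ((ball 0 \<epsilon> \<inter> Hp) + (ball 0 \<epsilon> \<inter> Hm)) (W lam) (\<phi> lam) \<psi>) \<and>
         \<phi> lam 0 = 0 \<and>
         (\<forall>p\<in>ball 0 \<epsilon> \<inter> Hp. \<forall>m\<in>ball 0 \<epsilon> \<inter> Hm.
            L (\<phi> lam (p + m)) + lam * G (\<phi> lam (p + m))
              = L 0 + lam * G 0 + (norm p)\<^sup>2 - (norm m)\<^sup>2) \<and>
         isolated_critical_point (\<lambda>u. L u + lam * G u) 0) \<and>
      continuous_on ({-\<rho>..\<rho>} \<times> ((ball 0 \<epsilon> \<inter> Hp) + (ball 0 \<epsilon> \<inter> Hm))) (\<lambda>(lam, u). \<phi> lam u) \<and>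
      (\<forall>K Kp. subspace K \<and> closed K \<and> Hm \<subseteq> K \<and> Kp = K \<inter> Hp \<longrightarrow>
         Kp = K \<inter> orthogonal_comp Hm \<and>
         (\<forall>lam\<in>{-\<rho>..\<rho>}.
            (\<exists>\<psi>. homeomorphism ((ball 0 \<epsilon> \<inter> Kp) + (ball 0 \<epsilon> \<inter> Hm)) (W lam \<inter> K) (\<phi> lam) \<psi>) \<and>
            (\<forall>p\<in>ball 0 \<epsilon> \<inter> Kp. \<forall>m\<in>ball 0 \<epsilon> \<inter> Hm.
               L (\<phi> lam (p + m)) + lam * G (\<phi> lam (p + m))
                 = L 0 + lam * G 0 + (norm p)\<^sup>2 - (norm m)\<^sup>2))))"
proof -
  note hyp = \<open>hypothesis_A V X L B P Q\<close>[unfolded hypothesis_A_def]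
  note hyp2 = hyp[THEN conjunct2, THEN conjunct2, THEN conjunct2]
  have H: "\<And>u. u \<in> V \<inter> X \<Longrightarrow> self_adjoint (B u)"
      "\<And>u. u \<in> V \<inter> X \<Longrightarrow> has_gateaux_derivative (grad L) (B u) u"
    using hyp[THEN conjunct1] by blast+
  have H_split: "\<And>x. x \<in> V \<inter> X \<Longrightarrow> B x = P x + Q x" "\<And>x. x \<in> V \<inter> X \<Longrightarrow> positive_definite (P x)"
      "\<And>x. x \<in> V \<inter> X \<Longrightarrow> self_adjoint (Q x)" "\<And>x. x \<in> V \<inter> X \<Longrightarrow> compact_operator (Q x)"
    using hyp[THEN conjunct2, THEN conjunct1] by blast+
  have D2: "\<And>x u. (\<And>k. x k \<in> V \<inter> X) \<Longrightarrow> (\<lambda>k. norm (x k)) \<longlonglongrightarrow> 0 \<Longrightarrow>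
      (\<lambda>k. norm (P (x k) u - P 0 u)) \<longlonglongrightarrow> 0"
    using hyp2[THEN conjunct1] by blast
  have D3: "continuous (at 0 within V \<inter> X) Q"
    using hyp2[THEN conjunct2, THEN conjunct1] .
  have D4: "\<And>x. (\<And>k. x k \<in> V \<inter> X) \<Longrightarrow> (\<lambda>k. norm (x k)) \<longlonglongrightarrow> 0 \<Longrightarrow>
      \<exists>C0>0. \<exists>k0::nat. \<forall>k\<ge>k0. \<forall>u. P (x k) u \<bullet> u \<ge> C0 * (norm u)\<^sup>2"
    using hyp2[THEN conjunct2, THEN conjunct2] by blast
  define D where "D = V \<inter> X"
  have zero: "0 \<in> D" using \<open>subspace X\<close> \<open>0 \<in> V\<close> by (simp add: D_def subspace_0)
  have P_adj: "self_adjoint (P x)" if "x \<in> D" for x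
    using H_split(2)[of x] that by (simp add: positive_definite_def D_def)
  obtain c d1 where c: "c > 0" "d1 > 0"
    "\<And>x u. x \<in> D \<Longrightarrow> norm x < d1 \<Longrightarrow> P x u \<bullet> u \<ge> c * (norm u)\<^sup>2"
    using uniform_coercivity[of "V \<inter> X" P, OF D4] unfolding D_def by metis
  interpret Fredholm_form "B 0" "P 0" "Q 0" c
  proof
    show "self_adjoint (B 0)" "B 0 = P 0 + Q 0" "compact_operator (Q 0)"
      using H(1) H_split(1,4) zero by (simp_all add: D_def)
    show "c * (norm u)\<^sup>2 \<le> P 0 u \<bullet> u" for u using c(2) by (intro c(3)[OF zero]) simp
  qed (rule c(1))
  obtain E b where E: "nonpos_system E" and b: "b > 0"
    and Hm: "neg_def_space (B 0) = span E" and Hp: "pos_def_space (B 0) = {u. \<forall>e\<in>E. u \<bullet> e = 0}"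
    and neg: "\<And>u. u \<in> span E \<Longrightarrow> B 0 u \<bullet> u \<le> - b * (norm u)\<^sup>2"
    and pos: "\<And>u. \<forall>e\<in>E. u \<bullet> e = 0 \<Longrightarrow> B 0 u \<bullet> u \<ge> b * (norm u)\<^sup>2"
    by (rule spectral_splitting[OF \<open>{u. B 0 u = 0} = {0}\<close>], rule that)
  have finE: "finite E" and orthE: "pairwise orthogonal E"
    using finite_nonpos_system[OF E] E by (auto simp: nonpos_system_def)
  have strong: "((\<lambda>x. P x u) \<longlongrightarrow> P 0 u) (at 0 within D)" for u
  proof -
    have "continuous (at 0 within D) (\<lambda>x. P x u)"
      unfolding continuous_within_sequentially o_def
    proof (intro allI impI)
      fix x :: "nat \<Rightarrow> 'a" assume x: "(\<forall>n. x n \<in> D) \<and> x \<longlonglongrightarrow> 0"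
      then have "(\<lambda>k. norm (P (x k) u - P 0 u)) \<longlonglongrightarrow> 0"
        by (intro D2) (auto simp: D_def tendsto_norm_zero_iff)
      then show "(\<lambda>k. P (x k) u) \<longlonglongrightarrow> P 0 u"
        by (rule LIM_zero_cancel[OF tendsto_norm_zero_cancel])
    qed
    then show ?thesis by (simp add: continuous_within)
  qed
  have Q_lim: "(Q \<longlongrightarrow> Q 0) (at 0 within D)" using D3 by (simp add: continuous_within D_def)
  have ev_D: "eventually (\<lambda>x. x \<in> D \<and> norm x < d1) (at 0 within D)"
    using c(2) by (auto simp: eventually_at intro!: exI[of _ d1])
  have ev_adj: "eventually (\<lambda>x. self_adjoint (P x)) (at 0 within D)"
    using ev_D by (rule eventually_mono) (use P_adj in auto)
  have ev_coer: "eventually (\<lambda>x. \<forall>u. P x u \<bullet> u \<ge> c * (norm u)\<^sup>2) (at 0 within D)"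
    using ev_D by (rule eventually_mono) (use c(3) in auto)
  have Q0_adj: "self_adjoint (Q 0)" using H_split(3) zero by (simp add: D_def)
  obtain a1 where a1: "a1 > 0"
    "eventually (\<lambda>x. \<forall>h. (\<forall>e\<in>E. h \<bullet> e = 0) \<longrightarrow> (P x + Q x) h \<bullet> h \<ge> a1 * (norm h)\<^sup>2) (at 0 within D)"
    by (rule perturbation_coercive[OF P_adj[OF zero] Q0_adj ev_adj strong Q_lim ev_coer finE b],
        erule pos, rule that)
  have ev_neg: "eventually (\<lambda>x. \<forall>h\<in>span E. (P x + Q x) h \<bullet> h \<le> - (b / 2) * (norm h)\<^sup>2) (at 0 within D)"
    by (rule perturbation_negative[OF strong Q_lim finE b neg])
  define a0 where "a0 = min a1 (b / 2)"
  have a0: "a0 > 0" "a0 \<le> a1" "a0 \<le> b / 2" using a1(1) b by (auto simp: a0_def)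
  obtain d2 where d2: "d2 > 0" "\<And>x. x \<in> D \<Longrightarrow> x \<noteq> 0 \<Longrightarrow> norm x < d2 \<Longrightarrow>
      (\<forall>h. (\<forall>e\<in>E. h \<bullet> e = 0) \<longrightarrow> (P x + Q x) h \<bullet> h \<ge> a1 * (norm h)\<^sup>2) \<and>
      (\<forall>h\<in>span E. (P x + Q x) h \<bullet> h \<le> - (b / 2) * (norm h)\<^sup>2)"
    using eventually_conj[OF a1(2) ev_neg] unfolding eventually_at by auto
  \<comment> \<open>The eventual bounds concern a punctured neighbourhood, so \<open>x = 0\<close>
    is covered by the bounds for \<open>B 0\<close> itself.\<close>
  have B_pos: "a0 * (norm h)\<^sup>2 \<le> B x h \<bullet> h"
    if "x \<in> D" "norm x < d2" "\<forall>e\<in>E. h \<bullet> e = 0" for x h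
  proof (cases "x = 0")
    case True
    have "a0 * (norm h)\<^sup>2 \<le> b * (norm h)\<^sup>2" using a0 b by (intro mult_right_mono) auto
    then show ?thesis using pos[OF that(3)] True by simp
  next
    case False
    have "a0 * (norm h)\<^sup>2 \<le> a1 * (norm h)\<^sup>2" using a0 by (intro mult_right_mono) auto
    then show ?thesis using d2(2)[OF that(1) False that(2)] that(1,3) H_split(1)[of x] by (force simp: D_def)
  qed
  have B_neg: "B x h \<bullet> h \<le> - a0 * (norm h)\<^sup>2"
    if "x \<in> D" "norm x < d2" "h \<in> span E" for x h
  proof -
    have "a0 * (norm h)\<^sup>2 \<le> b / 2 * (norm h)\<^sup>2" "b / 2 * (norm h)\<^sup>2 \<le> b * (norm h)\<^sup>2"
      using a0 b by (intro mult_right_mono; simp)+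
    then show ?thesis
      using d2(2)[OF that(1) _ that(2)] neg[OF that(3)] that(1,3) H_split(1)[of x]
      by (cases "x = 0") (force simp: D_def)+
  qed
  define N where "N = norm (G2 0) + 1"
  have N: "N > 0" by (simp add: N_def add_nonneg_pos)
  obtain d3 where d3: "d3 > 0" "\<And>x. x \<in> V \<Longrightarrow> norm x < d3 \<Longrightarrow> norm (G2 x) \<le> N"
  proof -
    obtain d3 where d3: "d3 > 0" "\<forall>x\<in>V. dist x 0 < d3 \<longrightarrow> dist (G2 x) (G2 0) < 1"
      using \<open>continuous (at 0 within V) G2\<close> unfolding continuous_within_eps_delta
      by (meson zero_less_one)
    have "norm (G2 x) \<le> N" if "x \<in> V" "norm x < d3" for x
      using d3(2) that norm_triangle_sub[of "G2 x" "G2 0"] by (force simp: N_def dist_norm)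
    with d3(1) show ?thesis by (rule that)
  qed
  obtain d4 where d4: "d4 > 0" "ball 0 d4 \<subseteq> V"
    using \<open>open V\<close> \<open>0 \<in> V\<close> open_contains_ball by blast
  \<comment> \<open>With \<open>N\<close> bounding \<open>G2\<close> near the origin, the
    perturbation costs at most \<open>\<rho> * N = a0 / 2\<close>, half of the coercivity.\<close>
  define \<rho> where "\<rho> = a0 / (2 * N)"
  have \<rho>: "\<rho> > 0" "\<rho> * N = a0 / 2" using a0 N by (simp_all add: \<rho>_def)
  define r where "r = min d2 (min d3 d4)"
  have r: "r > 0" "r \<le> d2" "r \<le> d3" "r \<le> d4" using d2(1) d3(1) d4(1) by (auto simp: r_def)
  have in_V: "u \<in> V" if "norm u < r" for u using that r(4) d4(2) by (auto simp: subset_iff)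
  define A where "A l u = grad L u + l *\<^sub>R grad G u" for l u
  \<comment> \<open>\<open>saddle_family\<close> wants value \<open>0\<close> at the origin; the
    subtracted constant reappears in the normal form.\<close>
  define J where "J l u = L u + l * G u - L 0 - l * G 0" for l u
  define \<pi> where "\<pi> u = u - orth_proj E u" for u
  define \<sigma> where "\<sigma> u = \<pi> u - (u - \<pi> u)" for u
  have \<pi>: "bounded_linear \<pi>"
    unfolding \<pi>_def[abs_def] by (intro bounded_linear_sub bounded_linear_ident bounded_linear_orth_proj)
  have \<sigma>: "bounded_linear \<sigma>"
    unfolding \<sigma>_def[abs_def] by (intro bounded_linear_sub bounded_linear_ident \<pi>)
  have \<pi>_Hp: "\<pi> u \<bullet> e = 0" if "e \<in> E" for u e
    unfolding \<pi>_def using orth_proj_residual[OF finE orthE span_base[OF that]] .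
  have \<pi>_Hm: "u - \<pi> u \<in> span E" for u
    by (simp add: \<pi>_def orth_proj_in_span)
  have orth: "x \<bullet> y = 0" if "\<And>e. e \<in> E \<Longrightarrow> x \<bullet> e = 0" "y \<in> span E" for x y
    using span_orth_complement[OF that] .
  have \<pi>_orth: "\<pi> u \<bullet> (u - \<pi> u) = 0" for u using orth[OF \<pi>_Hp \<pi>_Hm] .
  have split_sq: "(norm u)\<^sup>2 = (norm (\<pi> u))\<^sup>2 + (norm (u - \<pi> u))\<^sup>2" for u
  proof -
    have "(norm (\<pi> u + (u - \<pi> u)))\<^sup>2 = (norm (\<pi> u))\<^sup>2 + (norm (u - \<pi> u))\<^sup>2"
      unfolding power2_norm_eq_inner inner_add_left inner_add_right
      using \<pi>_orth[of u] by (simp add: inner_commute)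
    then show ?thesis by simp
  qed
  have \<sigma>_norm: "norm (\<sigma> u) = norm u" for u
  proof -
    have "(norm (\<sigma> u))\<^sup>2 = (norm (\<pi> u))\<^sup>2 + (norm (u - \<pi> u))\<^sup>2"
      unfolding \<sigma>_def power2_norm_eq_inner inner_diff_left[of "\<pi> u" "u - \<pi> u"]
        inner_diff_right[of _ "\<pi> u" "u - \<pi> u"]
      using \<pi>_orth[of u] inner_commute[of "u - \<pi> u" "\<pi> u"] by simp
    then have "(norm (\<sigma> u))\<^sup>2 = (norm u)\<^sup>2" using split_sq[of u] by simp
    then show ?thesis by (simp add: power2_eq_iff_nonneg)
  qed
  have L_grad: "GDERIV L u :> grad L u" and G_grad: "GDERIV G u :> grad G u" if "u \<in> V" for u
    using C1_on_GDERIV \<open>C1_on V L\<close> \<open>C1_on V G\<close> that by blast+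
  have cont_L: "continuous_on (ball 0 r) (grad L)" and cont_G: "continuous_on (ball 0 r) (grad G)"
    using continuous_on_grad[OF \<open>C1_on V L\<close>] continuous_on_grad[OF \<open>C1_on V G\<close>] in_V
    by (auto intro: continuous_on_subset)
  have grad_0: "grad L 0 = 0" "grad G 0 = 0"
    using \<open>critical_point L 0\<close> \<open>critical_point G 0\<close>
    by (auto intro!: grad_eqI simp: critical_point_def gderiv_def)
  have L_deriv: "((\<lambda>u. L u + l * G u) has_derivative (\<lambda>h. h \<bullet> A l u)) (at u)" if "u \<in> V" for l u
    using L_grad[OF that] G_grad[OF that] unfolding gderiv_def A_def
    by (auto intro!: derivative_eq_intros simp: inner_add_right)
  have lower: "a0 / 2 * (norm h)\<^sup>2 \<le> (B u + l *\<^sub>R G2 u) h \<bullet> \<sigma> h"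
    if l: "l \<in> {-\<rho>..\<rho>}" and u: "u \<in> X" "norm u < r" for l u h
  proof -
    define x y where "x = \<pi> h" and "y = h - \<pi> h"
    have uD: "u \<in> D" "norm u < d2" using u in_V[OF u(2)] r by (auto simp: D_def)
    have h: "h = x + y" by (simp add: x_def y_def)
    have "B u x \<bullet> y = B u y \<bullet> x"
      using H(1)[of u] uD(1) unfolding self_adjoint_def by (simp add: D_def inner_commute)
    then have "B u h \<bullet> \<sigma> h = B u x \<bullet> x - B u y \<bullet> y"
      unfolding \<sigma>_def x_def[symmetric] y_def[symmetric]
      by (simp add: h blinfun.add_right inner_add_left inner_diff_right)
    also have "\<dots> \<ge> a0 * (norm x)\<^sup>2 + a0 * (norm y)\<^sup>2"
      using B_pos[OF uD, of x] B_neg[OF uD, of y] \<pi>_Hp \<pi>_Hm by (simp add: x_def y_def)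
    finally have 1: "B u h \<bullet> \<sigma> h \<ge> a0 * (norm h)\<^sup>2"
      using split_sq[of h] by (simp add: x_def y_def algebra_simps)
    have "\<bar>l * (G2 u h \<bullet> \<sigma> h)\<bar> \<le> \<rho> * (N * norm h * norm h)"
      unfolding abs_mult
    proof (rule mult_mono)
      show "\<bar>l\<bar> \<le> \<rho>" using l by auto
      have "\<bar>G2 u h \<bullet> \<sigma> h\<bar> \<le> norm (G2 u h) * norm (\<sigma> h)" by (rule Cauchy_Schwarz_ineq2)
      also have "\<dots> \<le> (norm (G2 u) * norm h) * norm h"
        unfolding \<sigma>_norm by (intro mult_right_mono norm_blinfun) auto
      also have "\<dots> \<le> (N * norm h) * norm h"
        using d3(2) in_V[OF u(2)] u(2) r(3) by (intro mult_right_mono) auto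
      finally show "\<bar>G2 u h \<bullet> \<sigma> h\<bar> \<le> N * norm h * norm h" .
    qed (use \<rho> in auto)
    also have "\<rho> * (N * norm h * norm h) = a0 / 2 * (norm h)\<^sup>2"
      using \<rho>(2) by (simp add: power2_eq_square flip: mult.assoc)
    finally have 2: "l * (G2 u h \<bullet> \<sigma> h) \<ge> - (a0 / 2 * (norm h)\<^sup>2)" by linarith
    have "(B u + l *\<^sub>R G2 u) h \<bullet> \<sigma> h = B u h \<bullet> \<sigma> h + l * (G2 u h \<bullet> \<sigma> h)"
      by (simp add: blinfun.add_left blinfun.scaleR_left inner_add_left)
    with 1 2 show ?thesis by linarith
  qed
  interpret proj: bounded_linear \<pi> by (rule \<pi>)
  interpret M: saddle_family "{-\<rho>..\<rho>}" "{u. \<forall>e\<in>E. u \<bullet> e = 0}" "span E" \<pi> J A "a0 / 2" r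
  proof
    show "subspace {u. \<forall>e\<in>E. u \<bullet> e = 0}" by (auto simp: subspace_def inner_add_left)
    show "closed (span E)" by (rule closed_span_finite[OF finE])
    show "x \<bullet> y = 0" if "x \<in> {u. \<forall>e\<in>E. u \<bullet> e = 0}" "y \<in> span E" for x y
      by (rule orth) (use that in auto)
    show "(J l has_derivative (\<lambda>h. h \<bullet> A l u)) (at u)" if "l \<in> {-\<rho>..\<rho>}" "norm u < r" for l u
      using has_derivative_diff[OF has_derivative_diff[OF L_deriv[OF in_V[OF that(2)], of l]
            has_derivative_const[of "L 0"]] has_derivative_const[of "l * G 0"]]
      by (simp add: J_def[abs_def])
    have on_ball: "continuous_on ({-\<rho>..\<rho>} \<times> ball 0 r) (\<lambda>w. f (snd w))"
      if "continuous_on (ball 0 r) f" for f :: "'a \<Rightarrow> 'b::topological_space"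
      by (rule continuous_on_compose2[OF that continuous_on_snd[OF continuous_on_id]]) auto
    show "continuous_on ({-\<rho>..\<rho>} \<times> ball 0 r) (\<lambda>(l, u). A l u)"
      unfolding A_def case_prod_unfold by (intro continuous_intros on_ball cont_L cont_G)
    have "continuous_on (ball 0 r) L" "continuous_on (ball 0 r) G"
      using has_derivative_continuous[OF L_grad[unfolded gderiv_def]]
        has_derivative_continuous[OF G_grad[unfolded gderiv_def]] in_V
      by (auto intro!: continuous_at_imp_continuous_on)
    then show "continuous_on ({-\<rho>..\<rho>} \<times> ball 0 r) (\<lambda>(l, u). J l u)"
      unfolding J_def case_prod_unfold by (intro continuous_intros on_ball)
    show "\<exists>d>0. \<forall>l\<in>{-\<rho>..\<rho>}. \<forall>u. norm u \<le> d \<longrightarrow> norm (A l u) < e" if "e > 0" for e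
    proof -
      have "isCont (grad L) 0" "isCont (grad G) 0"
        using cont_L cont_G r(1) by (auto simp: continuous_on_eq_continuous_at)
      then have "((\<lambda>u. norm (grad L u) + \<rho> * norm (grad G u)) \<longlongrightarrow> norm (grad L 0) + \<rho> * norm (grad G 0)) (at 0)"
        by (intro tendsto_intros) (auto simp: isCont_def)
      then have "eventually (\<lambda>u. norm (grad L u) + \<rho> * norm (grad G u) < e) (at 0)"
        using that grad_0 by (intro order_tendstoD) auto
      then obtain d where d: "d > 0" "\<And>u. u \<noteq> 0 \<Longrightarrow> norm u < d \<Longrightarrow> norm (grad L u) + \<rho> * norm (grad G u) < e"
        by (auto simp: eventually_at)
      \<comment> \<open>Halving \<open>d\<close> replaces the strict bound by the closed one;
        \<open>u = 0\<close>, excluded from the limit, is treated separately.\<close>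
      have "norm (A l u) < e" if l: "l \<in> {-\<rho>..\<rho>}" and u: "norm u \<le> d / 2" for l u
      proof (cases "u = 0")
        case False
        have "norm (A l u) \<le> norm (grad L u) + \<bar>l\<bar> * norm (grad G u)"
          unfolding A_def by (rule order_trans[OF norm_triangle_ineq]) simp
        also have "\<dots> \<le> norm (grad L u) + \<rho> * norm (grad G u)"
          using l by (intro add_left_mono mult_right_mono) auto
        also have "\<dots> < e" using d u False by (intro d(2)) auto
        finally show ?thesis .
      qed (use \<open>e > 0\<close> grad_0 in \<open>simp add: A_def\<close>)
      then show ?thesis using d(1) by (intro exI[of _ "d / 2"]) auto
    qed
    show "a0 / 2 * (norm (v - u))\<^sup>2 \<le> (A l v - A l u) \<bullet> (\<pi> (v - u) - ((v - u) - \<pi> (v - u)))"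
      if l: "l \<in> {-\<rho>..\<rho>}" and uv: "norm u < r" "norm v < r" for l u v
      unfolding \<sigma>_def[symmetric]
    proof (rule monotone_of_gateaux_derivative[OF \<open>subspace X\<close> \<open>closure X = UNIV\<close> \<sigma> _ _ lower[OF l] uv])
      show "continuous_on (ball 0 r) (A l)"
        unfolding A_def[abs_def] by (intro continuous_intros cont_L cont_G)
      show "has_gateaux_derivative (A l) (B w + l *\<^sub>R G2 w) w" if "w \<in> X" "norm w < r" for w
        unfolding A_def[abs_def] using H(2)[of w] that in_V[OF that(2)]
          \<open>\<forall>u\<in>V. self_adjoint (G2 u) \<and> has_gateaux_derivative (grad G) (G2 u) u\<close>
        by (intro has_gateaux_derivative_add_scaleR) auto
    qed auto
  qed (use \<pi>_Hp \<pi>_Hm a0 r grad_0 in \<open>auto simp: A_def J_def\<close>)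
  have Hp_eq: "Hp = {u. \<forall>e\<in>E. u \<bullet> e = 0}" and Hm_eq: "Hm = span E"
    using assms(13,14) Hp Hm by auto
  have Hp_comp: "Hp = orthogonal_comp Hm"
    unfolding Hp_eq Hm_eq orthogonal_comp_def orthogonal_def
    using orth by (auto simp: inner_commute span_base)
  have sum: "Hp + Hm = UNIV"
  proof -
    have "u \<in> Hp + Hm" for u
      using set_plus_intro[of "\<pi> u" Hp "u - \<pi> u" Hm] \<pi>_Hp \<pi>_Hm by (simp add: Hp_eq Hm_eq)
    then show ?thesis by blast
  qed
  have chart_domain: "M.chart_domain = (ball 0 M.normal_radius \<inter> Hp) + (ball 0 M.normal_radius \<inter> Hm)"
    unfolding Hp_eq Hm_eq by (rule M.chart_domain_eq)
  have normal_form: "L (M.chart l (p + m)) + l * G (M.chart l (p + m)) = L 0 + l * G 0 + (norm p)\<^sup>2 - (norm m)\<^sup>2"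
    if "l \<in> {-\<rho>..\<rho>}" "p \<in> ball 0 M.normal_radius \<inter> Hp" "m \<in> ball 0 M.normal_radius \<inter> Hm" for l p m
  proof -
    have "p + m \<in> M.chart_domain" unfolding chart_domain using that(2,3) by (rule set_plus_intro)
    from M.J_chart[OF that(1) this] M.\<pi>_add[of p m] that(2,3) show ?thesis
      by (simp add: J_def Hp_eq Hm_eq)
  qed
  have isolated: "isolated_critical_point (\<lambda>u. L u + l * G u) 0" if l: "l \<in> {-\<rho>..\<rho>}" for l
    unfolding isolated_critical_point_def
  proof
    show "critical_point (\<lambda>u. L u + l * G u) 0"
      using L_deriv[OF \<open>0 \<in> V\<close>, of l] by (simp add: critical_point_def A_def grad_0)
    have "\<not> critical_point (\<lambda>u. L u + l * G u) v" if v: "v \<noteq> 0" "norm v < r" for v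
    proof
      assume "critical_point (\<lambda>u. L u + l * G u) v"
      then have "(\<lambda>h. h \<bullet> A l v) = (\<lambda>h. 0)"
        using L_deriv[OF in_V[OF v(2)], of l] unfolding critical_point_def
        by (intro has_derivative_unique)
      then have "A l v \<bullet> A l v = 0" by meson
      then show False using M.critical_imp_zero[OF l v(2)] v(1) by simp
    qed
    then show "\<forall>\<^sub>F v in at 0. \<not> critical_point (\<lambda>u. L u + l * G u) v"
      using r(1) by (auto simp: eventually_at intro!: exI[of _ r])
  qed
  have range: "open (M.chart_range l)" "0 \<in> M.chart_range l" "M.chart_range l \<subseteq> V"
    if l: "l \<in> {-\<rho>..\<rho>}" for l
  proof -
    show "open (M.chart_range l)" by (rule M.open_chart_range[OF l])
    show "0 \<in> M.chart_range l" using M.chart_in_range[OF l M.zero_in_chart_domain] M.chart_0[OF l] by simp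
    show "M.chart_range l \<subseteq> V" using M.chart_range_subset[OF l] in_V by auto
  qed
  show ?thesis
  proof (rule conjI[OF Hp_comp conjI[OF sum]], rule exI[of _ \<rho>], rule conjI[OF \<rho>(1)],
      rule exI[of _ M.normal_radius], rule conjI[OF M.normal_radius(1)],
      rule exI[of _ M.chart_range], rule exI[of _ M.chart],
      intro conjI ballI allI impI range isolated normal_form M.chart_0)
    show "\<exists>\<psi>. homeomorphism ((ball 0 M.normal_radius \<inter> Hp) + (ball 0 M.normal_radius \<inter> Hm))
        (M.chart_range l) (M.chart l) \<psi>" if "l \<in> {-\<rho>..\<rho>}" for l
      using M.homeomorphism_chart[OF that] unfolding chart_domain by blast
    show "continuous_on ({-\<rho>..\<rho>} \<times> ((ball 0 M.normal_radius \<inter> Hp) + (ball 0 M.normal_radius \<inter> Hm)))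
        (\<lambda>(lam, u). M.chart lam u)"
      using M.continuous_on_chart unfolding chart_domain .
    fix K Kp assume K: "subspace K \<and> closed K \<and> Hm \<subseteq> K \<and> Kp = K \<inter> Hp"
    show "Kp = K \<inter> orthogonal_comp Hm" using K Hp_comp by simp
    show "\<exists>\<psi>. homeomorphism ((ball 0 M.normal_radius \<inter> Kp) + (ball 0 M.normal_radius \<inter> Hm))
        (M.chart_range l \<inter> K) (M.chart l) \<psi>" if "l \<in> {-\<rho>..\<rho>}" for l
      using M.homeomorphism_chart_subspace[OF that, of K] K unfolding Hp_eq Hm_eq by blast
    show "p \<in> ball 0 M.normal_radius \<inter> Hp" if "p \<in> ball 0 M.normal_radius \<inter> Kp" for p
      using that K by blast
  qed
qed

end
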